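(* Let $k\ge 0$ be an integer. There exist positive constants $c$ and $C$ such that, for all sufficiently large $n$, \[ c\, n^{k/2+1-1/(k+1)} \le \mathbb{E}[L_k(\mathcal{C}_n)] \le C\, n^{k/2+1-1/(k+1)}, \] where $\mathcal{C}_n$ is the random clique complex process on $n$ vertices and $L_k(\mathcal{C}_n)$ is its $k$-th lifetime sum.
   Context: Process: let $V$ be an $n$-point set and assign to each 2-element subset $e\subset V$ an independent random variable $u_e$ uniform on $[0,1]$. For $t\in[0,1]$, $C_n(t)$ is the clique complex of the graph on $V$ with edge set $\{e: u_e\le t\}$, i.e. the simplicial complex of all nonempty subsets of $V$ all of whose 2-element subsets $e$ satisfy $u_e\le t$. The random clique complex process is $\mathcal{C}_n=\{C_n(t)\}_{0\le t\le1}$, extended by the full simplex on $V$ for $t\ge1$. Betti numbers: $\beta_k(X)$ denotes the $k$-th reduced Betti number over $\mathbb{R}$ (dimension of the $k$-th homology of the augmented chain complex with $C_{-1}=\mathbb{R}$); in particular $\beta_0$ is the number of connected components minus one for nonempty $X$. Lifetime sum: for a right-continuous filtration $\mathcal{X}=\{X(t)\}_{t\ge0}$ of a finite simplicial complex, the $k$-th persistent homology $\bigoplus_{t\ge 0}H_k(X(t))$ (reduced homology over $\mathbb{R}$, with maps induced by inclusions), as a graded module over the ring $\mathbb{R}[\mathbb{R}_{\ge0}]$ of finite real linear combinations of monomials $z^t$, $t\ge0$, is isomorphic to $\bigoplus_{i=1}^p (z^{b_i})/(z^{d_i})\oplus\bigoplus_{i=p+1}^{p+q}(z^{b_i})$ for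 unique $p,q$ and birth times $b_i$ and death times $d_i>b_i$ (with $d_i=\infty$ for $i>p$). The lifetime sum is $L_k(\mathcal{X})=\sum_{i=1}^{p+q}(d_i-b_i)$; it equals $\int_0^\infty\beta_k(X(t))\,dt$. *)

theory Defs
  imports "HOL-Probability.Probability"
begin

text \<open>Reduced simplicial homology over the reals. A finite simplicial complex is a finite set
  \<open>X\<close> of finite nonempty sets closed under nonempty subsets; simplices are oriented by the linear
  order on the vertices, and a chain is identified with its coefficient function.\<close>

definition chains :: "nat \<Rightarrow> 'a set set \<Rightarrow> ('a set \<Rightarrow> real) set" where
  "chains k X = {f. \<forall>\<sigma>. f \<sigma> \<noteq> 0 \<longrightarrow> \<sigma> \<in> X \<and> card \<sigma> = k + 1}"

text \<open>Linear extension of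
  \<open>[v\<^sub>0, \<dots>, v\<^sub>k] \<mapsto> (\<Sum>i\<le>k. (-1)^i [v\<^sub>0, \<dots>, v\<^sub>i\<^sub>-\<^sub>1, v\<^sub>i\<^sub>+\<^sub>1, \<dots>, v\<^sub>k])\<close> for \<open>v\<^sub>0 < \<dots> < v\<^sub>k\<close>.
  The complex is augmented: a 0-chain has as boundary the sum of its coefficients, placed at the
  empty simplex, which spans the chains of degree -1.\<close>

definition boundary :: "('a::linorder set \<Rightarrow> real) \<Rightarrow> 'a set \<Rightarrow> real" where
  "boundary f = (\<lambda>\<tau>. \<Sum>\<sigma> | f \<sigma> \<noteq> 0. \<Sum>v | v \<in> \<sigma> \<and> \<sigma> - {v} = \<tau>. (-1) ^ card {w \<in> \<sigma>. w < v} * f \<sigma>)"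

definition cycles :: "nat \<Rightarrow> 'a::linorder set set \<Rightarrow> ('a set \<Rightarrow> real) set" where
  "cycles k X = {z \<in> chains k X. boundary z = (\<lambda>_. 0)}"

definition boundaries :: "nat \<Rightarrow> 'a::linorder set set \<Rightarrow> ('a set \<Rightarrow> real) set" where
  "boundaries k X = boundary ` chains (k + 1) X"

definition homologous ::
  "nat \<Rightarrow> 'a::linorder set set \<Rightarrow> (('a set \<Rightarrow> real) \<times> ('a set \<Rightarrow> real)) set" where
  "homologous k X =
     {(z, w). z \<in> cycles k X \<and> w \<in> cycles k X \<and> (\<lambda>\<sigma>. z \<sigma> - w \<sigma>) \<in> boundaries k X}"

definition hom_class ::
  "nat \<Rightarrow> 'a::linorder set set \<Rightarrow> ('a set \<Rightarrow> real) \<Rightarrow> ('a set \<Rightarrow> real) set" where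
  "hom_class k X z = homologous k X `` {z}"

definition homology :: "nat \<Rightarrow> 'a::linorder set set \<Rightarrow> ('a set \<Rightarrow> real) set set" where
  "homology k X = cycles k X // homologous k X"

text \<open>A list of pairs \<open>(b\<^sub>i, d\<^sub>i)\<close> encodes the graded module given by the direct sum of the
  \<open>(z^b\<^sub>i) / (z^d\<^sub>i)\<close>, the denominator being 0 if \<open>d\<^sub>i = \<infinity>\<close>. Its i-th summand is one-dimensional,
  spanned by the class of \<open>z^t\<close>, in the degrees \<open>b\<^sub>i \<le> t < d\<^sub>i\<close>, and zero in all others. The vector
  \<open>x\<close> below collects the coordinates with respect to these classes.\<close>

definition bar_component :: "(real \<times> ereal) list \<Rightarrow> real \<Rightarrow> (nat \<Rightarrow> real) set" where
  "bar_component bs t =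
     {x. \<forall>i. x i \<noteq> 0 \<longrightarrow> i < length bs \<and> fst (bs ! i) \<le> t \<and> ereal t < snd (bs ! i)}"

text \<open>Multiplication by \<open>z^s\<close>, from degree \<open>t\<close> to degree \<open>t + s\<close>.\<close>

definition bar_shift :: "(real \<times> ereal) list \<Rightarrow> real \<Rightarrow> real \<Rightarrow> (nat \<Rightarrow> real) \<Rightarrow> nat \<Rightarrow> real" where
  "bar_shift bs t s x = (\<lambda>i. if ereal (t + s) < snd (bs ! i) then x i else 0)"

text \<open>An isomorphism of graded modules is a family of linear bijections \<open>\<phi> t\<close> between the components
  of degree \<open>t\<close> that commutes with multiplication by all \<open>z^s\<close>. On persistent homology, \<open>z^s\<close> acts by
  the map induced by the inclusion of \<open>X t\<close> into \<open>X (t + s)\<close>, which sends the class of a cycle to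
  the class of the same cycle.\<close>

definition is_barcode ::
  "nat \<Rightarrow> (real \<Rightarrow> 'a::linorder set set) \<Rightarrow> (real \<times> ereal) list \<Rightarrow> bool" where
  "is_barcode k X bs \<longleftrightarrow>
     (\<forall>(b, d) \<in> set bs. 0 \<le> b \<and> ereal b < d) \<and>
     (\<exists>\<phi> :: real \<Rightarrow> ('a set \<Rightarrow> real) set \<Rightarrow> nat \<Rightarrow> real. \<forall>t\<ge>0.
        bij_betw (\<phi> t) (homology k (X t)) (bar_component bs t) \<and>
        (\<forall>z \<in> cycles k (X t). \<forall>w \<in> cycles k (X t).
           \<phi> t (hom_class k (X t) (\<lambda>\<sigma>. z \<sigma> + w \<sigma>)) =
             (\<lambda>i. \<phi> t (hom_class k (X t) z) i + \<phi> t (hom_class k (X t) w) i)) \<and>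
        (\<forall>r. \<forall>z \<in> cycles k (X t).
           \<phi> t (hom_class k (X t) (\<lambda>\<sigma>. r * z \<sigma>)) = (\<lambda>i. r * \<phi> t (hom_class k (X t) z) i)) \<and>
        (\<forall>s\<ge>0. \<forall>z \<in> cycles k (X t).
           \<phi> (t + s) (hom_class k (X (t + s)) z) = bar_shift bs t s (\<phi> t (hom_class k (X t) z))))"

text \<open>A right-continuous filtration of a finite complex has a barcode, unique up to the order of
  its entries, so the choice does not affect the lifetime sum.\<close>

definition barcode :: "nat \<Rightarrow> (real \<Rightarrow> 'a::linorder set set) \<Rightarrow> (real \<times> ereal) list" where
  "barcode k X = (SOME bs. is_barcode k X bs)"

definition lifetime_sum :: "nat \<Rightarrow> (real \<Rightarrow> 'a::linorder set set) \<Rightarrow> ennreal" where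
  "lifetime_sum k X = (\<Sum>(b, d) \<leftarrow> barcode k X. e2ennreal (d - ereal b))"

definition pairs :: "'a set \<Rightarrow> 'a set set" where
  "pairs V = {e. e \<subseteq> V \<and> card e = 2}"

definition clique_complex :: "'a set \<Rightarrow> 'a set set \<Rightarrow> 'a set set" where
  "clique_complex V E = {\<sigma>. \<sigma> \<noteq> {} \<and> \<sigma> \<subseteq> V \<and> pairs \<sigma> \<subseteq> E}"

definition clique_process :: "nat \<Rightarrow> (nat set \<Rightarrow> real) \<Rightarrow> real \<Rightarrow> nat set set" where
  "clique_process n u t =
     (if t < 1 then clique_complex {..<n} {e \<in> pairs {..<n}. u e \<le> t}
      else {\<sigma>. \<sigma> \<noteq> {} \<and> \<sigma> \<subseteq> {..<n}})"

definition edge_weights :: "nat \<Rightarrow> (nat set \<Rightarrow> real) measure" where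
  "edge_weights n = PiM (pairs {..<n}) (\<lambda>_. uniform_measure lborel {0..1})"

end

theory Submission
  imports Defs "HOL-Library.Function_Algebras"
begin

text \<open>
  The lifetime sum is the integral over \<open>t\<close> of the Betti number \<open>\<beta>\<^sub>k\<close> of \<open>C\<^sub>n(t)\<close>, so everything reduces
  to expected Betti numbers of the random clique complex with edge probability \<open>p\<close>. Let \<open>f\<^sub>j\<close> be its
  number of \<open>j\<close>-simplices and let \<open>T\<close> be such that \<open>n T^(k+1) = 1\<close>. The lower bound follows from
  \<open>\<beta>\<^sub>k \<ge> f\<^sub>k - f\<^sub>k\<^sub>-\<^sub>1 - f\<^sub>k\<^sub>+\<^sub>1\<close> for \<open>p\<close> between \<open>T / 8\<close> and \<open>T / 4\<close>.

  For the upper bound, \<open>\<beta>\<^sub>k \<le> f\<^sub>k\<close> suffices if \<open>p \<le> T\<close>. For \<open>p > T\<close> consider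
  \<open>A = I - \<partial>\<partial>\<^sup>* / (n p^(k+1)) - \<partial>\<^sup>*\<partial> / (n p^k)\<close> on the \<open>k\<close>-chains. It is symmetric and fixes all
  harmonic chains, hence \<open>\<beta>\<^sub>k\<close> is at most the trace of \<open>A^m\<close> for even \<open>m\<close>. This trace is a sum over closed
  walks on \<open>k\<close>-simplices. Each step goes through a vertex \<open>v\<close> and has a weight depending only on the
  edges from \<open>v\<close> to the current simplex, centered if \<open>v\<close> is not in the simplex. A step through a vertex
  visited before costs a factor \<open>1 / (n p^(k+1))\<close>, and the expectation vanishes unless a fixed proportion
  of the steps is of this kind. So the expected trace is at most the expectation of \<open>f\<^sub>k\<close> times an
  arbitrarily high power of \<open>1 / (n p^(k+1)) = (T / p)^(k+1)\<close>, which makes it integrable over \<open>p > T\<close>.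
\<close>

section \<open>Linear algebra\<close>

text \<open>On the full simplex the two Laplacians add up to n times the identity, so
  \<open>A\<close> vanishes there at p = 1. For random edges, an entry between \<open>\<rho>\<close>
  and a neighbour \<open>\<sigma>\<close> that arises by exchanging a vertex for v gets two
  contributions of opposite sign: one from the common face, tied to v being joined to the k vertices
  of \<open>\<rho> \<inter> \<sigma>\<close>, and one from the common coface, present if v is joined
  to all k + 1 vertices of \<open>\<rho>\<close>. Division by p^k and p^(k+1) gives both indicators
  mean 1, so a step to an unseen vertex averages to zero. The estimate by f_k alone fails past T
  because the mean of f_k grows with p. A decay like (T / p)^2 is all that the integral requires, so
  the number m of steps depends on k only.

  The other obstacle is that the lifetime sum refers to some chosen barcode. Existence comes from a
  basis adapted simultaneously to the flag of cycle spaces and to the flag of boundary spaces;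
  conversely, every barcode shows the Betti number in each degree t. Only then does the lifetime sum
  become an integral of Betti numbers.\<close>

lemma (in vector_space) independent_family:
  assumes "finite E" and ind: "\<And>c. (\<Sum>e\<in>E. scale (c e) (g e)) = 0 \<Longrightarrow> \<forall>e\<in>E. c e = 0"
  shows "inj_on g E" "independent (g ` E)"
proof -
  show inj: "inj_on g E"
  proof (rule inj_onI, rule ccontr)
    fix a b assume ab: "a \<in> E" "b \<in> E" "g a = g b" "a \<noteq> b"
    let ?c = "\<lambda>e. if e = a then 1 else if e = b then -1 else 0"
    have "(\<Sum>e\<in>E. scale (?c e) (g e)) = (\<Sum>e\<in>{a, b}. scale (?c e) (g e))"
      using ab \<open>finite E\<close> by (intro sum.mono_neutral_right) auto
    also have "\<dots> = 0"
      using ab by simp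
    finally show False
      using ind[of ?c] ab by auto
  qed
  show "independent (g ` E)"
    unfolding dependent_finite[OF finite_imageI[OF \<open>finite E\<close>]]
  proof safe
    fix u e assume u: "(\<Sum>v\<in>g ` E. scale (u v) v) = 0" and e: "e \<in> E" "u (g e) \<noteq> 0"
    have "(\<Sum>e\<in>E. scale (u (g e)) (g e)) = 0"
      using u by (simp add: sum.reindex[OF inj])
    from ind[OF this] e show False by blast
  qed
qed

text \<open>Otherwise \<open>s\<close> would be expressed through the remaining vectors of
  \<open>S\<close>. In the construction of barcodes this makes coordinates modulo boundaries
  unique.\<close>

lemma (in vector_space) independent_sum_in_span:
  assumes S: "independent S" and F: "finite F" "F \<subseteq> S" and G: "G \<subseteq> S" "F \<inter> G = {}"
    and sum: "(\<Sum>s\<in>F. scale (c s) s) \<in> span G" and s: "s \<in> F"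
  shows "c s = 0"
proof (rule ccontr)
  assume c: "c s \<noteq> 0"
  have "scale (c s) s = (\<Sum>s\<in>F. scale (c s) s) - (\<Sum>s\<in>F - {s}. scale (c s) s)"
    using F s by (simp add: sum.remove)
  also have "\<dots> \<in> span (S - {s})"
  proof (rule span_diff)
    show "(\<Sum>s\<in>F. scale (c s) s) \<in> span (S - {s})"
      using sum span_mono[of G "S - {s}"] G s by blast
    show "(\<Sum>s\<in>F - {s}. scale (c s) s) \<in> span (S - {s})"
      using F by (intro span_sum span_scale span_base) auto
  qed
  finally have "scale (inverse (c s)) (scale (c s) s) \<in> span (S - {s})"
    by (rule span_scale)
  then have "s \<in> span (S - {s})" using c by simp
  then show False using S F(2) s by (auto simp: dependent_def)
qed

text \<open>Linearity is demanded on \<open>Z\<close> only, since two of the maps to which this is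
  applied are not known to be linear elsewhere: \<open>boundary\<close> is a sum over the support,
  with default value 0 if the support is infinite, and coordinates of homology classes are
  meaningful only for cycles.\<close>

lemma (in vector_space_pair) rank_nullity:
  assumes Z: "vs1.subspace Z" "finite D" "Z \<subseteq> vs1.span D"
    and add: "\<And>x y. x \<in> Z \<Longrightarrow> y \<in> Z \<Longrightarrow> g (x + y) = g x + g y"
    and scale: "\<And>r x. x \<in> Z \<Longrightarrow> g (s1 r x) = s2 r (g x)"
  shows "vs1.dim Z = vs1.dim {z \<in> Z. g z = 0} + vs2.dim (g ` Z)"
proof -
  define W where "W = {z \<in> Z. g z = 0}"
  have g0: "g 0 = 0"
    using scale[of 0 0] vs1.subspace_0[OF Z(1)] by simp
  have gsum: "g (\<Sum>e\<in>F. s1 (c e) e) = (\<Sum>e\<in>F. s2 (c e) (g e))"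
    if "finite F" "F \<subseteq> Z" for F c
    using that
  proof (induction F rule: finite_induct)
    case (insert x F)
    then show ?case
      by (simp add: add scale vs1.subspace_sum[OF Z(1)] vs1.subspace_scale[OF Z(1)] subset_iff)
  qed (simp add: g0)
  obtain D1 where D1: "D1 \<subseteq> W" "vs1.independent D1" "W \<subseteq> vs1.span D1"
    using vs1.maximal_independent_subset[of W] by blast
  have "D1 \<subseteq> Z" using D1 by (auto simp: W_def)
  then obtain D2 where D2: "D1 \<subseteq> D2" "D2 \<subseteq> Z" "vs1.independent D2" "Z \<subseteq> vs1.span D2"
    using vs1.maximal_independent_subset_extend[of D1 Z] D1 by blast
  have fin: "finite D2"
    using vs1.independent_span_bound[OF Z(2) D2(3)] D2(2) Z(3) by blast
  define E where "E = D2 - D1"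
  have finE: "finite E" "finite D1" "E \<subseteq> Z" and DE: "D2 = D1 \<union> E" "D1 \<inter> E = {}"
    using fin D2 by (auto simp: E_def finite_subset)
  have ind: "\<forall>e\<in>E. c e = 0" if c: "(\<Sum>e\<in>E. s2 (c e) (g e)) = 0" for c
  proof -
    define y where "y = (\<Sum>e\<in>E. s1 (c e) e)"
    have "y \<in> Z"
      unfolding y_def using finE by (intro vs1.subspace_sum[OF Z(1)] vs1.subspace_scale[OF Z(1)]) auto
    then have "y \<in> W"
      using c gsum[OF finE(1,3), of c] by (simp add: W_def y_def)
    then have "y \<in> vs1.span D1" using D1 by blast
    then obtain b where b: "y = (\<Sum>e\<in>D1. s1 (b e) e)"
      unfolding vs1.span_finite[OF finE(2)] by auto
    define u where "u e = (if e \<in> E then c e else - b e)" for e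
    have "(\<Sum>e\<in>D2. s1 (u e) e) = (\<Sum>e\<in>D1. s1 (u e) e) + (\<Sum>e\<in>E. s1 (u e) e)"
      unfolding DE(1) using finE DE(2) by (intro sum.union_disjoint) auto
    also have "(\<Sum>e\<in>D1. s1 (u e) e) = - y"
      unfolding b sum_negf[symmetric] u_def using DE by (intro sum.cong) auto
    also have "(\<Sum>e\<in>E. s1 (u e) e) = y"
      unfolding y_def u_def by (intro sum.cong) auto
    finally have "(\<Sum>e\<in>D2. s1 (u e) e) = 0" by simp
    moreover have "\<not> (\<exists>u. (\<exists>v\<in>D2. u v \<noteq> 0) \<and> (\<Sum>v\<in>D2. s1 (u v) v) = 0)"
      using D2(3) unfolding vs1.dependent_finite[OF fin] .
    ultimately have "\<forall>e\<in>D2. u e = 0"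
      by blast
    then have "\<forall>e\<in>E. u e = 0" using DE by auto
    then show ?thesis by (simp add: u_def)
  qed
  note gE = vs2.independent_family[OF finE(1) ind]
  have "g z \<in> vs2.span (g ` E)" if "z \<in> Z" for z
  proof -
    from that D2(4) obtain c where c: "z = (\<Sum>e\<in>D2. s1 (c e) e)"
      unfolding vs1.span_finite[OF fin] by auto
    have "g z = (\<Sum>e\<in>D2. s2 (c e) (g e))"
      unfolding c using gsum[OF fin D2(2)] by simp
    also have "\<dots> = (\<Sum>e\<in>E. s2 (c e) (g e))"
      using D1(1) fin by (intro sum.mono_neutral_right) (auto simp: E_def W_def)
    also have "\<dots> \<in> vs2.span (g ` E)"
      by (intro vs2.span_sum vs2.span_scale vs2.span_base) auto
    finally show ?thesis .
  qed
  then have "vs2.dim (g ` Z) = card (g ` E)"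
    using gE finE by (intro vs2.basis_card_eq_dim[symmetric]) auto
  moreover have "vs1.dim Z = card D2" "vs1.dim W = card D1"
    using D1 D2 by (simp_all add: vs1.basis_card_eq_dim)
  moreover have "card D2 = card D1 + card E"
    unfolding DE(1) using finE DE(2) by (intro card_Un_disjoint) auto
  ultimately show ?thesis
    by (simp add: card_image[OF gE(1)] W_def)
qed

text \<open>Once the flag of the \<open>B\<close>'s is filled up to \<open>span S\<close>, a vector of \<open>Z \<inter> B'\<close> is corrected by old
  basis vectors only inside \<open>Z \<inter> span S\<close>, where the basis is already adapted.\<close>

lemma (in vector_space) extend_adapted_basis:
  assumes S: "independent S" "S \<subseteq> B'" and B': "subspace B'"
    and zs: "sorted_wrt (\<subseteq>) zs" "\<And>Z. Z \<in> set zs \<Longrightarrow> subspace Z"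
    and ad: "\<And>Z. Z \<in> set zs \<Longrightarrow> Z \<inter> span S \<subseteq> span (S \<inter> Z)"
  shows "\<exists>S'. independent S' \<and> S \<subseteq> S' \<and> S' \<subseteq> B' \<and> S' \<subseteq> S \<union> \<Union>(set zs) \<and>
    (\<forall>Z\<in>set zs. Z \<inter> B' \<subseteq> span (S' \<inter> Z))"
  using zs ad
proof (induction zs rule: rev_induct)
  case Nil
  then show ?case using S by auto
next
  case (snoc Z zs)
  have chain: "\<And>Y. Y \<in> set zs \<Longrightarrow> Y \<subseteq> Z"
    using snoc.prems(1) by (auto simp: sorted_wrt_append)
  have "\<exists>S'. independent S' \<and> S \<subseteq> S' \<and> S' \<subseteq> B' \<and> S' \<subseteq> S \<union> \<Union>(set zs) \<and>
    (\<forall>Z\<in>set zs. Z \<inter> B' \<subseteq> span (S' \<inter> Z))"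
    using snoc.prems by (intro snoc.IH) (auto simp: sorted_wrt_append)
  then obtain S1 where S1: "independent S1" "S \<subseteq> S1" "S1 \<subseteq> B'" "S1 \<subseteq> S \<union> \<Union>(set zs)"
    "\<And>Y. Y \<in> set zs \<Longrightarrow> Y \<inter> B' \<subseteq> span (S1 \<inter> Y)"
    by blast
  obtain S2 where S2: "S1 \<subseteq> S2" "S2 \<subseteq> S1 \<union> (Z \<inter> B')" "independent S2" "S1 \<union> (Z \<inter> B') \<subseteq> span S2"
    using maximal_independent_subset_extend[OF Un_upper1[of S1 "Z \<inter> B'"] S1(1)] by blast
  \<comment> \<open>Vectors added for earlier members of the chain lie in \<open>Z\<close> as well,
    so a vector of \<open>S2\<close> outside \<open>Z\<close> was already in
    \<open>S\<close>.\<close>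
  have old: "S2 \<subseteq> S \<union> Z"
    using S1(4) S2(2) chain by blast
  have Zsub: "subspace Z" using snoc.prems(2) by simp
  have "x \<in> span (S2 \<inter> Z)" if x: "x \<in> Z \<inter> B'" for x
  proof -
    have "x \<in> span ((S2 \<inter> Z) \<union> (S2 - Z))"
      using x S2(4) by (auto simp: Int_Diff_Un)
    then obtain y w where yw: "x = y + w" "y \<in> span (S2 \<inter> Z)" "w \<in> span (S2 - Z)"
      by (auto simp: span_Un)
    have "y \<in> Z" using span_minimal[of "S2 \<inter> Z" Z] Zsub yw(2) by blast
    then have "w \<in> Z" using x yw(1) subspace_diff[OF Zsub, of x y] by simp
    moreover have "w \<in> span S" using yw(3) span_mono[of "S2 - Z" S] old by blast
    ultimately have "w \<in> span (S \<inter> Z)" using snoc.prems(3)[of Z] by auto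
    then have "w \<in> span (S2 \<inter> Z)"
      using span_mono[of "S \<inter> Z" "S2 \<inter> Z"] S1(2) S2(1) by blast
    then show ?thesis using yw by (simp add: span_add)
  qed
  moreover have "Y \<inter> B' \<subseteq> span (S2 \<inter> Y)" if "Y \<in> set zs" for Y
    using S1(5)[OF that] span_mono[of "S1 \<inter> Y" "S2 \<inter> Y"] S2(1) by blast
  moreover have "S2 \<subseteq> S \<union> \<Union>(set (zs @ [Z]))" "S2 \<subseteq> B'" "S \<subseteq> S2"
    using S2 S1 by auto
  ultimately show ?case
    using S2(3) by (intro exI[of _ S2]) auto
qed

text \<open>This is the linear algebra behind the decomposition into intervals: two flags always
  have a common adapted basis. The flag \<open>bs\<close> is filled one subspace at a time, and at
  each stage the basis found so far stays adapted to the intersections of the flag \<open>zs\<close>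
  with its span.\<close>

lemma (in vector_space) adapted_basis:
  assumes zs: "sorted_wrt (\<subseteq>) zs" "\<And>Z. Z \<in> set zs \<Longrightarrow> subspace Z"
    and bs: "sorted_wrt (\<subseteq>) bs" "\<And>B. B \<in> set bs \<Longrightarrow> subspace B"
  shows "\<exists>S. independent S \<and> (\<forall>W\<in>set zs \<union> set bs. span (S \<inter> W) = W)"
proof -
  \<comment> \<open>With the whole space as last member of the flag, being adapted to it inside
    \<open>B\<close> says that the vectors found span \<open>B\<close>.\<close>
  have zs': "sorted_wrt (\<subseteq>) (zs @ [UNIV])" "\<And>Z. Z \<in> set (zs @ [UNIV]) \<Longrightarrow> subspace Z"
    using zs by (auto simp: sorted_wrt_append)
  have "\<exists>S. independent S \<and> S \<subseteq> \<Union>(set bs) \<and> (\<forall>B\<in>set bs. B \<subseteq> span (S \<inter> B)) \<and>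
     (\<forall>Z\<in>set (zs @ [UNIV]). Z \<inter> span S \<subseteq> span (S \<inter> Z))"
    using bs
  proof (induction bs rule: rev_induct)
    case Nil
    show ?case by (intro exI[of _ "{}"]) (auto simp: span_zero independent_empty)
  next
    case (snoc B bs)
    have chain: "\<And>Y. Y \<in> set bs \<Longrightarrow> Y \<subseteq> B"
      using snoc.prems(1) by (auto simp: sorted_wrt_append)
    have "\<exists>S. independent S \<and> S \<subseteq> \<Union>(set bs) \<and> (\<forall>B\<in>set bs. B \<subseteq> span (S \<inter> B)) \<and>
     (\<forall>Z\<in>set (zs @ [UNIV]). Z \<inter> span S \<subseteq> span (S \<inter> Z))"
      using snoc.prems by (intro snoc.IH) (auto simp: sorted_wrt_append)
    then obtain S where S: "independent S" "S \<subseteq> \<Union>(set bs)"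
      "\<forall>B\<in>set bs. B \<subseteq> span (S \<inter> B)"
      "\<forall>Z\<in>set (zs @ [UNIV]). Z \<inter> span S \<subseteq> span (S \<inter> Z)"
      by blast
    have Bsub: "subspace B" using snoc.prems(2) by simp
    have "\<exists>S'. independent S' \<and> S \<subseteq> S' \<and> S' \<subseteq> B \<and> S' \<subseteq> S \<union> \<Union>(set (zs @ [UNIV])) \<and>
        (\<forall>Z\<in>set (zs @ [UNIV]). Z \<inter> B \<subseteq> span (S' \<inter> Z))"
      using S(2) chain by (intro extend_adapted_basis S(1) bspec[OF S(4)] zs' Bsub) auto
    then obtain S' where S': "independent S'" "S \<subseteq> S'" "S' \<subseteq> B"
        "\<forall>Z\<in>set (zs @ [UNIV]). Z \<inter> B \<subseteq> span (S' \<inter> Z)"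
      by blast
    have "span S' \<subseteq> B" using S'(3) Bsub by (rule span_minimal)
    moreover have "B \<subseteq> span (S' \<inter> B)" using S'(3) bspec[OF S'(4), of UNIV] by (simp add: Int_absorb2)
    moreover have "Y \<subseteq> span (S' \<inter> Y)" if "Y \<in> set bs" for Y
      using bspec[OF S(3) that] span_mono[of "S \<inter> Y" "S' \<inter> Y"] S'(2) by blast
    ultimately have "\<forall>B\<in>set (bs @ [B]). B \<subseteq> span (S' \<inter> B)"
      by auto
    moreover have "Z \<inter> span S' \<subseteq> span (S' \<inter> Z)" if "Z \<in> set (zs @ [UNIV])" for Z
      using bspec[OF S'(4) that] \<open>span S' \<subseteq> B\<close> by blast
    moreover have "S' \<subseteq> \<Union>(set (bs @ [B]))"
      using S'(3) by auto
    ultimately show ?case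
      using S'(1) by blast
  qed
  then obtain S where S: "independent S" "S \<subseteq> \<Union>(set bs)"
      "\<forall>B\<in>set bs. B \<subseteq> span (S \<inter> B)"
      "\<forall>Z\<in>set (zs @ [UNIV]). Z \<inter> span S \<subseteq> span (S \<inter> Z)"
    by blast
  \<comment> \<open>One more extension, now inside the whole space, supplies what the members of
    \<open>zs\<close> still lack outside the largest member of \<open>bs\<close>.\<close>
  have "\<exists>S'. independent S' \<and> S \<subseteq> S' \<and> S' \<subseteq> UNIV \<and> S' \<subseteq> S \<union> \<Union>(set (zs @ [UNIV])) \<and>
        (\<forall>Z\<in>set (zs @ [UNIV]). Z \<inter> UNIV \<subseteq> span (S' \<inter> Z))"
    by (intro extend_adapted_basis S(1) bspec[OF S(4)] zs') auto
  then obtain S' where S': "independent S'" "S \<subseteq> S'"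
        "\<And>Z. Z \<in> set zs \<Longrightarrow> Z \<subseteq> span (S' \<inter> Z)"
    by auto
  have "span (S' \<inter> W) = W" if W: "W \<in> set zs \<union> set bs" for W
  proof
    show "span (S' \<inter> W) \<subseteq> W"
      using W zs(2) bs(2) by (intro span_minimal) auto
    show "W \<subseteq> span (S' \<inter> W)"
      using W S'(3) bspec[OF S(3), of W] span_mono[of "S \<inter> W" "S' \<inter> W"] S'(2) by blast
  qed
  then show ?thesis using S'(1) by blast
qed

section \<open>Real functions supported on a finite set\<close>

interpretation fs: vector_space "\<lambda>(r::real) (f :: 'b \<Rightarrow> real) x. r * f x"
  by standard (auto simp: algebra_simps fun_eq_iff)

interpretation fsp: vector_space_pair "\<lambda>(r::real) (f :: 'b \<Rightarrow> real) x. r * f x"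
    "\<lambda>(r::real) (f :: 'c \<Rightarrow> real) x. r * f x" ..

lemma sum_fun_apply: "(\<Sum>i\<in>I. f i) x = (\<Sum>i\<in>I. f i x :: real)"
  by (induction I rule: infinite_finite_induct) auto

lemma span_indicators:
  assumes "finite I"
  shows "{f :: 'b \<Rightarrow> real. \<forall>x. f x \<noteq> 0 \<longrightarrow> x \<in> I} = fs.span ((\<lambda>x. indicator {x}) ` I)"
    (is "?V = fs.span ?D")
proof
  have sub: "fs.subspace ?V"
    unfolding fs.subspace_def by (auto; metis add.right_neutral)
  show "fs.span ?D \<subseteq> ?V"
    by (rule fs.span_minimal[OF _ sub]) (auto simp: indicator_def split: if_splits)
  show "?V \<subseteq> fs.span ?D"
  proof
    fix f assume f: "f \<in> ?V"
    have "f = (\<Sum>x\<in>I. (\<lambda>y. f x * indicator {x} y))"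
    proof
      fix y
      have "(\<Sum>x\<in>I. f x * indicator {x} y) = (if y \<in> I then f y else 0)"
        using assms by (subst sum.cong[of I I _ "\<lambda>x. if x = y then f y else 0"])
          (auto simp: indicator_def)
      then show "f y = (\<Sum>x\<in>I. (\<lambda>y. f x * indicator {x} y)) y"
        using f by (auto simp: sum_fun_apply)
    qed
    also have "\<dots> \<in> fs.span ?D"
      by (intro fs.span_sum fs.span_scale fs.span_base) auto
    finally show "f \<in> fs.span ?D" .
  qed
qed

lemma dim_supported:
  assumes "finite I"
  shows "fs.dim {f :: 'b \<Rightarrow> real. \<forall>x. f x \<noteq> 0 \<longrightarrow> x \<in> I} = card I"
proof -
  let ?i = "\<lambda>x::'b. indicator {x} :: 'b \<Rightarrow> real"
  have ind: "\<forall>e\<in>I. c e = 0" if "(\<Sum>e\<in>I. (\<lambda>y. c e * ?i e y)) = 0" for c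
  proof
    fix e assume e: "e \<in> I"
    have "0 = (\<Sum>x\<in>I. (\<lambda>y. c x * ?i x y)) e" using that by simp
    also have "\<dots> = (\<Sum>x\<in>I. c x * ?i x e)" by (rule sum_fun_apply)
    also have "\<dots> = c e"
      using assms e by (subst sum.cong[of I I _ "\<lambda>x. if x = e then c e else 0"])
          (auto simp: indicator_def)
    finally show "c e = 0" by simp
  qed
  note * = fs.independent_family[OF assms, of ?i, OF ind]
  show ?thesis
    unfolding span_indicators[OF assms] using *
    by (simp add: fs.dim_eq_card_independent card_image)
qed

section \<open>Chains, boundaries and homology\<close>

text \<open>The entry of the boundary matrix: the sum has at most one term, so it is 1 or -1 if
  \<open>\<tau>\<close> is a facet of \<open>\<sigma>\<close> and 0 otherwise. It does not refer to
  a complex, so one matrix serves all complexes on the same vertices.\<close>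

definition incidence :: "'a::linorder set \<Rightarrow> 'a set \<Rightarrow> real" where
  "incidence \<tau> \<sigma> = (\<Sum>v | v \<in> \<sigma> \<and> \<sigma> - {v} = \<tau>. (-1) ^ card {w \<in> \<sigma>. w < v})"

lemma boundary_eq:
  assumes "finite F" "\<And>\<sigma>. f \<sigma> \<noteq> 0 \<Longrightarrow> \<sigma> \<in> F"
  shows "boundary f = (\<lambda>\<tau>. \<Sum>\<sigma>\<in>F. incidence \<tau> \<sigma> * f \<sigma>)"
proof
  fix \<tau>
  have "boundary f \<tau> = (\<Sum>\<sigma> | f \<sigma> \<noteq> 0. incidence \<tau> \<sigma> * f \<sigma>)"
    unfolding boundary_def incidence_def by (simp add: sum_distrib_right)
  also have "\<dots> = (\<Sum>\<sigma>\<in>F. incidence \<tau> \<sigma> * f \<sigma>)"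
    using assms by (intro sum.mono_neutral_left) auto
  finally show "boundary f \<tau> = (\<Sum>\<sigma>\<in>F. incidence \<tau> \<sigma> * f \<sigma>)" .
qed

lemma boundary_chains:
  assumes "finite X" "f \<in> chains k X"
  shows "boundary f = (\<lambda>\<tau>. \<Sum>\<sigma>\<in>X. incidence \<tau> \<sigma> * f \<sigma>)"
  using assms by (intro boundary_eq) (auto simp: chains_def)

lemma subspace_chains: "fs.subspace (chains k X)"
  unfolding fs.subspace_def chains_def by (auto; metis add.right_neutral)

lemma boundary_add:
  assumes "finite X" "f \<in> chains k X" "g \<in> chains k X"
  shows "boundary (f + g) = boundary f + boundary g"
  using assms fs.subspace_add[OF subspace_chains, of f k X g]
  by (simp add: boundary_chains[of X _ k] fun_eq_iff sum.distrib distrib_left)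

lemma boundary_scale:
  assumes "finite X" "f \<in> chains k X"
  shows "boundary (\<lambda>\<sigma>. r * f \<sigma>) = (\<lambda>\<sigma>. r * boundary f \<sigma>)"
  using assms fs.subspace_scale[OF subspace_chains, of f k X r]
  by (simp add: boundary_chains[of X _ k] fun_eq_iff sum_distrib_left mult_ac)

lemma subspace_cycles:
  assumes "finite X"
  shows "fs.subspace (cycles k X)"
  unfolding fs.subspace_def
proof (intro conjI ballI allI)
  show "0 \<in> cycles k X"
    using fs.subspace_0[OF subspace_chains, of k X]
    by (auto simp: cycles_def boundary_def)
  show "x + y \<in> cycles k X" if "x \<in> cycles k X" "y \<in> cycles k X" for x y
    using that fs.subspace_add[OF subspace_chains, of x k X y] boundary_add[OF assms, of x k y]
    by (auto simp: cycles_def)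
  show "(\<lambda>\<sigma>. r * x \<sigma>) \<in> cycles k X" if "x \<in> cycles k X" for x r
    using that fs.subspace_scale[OF subspace_chains, of x k X r] boundary_scale[OF assms, of x k r]
    by (auto simp: cycles_def)
qed

lemma subspace_boundaries:
  assumes "finite X"
  shows "fs.subspace (boundaries k X)"
  unfolding fs.subspace_def
proof (intro conjI ballI allI)
  have "boundary (0 :: 'a set \<Rightarrow> real) = 0" by (auto simp: boundary_def)
  then show "0 \<in> boundaries k X"
    unfolding boundaries_def
    by (intro image_eqI[where x = 0] fs.subspace_0[OF subspace_chains]) simp
  show "x + y \<in> boundaries k X" if xy: "x \<in> boundaries k X" "y \<in> boundaries k X" for x y
  proof -
    from xy obtain f g where fg: "f \<in> chains (k + 1) X" "g \<in> chains (k + 1) X"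
      "x = boundary f" "y = boundary g" unfolding boundaries_def by blast
    then show ?thesis
      unfolding boundaries_def
      by (intro image_eqI[where x = "f + g"] fs.subspace_add[OF subspace_chains])
        (simp_all add: boundary_add[OF assms])
  qed
  show "(\<lambda>\<sigma>. r * x \<sigma>) \<in> boundaries k X" if x: "x \<in> boundaries k X" for x r
  proof -
    from x obtain f where f: "f \<in> chains (k + 1) X" "x = boundary f"
      unfolding boundaries_def by blast
    then show ?thesis
      unfolding boundaries_def
      by (intro image_eqI[where x = "\<lambda>\<sigma>. r * f \<sigma>"] fs.subspace_scale[OF subspace_chains])
        (simp_all add: boundary_scale[OF assms])
  qed
qed

lemma chains_mono: "X \<subseteq> Y \<Longrightarrow> chains k X \<subseteq> chains k Y"
  by (auto simp: chains_def)

lemma cycles_mono: "X \<subseteq> Y \<Longrightarrow> cycles k X \<subseteq> cycles k Y"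
  using chains_mono[of X Y k] by (auto simp: cycles_def)

lemma boundaries_mono: "X \<subseteq> Y \<Longrightarrow> boundaries k X \<subseteq> boundaries k Y"
  using chains_mono[of X Y "k + 1"] by (auto simp: boundaries_def)

lemma mem_hom_class:
  "w \<in> hom_class k X z \<longleftrightarrow> z \<in> cycles k X \<and> w \<in> cycles k X \<and> z - w \<in> boundaries k X"
  by (auto simp: hom_class_def homologous_def fun_diff_def)

lemma homology_eq: "homology k X = hom_class k X ` cycles k X"
  by (auto simp: homology_def quotient_def hom_class_def)

lemma hom_class_eq_iff:
  assumes X: "finite X" and z: "z \<in> cycles k X" and w: "w \<in> cycles k X"
  shows "hom_class k X z = hom_class k X w \<longleftrightarrow> z - w \<in> boundaries k X"
proof
  note sB = subspace_boundaries[OF X, of k]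
  assume "hom_class k X z = hom_class k X w"
  moreover have "w \<in> hom_class k X w"
    using w fs.subspace_0[OF sB] by (simp add: mem_hom_class)
  ultimately show "z - w \<in> boundaries k X" by (metis mem_hom_class)
next
  note sB = subspace_boundaries[OF X, of k]
  assume zw: "z - w \<in> boundaries k X"
  have "z - v \<in> boundaries k X \<longleftrightarrow> w - v \<in> boundaries k X" for v
  proof
    assume "z - v \<in> boundaries k X"
    from fs.subspace_diff[OF sB this zw] show "w - v \<in> boundaries k X" by simp
  next
    assume "w - v \<in> boundaries k X"
    from fs.subspace_add[OF sB zw this] show "z - v \<in> boundaries k X" by simp
  qed
  then show "hom_class k X z = hom_class k X w"
    using z w by (auto simp: mem_hom_class)
qed

text \<open>Source of birth and death times. A monotone property that can only start at one of
  finitely many times holds on a closed half-line, which is where right-continuity enters; the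
  threshold is infinite if the property never holds.\<close>

lemma threshold:
  fixes P :: "real \<Rightarrow> bool"
  assumes T: "finite T" "\<And>t. t \<ge> 0 \<Longrightarrow> P t \<Longrightarrow> \<exists>t'\<in>T. 0 \<le> t' \<and> t' \<le> t \<and> P t'"
    and up: "\<And>s t. 0 \<le> s \<Longrightarrow> s \<le> t \<Longrightarrow> P s \<Longrightarrow> P t"
  shows "\<exists>d::ereal. 0 \<le> d \<and> (\<forall>t\<ge>0. P t \<longleftrightarrow> d \<le> ereal t)"
proof (cases "\<exists>t\<ge>0. P t")
  case False
  then show ?thesis by (intro exI[of _ \<infinity>]) auto
next
  case True
  define D where "D = {t \<in> T. 0 \<le> t \<and> P t}"
  have D: "finite D" "D \<noteq> {}"
    using T True by (auto simp: D_def)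
  have M: "0 \<le> Min D" "P (Min D)"
    using Min_in[OF D] by (auto simp: D_def)
  have "Min D \<le> t" if t: "t \<ge> 0" "P t" for t
  proof -
    obtain t' where "t' \<in> D" "t' \<le> t" using T(2)[OF t] by (auto simp: D_def)
    then show ?thesis using Min_le[OF D(1)] order_trans by blast
  qed
  then have "P t \<longleftrightarrow> Min D \<le> t" if "t \<ge> 0" for t
    using M up[of "Min D" t] that by blast
  then show ?thesis
    using M(1) by (intro exI[of _ "ereal (Min D)"]) simp
qed

text \<open>The filtration is given by entrance times \<open>w\<close>, so it takes finitely many
  values and \<open>adapted_basis\<close> applies to the two flags of cycles and of bounding cycles.
  Each vector then has a time \<open>b s\<close> at which it becomes a cycle and a time
  \<open>d s\<close> at which it becomes a bounding cycle.\<close>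

lemma filtration_adapted_basis:
  fixes X :: "real \<Rightarrow> 'a::linorder set set"
  assumes K: "finite K" and X: "\<And>t. t \<ge> 0 \<Longrightarrow> X t = {\<sigma> \<in> K. w \<sigma> \<le> t}"
  shows "\<exists>S b d. fs.independent S \<and> (\<forall>s. 0 \<le> b s) \<and> (\<forall>t\<ge>0.
      fs.span (S \<inter> cycles k (X t)) = cycles k (X t) \<and>
      fs.span (S \<inter> (cycles k (X t) \<inter> boundaries k (X t))) = cycles k (X t) \<inter> boundaries k (X t) \<and>
      (\<forall>s. (s \<in> cycles k (X t) \<longleftrightarrow> b s \<le> ereal t) \<and>
        (s \<in> cycles k (X t) \<inter> boundaries k (X t) \<longleftrightarrow> d s \<le> ereal t)))"
proof -
  define Z where "Z t = cycles k (X t)" for t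
  define B where "B t = cycles k (X t) \<inter> boundaries k (X t)" for t
  have finX: "finite (X t)" if "t \<ge> 0" for t
    using X[OF that] K by simp
  have Xm: "X s \<subseteq> X t" if "0 \<le> s" "s \<le> t" for s t
    using that X[of s] X[of t] by auto
  have Zm: "Z s \<subseteq> Z t" and Bm: "B s \<subseteq> B t" if "0 \<le> s" "s \<le> t" for s t
    using cycles_mono[OF Xm[OF that], of k] boundaries_mono[OF Xm[OF that], of k]
    by (auto simp: Z_def B_def)
  \<comment> \<open>The complex can change only at these times: \<open>X t\<close> agrees with
    \<open>X\<close> at the largest member of \<open>T\<close> below \<open>t\<close>. The 0 stands
    for all simplices with a negative entrance time.\<close>
  define T where "T = insert 0 (w ` K \<inter> {0..})"
  have T: "finite T" "T \<subseteq> {0..}" using K by (auto simp: T_def)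
  have T': "\<exists>t'\<in>T. 0 \<le> t' \<and> t' \<le> t \<and> X t' = X t" if t: "t \<ge> 0" for t
  proof -
    let ?M = "Max (T \<inter> {..t})"
    have f: "finite (T \<inter> {..t})" "T \<inter> {..t} \<noteq> {}" using T t by (auto simp: T_def)
    have M: "?M \<in> T" "?M \<le> t" "0 \<le> ?M"
      using Max_in[OF f] T by auto
    have "X ?M = X t"
    proof
      show "X ?M \<subseteq> X t" using Xm M by blast
      show "X t \<subseteq> X ?M"
      proof
        fix \<sigma> assume "\<sigma> \<in> X t"
        then have s: "\<sigma> \<in> K" "w \<sigma> \<le> t" using X[OF t] by auto
        have "w \<sigma> \<le> ?M"
        proof (cases "w \<sigma> \<ge> 0")
          case True
          then show ?thesis using s f by (intro Max_ge) (auto simp: T_def)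
        qed (use M in auto)
        then show "\<sigma> \<in> X ?M" using s X[OF M(3)] by auto
      qed
    qed
    then show ?thesis using M by blast
  qed
  let ?l = "sorted_list_of_set T"
  have mem: "t \<in> set ?l \<Longrightarrow> 0 \<le> t" for t using T by auto
  have srt: "sorted_wrt (\<le>) ?l" by simp
  have "\<exists>S. fs.independent S \<and> (\<forall>W\<in>set (map Z ?l) \<union> set (map B ?l). fs.span (S \<inter> W) = W)"
  proof (rule fs.adapted_basis)
    show "sorted_wrt (\<subseteq>) (map Z ?l)"
      unfolding sorted_wrt_map by (rule sorted_wrt_mono_rel[OF _ srt]) (use mem Zm in blast)
    show "sorted_wrt (\<subseteq>) (map B ?l)"
      unfolding sorted_wrt_map by (rule sorted_wrt_mono_rel[OF _ srt]) (use mem Bm in blast)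
    show "fs.subspace W" if "W \<in> set (map Z ?l)" for W
      using that mem finX by (auto simp: Z_def intro!: subspace_cycles)
    show "fs.subspace W" if "W \<in> set (map B ?l)" for W
      using that mem finX
      by (auto simp: B_def intro!: subspace_cycles subspace_boundaries fs.subspace_inter)
  qed
  then obtain S where S: "fs.independent S"
    "\<forall>W\<in>set (map Z ?l) \<union> set (map B ?l). fs.span (S \<inter> W) = W" by blast
  have SZ: "fs.span (S \<inter> Z t) = Z t" "fs.span (S \<inter> B t) = B t" if "t \<ge> 0" for t
  proof -
    from T'[OF that] obtain t' where "t' \<in> T" and Xt: "X t' = X t" by blast
    then have "t' \<in> set ?l" using T by simp
    then have "fs.span (S \<inter> Z t') = Z t'" "fs.span (S \<inter> B t') = B t'"
      using S(2) by auto
    then show "fs.span (S \<inter> Z t) = Z t" "fs.span (S \<inter> B t) = B t"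
      using Xt by (simp_all add: Z_def B_def)
  qed
  have "\<exists>d::ereal. 0 \<le> d \<and> (\<forall>t\<ge>0. s \<in> Z t \<longleftrightarrow> d \<le> ereal t)" for s
    proof (rule threshold[OF T(1)])
    show "\<exists>t'\<in>T. 0 \<le> t' \<and> t' \<le> t \<and> s \<in> Z t'" if "t \<ge> 0" "s \<in> Z t" for t
      using T'[OF that(1)] that(2) by (auto simp: Z_def)
  qed (use Zm in blast)
  then obtain b where b: "\<And>s. 0 \<le> b s" "\<And>s t. t \<ge> 0 \<Longrightarrow> s \<in> Z t \<longleftrightarrow> b s \<le> ereal t"
    by metis
  have "\<exists>d::ereal. 0 \<le> d \<and> (\<forall>t\<ge>0. s \<in> B t \<longleftrightarrow> d \<le> ereal t)" for s
    proof (rule threshold[OF T(1)])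
    show "\<exists>t'\<in>T. 0 \<le> t' \<and> t' \<le> t \<and> s \<in> B t'" if "t \<ge> 0" "s \<in> B t" for t
      using T'[OF that(1)] that(2) by (auto simp: B_def)
  qed (use Bm in blast)
  then obtain d where d: "\<And>s t. t \<ge> 0 \<Longrightarrow> s \<in> B t \<longleftrightarrow> d s \<le> ereal t"
    by metis
  show ?thesis
    using S(1) SZ b(1) b(2)[unfolded Z_def] d[unfolded B_def]
    by (intro exI[of _ S] exI[of _ b] exI[of _ d] conjI allI impI) (simp_all add: Z_def B_def)
qed

section \<open>Barcodes\<close>

lemma subspace_bar_component: "fs.subspace (bar_component bs t)"
  unfolding fs.subspace_def
proof (intro conjI ballI allI)
  show "x + y \<in> bar_component bs t"
    if "x \<in> bar_component bs t" "y \<in> bar_component bs t" for x y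
    unfolding bar_component_def
  proof (intro CollectI allI impI)
    fix i assume "(x + y) i \<noteq> 0"
    then have "x i \<noteq> 0 \<or> y i \<noteq> 0" by auto
    then show "i < length bs \<and> fst (bs ! i) \<le> t \<and> ereal t < snd (bs ! i)"
      using that unfolding bar_component_def by blast
  qed
qed (auto simp: bar_component_def)

text \<open>Each basis vector \<open>s\<close> with \<open>b s < d s\<close> spans one interval
  module. Passing to a later time leaves such a vector in place or turns it into a boundary, which
  is precisely how multiplication by a monomial acts on a bar.\<close>

lemma barcode_exists:
  fixes X :: "real \<Rightarrow> 'a::linorder set set"
  assumes K: "finite K" and X: "\<And>t. t \<ge> 0 \<Longrightarrow> X t = {\<sigma> \<in> K. w \<sigma> \<le> t}"
  shows "\<exists>bs. is_barcode k X bs"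
proof -
  define Z where "Z t = cycles k (X t)" for t
  define B where "B t = cycles k (X t) \<inter> boundaries k (X t)" for t
  obtain S b d where S: "fs.independent S" and b0: "\<And>s. 0 \<le> b s" and
    SZ: "\<And>t. t \<ge> 0 \<Longrightarrow> fs.span (S \<inter> Z t) = Z t" and
    SB: "\<And>t. t \<ge> 0 \<Longrightarrow> fs.span (S \<inter> B t) = B t" and
    b: "\<And>t s. t \<ge> 0 \<Longrightarrow> s \<in> Z t \<longleftrightarrow> b s \<le> ereal t" and
    d: "\<And>t s. t \<ge> 0 \<Longrightarrow> s \<in> B t \<longleftrightarrow> d s \<le> ereal t"
    using filtration_adapted_basis[OF assms, where k = k] unfolding Z_def B_def by blast
  have finX: "finite (X t)" if "t \<ge> 0" for t
    using X[OF that] K by simp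
  have Xm: "X s \<subseteq> X t" if "0 \<le> s" "s \<le> t" for s t
    using that X[of s] X[of t] by auto
  have Zm: "Z s \<subseteq> Z t" and Bm: "B s \<subseteq> B t" if "0 \<le> s" "s \<le> t" for s t
    using cycles_mono[OF Xm[OF that], of k] boundaries_mono[OF Xm[OF that], of k]
    by (auto simp: Z_def B_def)
  have subZ: "fs.subspace (Z t)" and subB: "fs.subspace (B t)" if "t \<ge> 0" for t
    using finX[OF that] unfolding Z_def B_def
    by (auto intro!: subspace_cycles subspace_boundaries fs.subspace_inter)
  \<comment> \<open>The basis as a whole is not known to be finite, but all cycles that occur are
    supported in \<open>K\<close>, and only finitely many basis vectors can be.\<close>
  define C where "C = {f :: 'a set \<Rightarrow> real. \<forall>\<sigma>. f \<sigma> \<noteq> 0 \<longrightarrow> \<sigma> \<in> K}"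
  have ZC: "Z t \<subseteq> C" if "t \<ge> 0" for t
    using X[OF that] by (auto simp: Z_def C_def cycles_def chains_def)
  have finS: "finite (S \<inter> C)"
    using fs.independent_span_bound[OF finite_imageI[OF K, of "\<lambda>x. indicator {x}"], of "S \<inter> C"]
      fs.independent_mono[OF S, of "S \<inter> C"] span_indicators[OF K] by (auto simp: C_def)
  define S1 where "S1 = {s \<in> S. b s < d s}"
  have bfin: "\<exists>r\<ge>0. b s = ereal r" if "s \<in> S1" for s
    using that b0[of s] by (cases "b s") (auto simp: S1_def)
  have S1C: "S1 \<subseteq> S \<inter> C"
  proof
    fix s assume s: "s \<in> S1"
    from bfin[OF this] obtain r where "r \<ge> 0" "b s = ereal r" by blast
    then have "s \<in> C" using b[of r s] ZC by auto
    then show "s \<in> S \<inter> C" using s by (auto simp: S1_def)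
  qed
  then have "finite S1" using finS finite_subset by blast
  then obtain ss where ss: "set ss = S1" "distinct ss" using finite_distinct_list by blast
  define bs where "bs = map (\<lambda>s. (real_of_ereal (b s), d s)) ss"
  define al where "al t i \<longleftrightarrow> i < length ss \<and> ss ! i \<in> Z t \<and> ss ! i \<notin> B t" for t i
  have len: "length bs = length ss" by (simp add: bs_def)
  have alive: "al t i \<longleftrightarrow> i < length bs \<and> fst (bs ! i) \<le> t \<and> ereal t < snd (bs ! i)"
    if t: "t \<ge> 0" for t i
  proof (cases "i < length ss")
    case True
    then have "ss ! i \<in> S1" using ss by auto
    from bfin[OF this] obtain r where "r \<ge> 0" "b (ss ! i) = ereal r" by blast
    then show ?thesis
      using True b[OF t, of "ss ! i"] d[OF t, of "ss ! i"] by (auto simp: al_def bs_def not_le)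
  qed (simp add: al_def len)
  have bc: "x \<in> bar_component bs t \<longleftrightarrow> (\<forall>i. x i \<noteq> 0 \<longrightarrow> al t i)" if "t \<ge> 0" for x t
    using alive[OF that] by (simp add: bar_component_def)
  define lin where "lin x = (\<Sum>i<length ss. (\<lambda>\<sigma>. x i * (ss ! i) \<sigma>))" for x :: "nat \<Rightarrow> real"
  have lin_add: "lin (x + y) = lin x + lin y" for x y
    by (simp add: lin_def sum.distrib[symmetric] fun_eq_iff sum_fun_apply distrib_right)
  have lin_diff: "lin (x - y) = lin x - lin y" for x y
    by (simp add: lin_def sum_subtractf[symmetric] fun_eq_iff sum_fun_apply left_diff_distrib)
  have lin_scale: "lin (\<lambda>i. r * x i) = (\<lambda>\<sigma>. r * lin x \<sigma>)" for r x
    unfolding lin_def by (rule ext) (simp only: sum_fun_apply sum_distrib_left mult.assoc)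
  define idx where "idx = the_inv_into {..<length ss} ((!) ss)"
  have bij: "bij_betw ((!) ss) {..<length ss} S1"
    using bij_betw_nth[OF ss(2), of "{..<length ss}" S1] ss(1) by simp
  have idx: "idx (ss ! i) = i" if "i < length ss" for i
    using that bij unfolding idx_def by (intro the_inv_into_f_f) (auto simp: bij_betw_def)
  have lin_set: "lin x = (\<Sum>s\<in>S1. (\<lambda>\<sigma>. x (idx s) * s \<sigma>))" for x
    unfolding lin_def using idx by (subst sum.reindex_bij_betw[OF bij, symmetric]) auto
  have linZ: "lin x \<in> Z t" if t: "t \<ge> 0" and x: "x \<in> bar_component bs t" for x t
    unfolding lin_def
  proof (intro fs.subspace_sum[OF subZ[OF t]])
    fix i assume "i \<in> {..<length ss}"
    show "(\<lambda>\<sigma>. x i * (ss ! i) \<sigma>) \<in> Z t"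
    proof (cases "x i = 0")
      case True
      then show ?thesis using fs.subspace_0[OF subZ[OF t]] by (simp add: zero_fun_def)
    next
      case False
      then have "ss ! i \<in> Z t" using x bc[OF t] by (auto simp: al_def)
      then show ?thesis by (rule fs.subspace_scale[OF subZ[OF t]])
    qed
  qed
  have surj: "\<exists>x\<in>bar_component bs t. z - lin x \<in> B t" if t: "t \<ge> 0" and z: "z \<in> Z t" for z t
  proof -
    have fin: "finite (S \<inter> Z t)" using finite_subset[OF _ finS] ZC[OF t] by blast
    from z SZ[OF t] obtain c where c: "z = (\<Sum>s\<in>S \<inter> Z t. (\<lambda>\<sigma>. c s * s \<sigma>))"
      unfolding fs.span_finite[OF fin] by auto
    let ?A = "{s \<in> S1. s \<in> Z t \<and> s \<notin> B t}"
    define x where "x i = (if al t i then c (ss ! i) else 0)" for i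
    have x: "x \<in> bar_component bs t" by (simp add: bc[OF t] x_def)
    have nth_idx: "idx s < length ss \<and> ss ! idx s = s" if "s \<in> S1" for s
      using that ss idx by (metis in_set_conv_nth)
    have "lin x = (\<Sum>s\<in>?A. (\<lambda>\<sigma>. x (idx s) * s \<sigma>))"
      unfolding lin_set using \<open>finite S1\<close> nth_idx
      by (intro sum.mono_neutral_right) (auto simp: x_def al_def)
    also have "\<dots> = (\<Sum>s\<in>?A. (\<lambda>\<sigma>. c s * s \<sigma>))"
      using nth_idx by (intro sum.cong) (auto simp: x_def al_def)
    finally have lx: "lin x = (\<Sum>s\<in>?A. (\<lambda>\<sigma>. c s * s \<sigma>))" .
    \<comment> \<open>A basis vector that is a cycle at time \<open>t\<close> is either alive or
      already a boundary. Dropping the latter from the expansion of \<open>z\<close> does not change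
      its class.\<close>
    have "S \<inter> Z t = ?A \<union> (S \<inter> B t)"
    proof
      show "S \<inter> Z t \<subseteq> ?A \<union> (S \<inter> B t)"
        using b[OF t] d[OF t] by (auto simp: S1_def not_le)
      show "?A \<union> (S \<inter> B t) \<subseteq> S \<inter> Z t" by (auto simp: S1_def B_def Z_def)
    qed
    then have "z = lin x + (\<Sum>s\<in>S \<inter> B t. (\<lambda>\<sigma>. c s * s \<sigma>))"
      unfolding c lx using fin by (subst sum.union_disjoint[symmetric]) auto
    then have "z - lin x = (\<Sum>s\<in>S \<inter> B t. (\<lambda>\<sigma>. c s * s \<sigma>))"
      by simp
    also have "\<dots> \<in> B t"
      by (intro fs.subspace_sum[OF subB[OF t]] fs.subspace_scale[OF subB[OF t]]) auto
    finally show ?thesis using x by blast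
  qed
  have inj: "x = 0" if t: "t \<ge> 0" and x: "x \<in> bar_component bs t" and l: "lin x \<in> B t" for x t
  proof
    fix i
    let ?A = "{s \<in> S1. s \<in> Z t \<and> s \<notin> B t}"
    have x0: "x i = 0" if "\<not> al t i" for i using x that bc[OF t] by blast
    have nth_idx: "idx s < length ss \<and> ss ! idx s = s" if "s \<in> S1" for s
      using that ss idx by (metis in_set_conv_nth)
    have "lin x = (\<Sum>s\<in>?A. (\<lambda>\<sigma>. x (idx s) * s \<sigma>))"
      unfolding lin_set
    proof (intro sum.mono_neutral_right ballI)
      fix s assume "s \<in> S1 - ?A"
      then have "\<not> al t (idx s)" using nth_idx[of s] by (auto simp: al_def)
      then show "(\<lambda>\<sigma>. x (idx s) * s \<sigma>) = 0" using x0 by auto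
    qed (use \<open>finite S1\<close> in auto)
    then have *: "(\<Sum>s\<in>?A. (\<lambda>\<sigma>. x (idx s) * s \<sigma>)) \<in> fs.span (S \<inter> B t)"
      using l unfolding SB[OF t] by simp
    have "x i = 0" if i: "al t i"
    proof -
      have "x (idx (ss ! i)) = 0"
      proof (rule fs.independent_sum_in_span[where c = "\<lambda>s. x (idx s)", OF S _ _ _ _ *])
        show "ss ! i \<in> ?A" using i ss(1) by (auto simp: al_def)
      qed (use \<open>finite S1\<close> in \<open>auto simp: S1_def intro: rev_finite_subset\<close>)
      moreover have "idx (ss ! i) = i" using i by (intro idx) (simp add: al_def)
      ultimately show ?thesis by simp
    qed
    then have "x i = 0" using x0[of i] by blast
    then show "x i = 0 i" by simp
  qed
  \<comment> \<open>The coordinates of a class: the unique combination of the vectors alive at time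
    \<open>t\<close> that lies in it. Existence is \<open>surj\<close>, and uniqueness follows from
    \<open>inj\<close> applied to a difference.\<close>
  define \<phi> where "\<phi> t H = (THE x. x \<in> bar_component bs t \<and> lin x \<in> H)" for t H
  have mem: "lin x \<in> hom_class k (X t) z \<longleftrightarrow> z - lin x \<in> B t"
    if t: "t \<ge> 0" and z: "z \<in> Z t" and x: "x \<in> bar_component bs t" for t z x
    using linZ[OF t x] z fs.subspace_diff[OF subZ[OF t] z linZ[OF t x]]
    by (auto simp: mem_hom_class Z_def B_def)
  have \<phi>: "\<phi> t (hom_class k (X t) z) = x"
    if t: "t \<ge> 0" and z: "z \<in> Z t" and x: "x \<in> bar_component bs t" "z - lin x \<in> B t" for t z x
    unfolding \<phi>_def
  proof (rule the_equality)
    show "x \<in> bar_component bs t \<and> lin x \<in> hom_class k (X t) z"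
      using mem[OF t z] x by blast
    fix y assume y: "y \<in> bar_component bs t \<and> lin y \<in> hom_class k (X t) z"
    then have "z - lin y \<in> B t" using mem[OF t z] by blast
    from fs.subspace_diff[OF subB[OF t] x(2) this] have "lin (y - x) \<in> B t"
      by (simp add: lin_diff)
    then have "y - x = 0"
      using inj[OF t] fs.subspace_diff[OF subspace_bar_component] x(1) y by blast
    then show "y = x" by simp
  qed
  have \<phi>': "\<exists>x. \<phi> t (hom_class k (X t) z) = x \<and> x \<in> bar_component bs t \<and> z - lin x \<in> B t"
    if t: "t \<ge> 0" and z: "z \<in> Z t" for t z
    using surj[OF t z] \<phi>[OF t z] by blast
  have "is_barcode k X bs"
    unfolding is_barcode_def
  proof (intro conjI exI[of _ \<phi>] allI impI)
    show "\<forall>(b, d)\<in>set bs. 0 \<le> b \<and> ereal b < d"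
    proof safe
      fix b' d' assume "(b', d') \<in> set bs"
      then obtain s where s: "s \<in> S1" "b' = real_of_ereal (b s)" "d' = d s"
        using ss by (auto simp: bs_def)
      from bfin[OF s(1)] obtain r where "r \<ge> 0" "b s = ereal r" by blast
      then show "0 \<le> b'" "ereal b' < d'" using s by (auto simp: S1_def)
    qed
    fix t :: real assume t: "0 \<le> t"
    show "bij_betw (\<phi> t) (homology k (X t)) (bar_component bs t)"
      unfolding bij_betw_def homology_eq
    proof
      show "inj_on (\<phi> t) (hom_class k (X t) ` cycles k (X t))"
      proof (rule inj_onI; clarify)
        fix z w assume zw: "z \<in> cycles k (X t)" "w \<in> cycles k (X t)"
          and eq: "\<phi> t (hom_class k (X t) z) = \<phi> t (hom_class k (X t) w)"
        obtain x where "z - lin x \<in> B t" "w - lin x \<in> B t"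
          using \<phi>'[OF t, of z] \<phi>'[OF t, of w] zw eq by (auto simp: Z_def)
        from fs.subspace_diff[OF subB[OF t] this] have "z - w \<in> B t" by simp
        then show "hom_class k (X t) z = hom_class k (X t) w"
          using hom_class_eq_iff[OF finX[OF t] zw] by (simp add: B_def)
      qed
      show "\<phi> t ` hom_class k (X t) ` cycles k (X t) = bar_component bs t"
      proof
        show "\<phi> t ` hom_class k (X t) ` cycles k (X t) \<subseteq> bar_component bs t"
          using \<phi>'[OF t] by (auto simp: Z_def)
        show "bar_component bs t \<subseteq> \<phi> t ` hom_class k (X t) ` cycles k (X t)"
        proof
          fix x assume x: "x \<in> bar_component bs t"
          have "\<phi> t (hom_class k (X t) (lin x)) = x"
            using linZ[OF t x] x fs.subspace_0[OF subB[OF t]] by (intro \<phi>[OF t]) auto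
          then show "x \<in> \<phi> t ` hom_class k (X t) ` cycles k (X t)"
            using linZ[OF t x] unfolding Z_def by (metis image_eqI)
        qed
      qed
    qed
    show "\<forall>z\<in>cycles k (X t). \<forall>w\<in>cycles k (X t). \<phi> t (hom_class k (X t) (\<lambda>\<sigma>. z \<sigma> + w \<sigma>)) =
             (\<lambda>i. \<phi> t (hom_class k (X t) z) i + \<phi> t (hom_class k (X t) w) i)"
    proof (intro ballI)
      fix z w assume zw: "z \<in> cycles k (X t)" "w \<in> cycles k (X t)"
      obtain x where x: "\<phi> t (hom_class k (X t) z) = x" "x \<in> bar_component bs t" "z - lin x \<in> B t"
        using \<phi>'[OF t, of z] zw by (auto simp: Z_def)
      obtain y where y: "\<phi> t (hom_class k (X t) w) = y" "y \<in> bar_component bs t" "w - lin y \<in> B t"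
        using \<phi>'[OF t, of w] zw by (auto simp: Z_def)
      have "\<phi> t (hom_class k (X t) (z + w)) = x + y"
        using fs.subspace_add[OF subB[OF t] x(3) y(3)] zw fs.subspace_add[OF subZ[OF t], of z w]
          fs.subspace_add[OF subspace_bar_component x(2) y(2)]
        by (intro \<phi>[OF t]) (auto simp: Z_def lin_add algebra_simps)
      then show "\<phi> t (hom_class k (X t) (\<lambda>\<sigma>. z \<sigma> + w \<sigma>)) =
             (\<lambda>i. \<phi> t (hom_class k (X t) z) i + \<phi> t (hom_class k (X t) w) i)"
        using x(1) y(1) by (simp add: plus_fun_def)
    qed
    show "\<forall>z\<in>cycles k (X t).
        \<phi> t (hom_class k (X t) (\<lambda>\<sigma>. r * z \<sigma>)) = (\<lambda>i. r * \<phi> t (hom_class k (X t) z) i)" for r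
    proof
      fix z assume z: "z \<in> cycles k (X t)"
      obtain x where x: "\<phi> t (hom_class k (X t) z) = x" "x \<in> bar_component bs t" "z - lin x \<in> B t"
        using \<phi>'[OF t, of z] z by (auto simp: Z_def)
      have "(\<lambda>\<sigma>. r * z \<sigma>) - lin (\<lambda>i. r * x i) = (\<lambda>\<sigma>. r * (z - lin x) \<sigma>)"
        by (simp add: lin_scale fun_eq_iff algebra_simps)
      then show "\<phi> t (hom_class k (X t) (\<lambda>\<sigma>. r * z \<sigma>)) = (\<lambda>i. r * \<phi> t (hom_class k (X t) z) i)"
        unfolding x(1) using fs.subspace_scale[OF subB[OF t] x(3), of r] z
          fs.subspace_scale[OF subZ[OF t], of z r]
          fs.subspace_scale[OF subspace_bar_component x(2), of r]
        by (intro \<phi>[OF t]) (auto simp: Z_def)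
    qed
    show "\<forall>z\<in>cycles k (X t).
        \<phi> (t + s) (hom_class k (X (t + s)) z) = bar_shift bs t s (\<phi> t (hom_class k (X t) z))"
      if s: "0 \<le> s" for s
    proof
      fix z assume z: "z \<in> cycles k (X t)"
      have ts: "0 \<le> t + s" "t \<le> t + s" using t s by auto
      obtain x where x: "\<phi> t (hom_class k (X t) z) = x" "x \<in> bar_component bs t" "z - lin x \<in> B t"
        using \<phi>'[OF t, of z] z by (auto simp: Z_def)
      let ?y = "bar_shift bs t s x"
      have xal: "i < length ss \<and> ss ! i \<in> Z (t + s)" if "x i \<noteq> 0" for i
        using x(2) that Zm[OF t ts(2)] bc[OF t] by (auto simp: al_def)
      have dead: "ss ! i \<in> B (t + s) \<longleftrightarrow> \<not> ereal (t + s) < snd (bs ! i)" if "i < length ss" for i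
        using that d[OF ts(1)] by (simp add: bs_def not_less)
      have y: "?y \<in> bar_component bs (t + s)"
        unfolding bc[OF ts(1)] using xal dead by (auto simp: bar_shift_def al_def)
      \<comment> \<open>The coordinates erased by \<open>bar_shift\<close> belong to vectors that
        have become boundaries by time \<open>t + s\<close>.\<close>
      have "lin (x - ?y) \<in> B (t + s)"
        unfolding lin_def
      proof (intro fs.subspace_sum[OF subB[OF ts(1)]])
        fix i assume i: "i \<in> {..<length ss}"
        show "(\<lambda>\<sigma>. (x - ?y) i * (ss ! i) \<sigma>) \<in> B (t + s)"
        proof (cases "ss ! i \<in> B (t + s)")
          case True
          then show ?thesis by (rule fs.subspace_scale[OF subB[OF ts(1)]])
        next
          case False
          then have "(x - ?y) i = 0" using dead i by (auto simp: bar_shift_def)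
          then show ?thesis using fs.subspace_0[OF subB[OF ts(1)]] by (simp add: zero_fun_def)
        qed
      qed
      moreover have "z - lin x \<in> B (t + s)" using x(3) Bm[OF t ts(2)] by blast
      ultimately have "(z - lin x) + lin (x - ?y) \<in> B (t + s)"
        by (intro fs.subspace_add[OF subB[OF ts(1)]])
      then have "z - lin ?y \<in> B (t + s)" by (simp add: lin_diff)
      then show "\<phi> (t + s) (hom_class k (X (t + s)) z) = bar_shift bs t s (\<phi> t (hom_class k (X t) z))"
        unfolding x(1) using z Zm[OF t ts(2)] y by (intro \<phi>[OF ts(1)]) (auto simp: Z_def)
    qed
  qed
  then show ?thesis by blast
qed

text \<open>Proved for an arbitrary barcode, because \<open>barcode\<close> is a mere choice. The
  map from a cycle to the coordinates of its class has the bounding cycles as kernel and the bar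
  component as image. Writing the Betti number as the excess of one dimension over another avoids
  quotient spaces, and later lemmas take it in the same form, as a number \<open>N\<close>.\<close>

lemma dim_cycles_barcode:
  assumes bs: "is_barcode k X bs" and t: "t \<ge> 0" and fin: "finite (X t)"
  shows "fs.dim (cycles k (X t)) = fs.dim (cycles k (X t) \<inter> boundaries k (X t)) +
     card {i. i < length bs \<and> fst (bs ! i) \<le> t \<and> ereal t < snd (bs ! i)}"
proof -
  obtain \<phi> where bij: "bij_betw (\<phi> t) (homology k (X t)) (bar_component bs t)"
    and add: "\<And>z w. z \<in> cycles k (X t) \<Longrightarrow> w \<in> cycles k (X t) \<Longrightarrow>
           \<phi> t (hom_class k (X t) (\<lambda>\<sigma>. z \<sigma> + w \<sigma>)) =
             (\<lambda>i. \<phi> t (hom_class k (X t) z) i + \<phi> t (hom_class k (X t) w) i)"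
    and scale: "\<And>r z. z \<in> cycles k (X t) \<Longrightarrow>
           \<phi> t (hom_class k (X t) (\<lambda>\<sigma>. r * z \<sigma>)) = (\<lambda>i. r * \<phi> t (hom_class k (X t) z) i)"
    using bs unfolding is_barcode_def
    apply (elim conjE exE)
    subgoal for \<phi>
      apply (drule spec[of _ t])
      apply (drule mp, rule t)
      apply (elim conjE)
      apply (rule that[of \<phi>])
        apply assumption
       apply (drule bspec, assumption, drule bspec, assumption, assumption)
      apply (drule spec, drule bspec, assumption, assumption)
      done
    done
  let ?g = "\<lambda>z. \<phi> t (hom_class k (X t) z)"
  note sub = subspace_cycles[OF fin, of k]
  have g0: "?g 0 = 0"
    using scale[of 0 0] fs.subspace_0[OF sub] by (simp add: zero_fun_def)
  have "fs.dim (cycles k (X t)) = fs.dim {z \<in> cycles k (X t). ?g z = 0} + fs.dim (?g ` cycles k (X t))"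
  proof (rule fsp.rank_nullity[OF sub])
    show "finite ((\<lambda>x. indicator {x} :: 'a set \<Rightarrow> real) ` X t)" using fin by simp
    show "cycles k (X t) \<subseteq> fs.span ((\<lambda>x. indicator {x}) ` X t)"
      unfolding span_indicators[OF fin, symmetric] by (auto simp: cycles_def chains_def)
  qed (use add scale in \<open>auto simp: plus_fun_def\<close>)
  also have "{z \<in> cycles k (X t). ?g z = 0} = cycles k (X t) \<inter> boundaries k (X t)"
  proof -
    have "?g z = 0 \<longleftrightarrow> z \<in> boundaries k (X t)" if z: "z \<in> cycles k (X t)" for z
    proof -
      note 0 = fs.subspace_0[OF sub]
      have "?g z = 0 \<longleftrightarrow> hom_class k (X t) z = hom_class k (X t) 0"
        unfolding g0[symmetric] using bij z 0
        by (auto simp: bij_betw_def homology_eq inj_on_def)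
      then show ?thesis using hom_class_eq_iff[OF fin z 0] by simp
    qed
    then show ?thesis by blast
  qed
  also have "?g ` cycles k (X t) = bar_component bs t"
    using bij unfolding bij_betw_def homology_eq by (auto simp: image_image)
  also have "bar_component bs t = {x. \<forall>i. x i \<noteq> 0 \<longrightarrow>
      i \<in> {i. i < length bs \<and> fst (bs ! i) \<le> t \<and> ereal t < snd (bs ! i)}}"
    by (simp add: bar_component_def)
  also have "fs.dim \<dots> = card {i. i < length bs \<and> fst (bs ! i) \<le> t \<and> ereal t < snd (bs ! i)}"
    by (rule dim_supported) auto
  finally show ?thesis .
qed

section \<open>Incidence numbers and the trace bound\<close>

lemma incidence_face:
  "v \<in> \<sigma> \<Longrightarrow> incidence (\<sigma> - {v}) \<sigma> = (-1) ^ card {w \<in> \<sigma>. w < v}"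
proof -
  assume v: "v \<in> \<sigma>"
  have "{u. u \<in> \<sigma> \<and> \<sigma> - {u} = \<sigma> - {v}} = {v}" using v by auto
  then show ?thesis by (simp add: incidence_def)
qed

lemma incidence_nonzeroD:
  assumes "incidence \<tau> \<sigma> \<noteq> 0"
  obtains v where "v \<in> \<sigma>" "\<tau> = \<sigma> - {v}"
proof -
  have "{u. u \<in> \<sigma> \<and> \<sigma> - {u} = \<tau>} \<noteq> {}"
    using assms unfolding incidence_def by (metis sum.empty)
  then show ?thesis using that by blast
qed

lemma incidence_square: "v \<in> \<sigma> \<Longrightarrow> incidence (\<sigma> - {v}) \<sigma> * incidence (\<sigma> - {v}) \<sigma> = 1"
  by (simp add: incidence_face flip: power_add)

lemma incidence_abs: "\<bar>incidence \<tau> \<sigma>\<bar> \<le> 1"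
proof (cases "incidence \<tau> \<sigma> = 0")
  case False
  then show ?thesis by (elim incidence_nonzeroD) (simp add: incidence_face power_abs)
qed simp

text \<open>If \<open>a < b\<close>, removing \<open>a\<close> first moves \<open>b\<close> down by
  one position, while removing \<open>b\<close> first leaves the position of \<open>a\<close>
  unchanged.\<close>

lemma incidence_opposite:
  assumes fin: "finite \<eta>" and ab: "a \<in> \<eta>" "b \<in> \<eta>" "a \<noteq> b"
  shows "incidence (\<eta> - {a, b}) (\<eta> - {a}) * incidence (\<eta> - {a}) \<eta> =
    - (incidence (\<eta> - {a, b}) (\<eta> - {b}) * incidence (\<eta> - {b}) \<eta>)"
proof -
  have *: "incidence (\<eta> - {a, b}) (\<eta> - {a}) * incidence (\<eta> - {a}) \<eta> =
    - (incidence (\<eta> - {a, b}) (\<eta> - {b}) * incidence (\<eta> - {b}) \<eta>)"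
    if ab: "a \<in> \<eta>" "b \<in> \<eta>" "a < b" for a b
  proof -
    have eq: "\<eta> - {a, b} = \<eta> - {a} - {b}" "\<eta> - {a} - {b} = \<eta> - {b} - {a}" by auto
    have "{w \<in> \<eta>. w < b} = insert a {w \<in> \<eta> - {a}. w < b}" using ab by auto
    then have c1: "card {w \<in> \<eta>. w < b} = Suc (card {w \<in> \<eta> - {a}. w < b})"
      using fin by simp
    have c2: "{w \<in> \<eta> - {b}. w < a} = {w \<in> \<eta>. w < a}" using ab by auto
    have "incidence (\<eta> - {a, b}) (\<eta> - {a}) = (-1) ^ card {w \<in> \<eta> - {a}. w < b}"
      unfolding eq(1) using ab by (intro incidence_face) auto
    moreover have "incidence (\<eta> - {a, b}) (\<eta> - {b}) = (-1) ^ card {w \<in> \<eta> - {b}. w < a}"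
      unfolding eq using ab by (intro incidence_face) auto
    ultimately show ?thesis
      using ab by (simp only: c2) (simp add: incidence_face c1)
  qed
  show ?thesis
  proof (cases "a < b")
    case True
    then show ?thesis using * ab by blast
  next
    case False
    then have "b < a" using ab by auto
    from *[OF ab(2,1) this] show ?thesis by (simp add: insert_commute)
  qed
qed

lemma boundary_boundary_simplex:
  assumes fin: "finite \<eta>"
  shows "(\<Sum>a\<in>\<eta>. incidence \<tau> (\<eta> - {a}) * incidence (\<eta> - {a}) \<eta>) = 0"
proof (cases "\<exists>a\<in>\<eta>. \<exists>b\<in>\<eta> - {a}. \<tau> = \<eta> - {a} - {b}")
  case False
  have "incidence \<tau> (\<eta> - {a}) = 0" if "a \<in> \<eta>" for a
    using False that incidence_nonzeroD[of \<tau> "\<eta> - {a}"] by blast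
  then show ?thesis by simp
next
  case True
  then obtain a b where ab: "a \<in> \<eta>" "b \<in> \<eta>" "a \<noteq> b" "\<tau> = \<eta> - {a, b}" by auto
  have z: "incidence \<tau> (\<eta> - {c}) = 0" if c: "c \<in> \<eta>" "c \<noteq> a" "c \<noteq> b" for c
  proof (rule ccontr)
    assume "incidence \<tau> (\<eta> - {c}) \<noteq> 0"
    then obtain v where "\<tau> = \<eta> - {c} - {v}" by (rule incidence_nonzeroD)
    then have "\<eta> - {a, b} = \<eta> - {c} - {v}" using ab by simp
    then show False using c by blast
  qed
  have "(\<Sum>c\<in>\<eta>. incidence \<tau> (\<eta> - {c}) * incidence (\<eta> - {c}) \<eta>) =
      (\<Sum>c\<in>{a, b}. incidence \<tau> (\<eta> - {c}) * incidence (\<eta> - {c}) \<eta>)"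
    using ab fin z by (intro sum.mono_neutral_right) auto
  also have "\<dots> = 0"
    using incidence_opposite[OF fin ab(1-3)] ab by simp
  finally show ?thesis .
qed

text \<open>Gram-Schmidt inside \<open>Z\<close>, relative to \<open>D\<close>. Orthogonality to
  \<open>D\<close> amounts to \<open>card D\<close> linear conditions, so \<open>Z\<close> contains
  a nonzero solution as long as its dimension is larger; each vector found then joins
  \<open>D\<close>. With the cycles as \<open>Z\<close> and a basis of the bounding cycles as
  \<open>D\<close>, the family consists of harmonic chains.\<close>

lemma orthonormal_family:
  fixes Z :: "('b \<Rightarrow> real) set"
  assumes I: "finite I" "\<And>z x. z \<in> Z \<Longrightarrow> z x \<noteq> 0 \<Longrightarrow> x \<in> I" and Z: "fs.subspace Z"
    and D: "finite D" "card D + N \<le> fs.dim Z"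
  shows "\<exists>e. (\<forall>i<N. e i \<in> Z \<and> (\<forall>d\<in>D. (\<Sum>x\<in>I. e i x * d x) = 0) \<and>
    (\<forall>j<N. (\<Sum>x\<in>I. e i x * e j x) = (if i = j then 1 else 0)))"
  using D
proof (induction N arbitrary: D)
  case (Suc N)
  define g where "g z = (\<lambda>d. if d \<in> D then \<Sum>x\<in>I. z x * d x else 0)" for z :: "'b \<Rightarrow> real"
  define Z' where "Z' = {z \<in> Z. g z = 0}"
  have "fs.dim Z = fs.dim Z' + fs.dim (g ` Z)"
    unfolding Z'_def
  proof (rule fsp.rank_nullity[OF Z])
    show "finite ((\<lambda>x. indicator {x} :: 'b \<Rightarrow> real) ` I)" using I by simp
    show "Z \<subseteq> fs.span ((\<lambda>x. indicator {x}) ` I)"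
      unfolding span_indicators[OF I(1), symmetric] using I(2) by auto
  qed (auto simp: g_def fun_eq_iff distrib_right sum.distrib sum_distrib_left mult.assoc)
  moreover have "fs.dim (g ` Z) \<le> card ((\<lambda>x. indicator {x} :: ('b \<Rightarrow> real) \<Rightarrow> real) ` D)"
  proof (rule fs.dim_le_card)
    show "g ` Z \<subseteq> fs.span ((\<lambda>x. indicator {x}) ` D)"
      unfolding span_indicators[OF Suc.prems(1), symmetric] by (auto simp: g_def split: if_splits)
  qed (use Suc.prems in simp)
  moreover have "card ((\<lambda>x. indicator {x} :: ('b \<Rightarrow> real) \<Rightarrow> real) ` D) \<le> card D"
    by (rule card_image_le[OF Suc.prems(1)])
  ultimately have "fs.dim Z' \<noteq> 0" using Suc.prems(2) by linarith
  then have "\<not> Z' \<subseteq> {0}"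
    using fs.dim_le_card[of Z' "{}"] by auto
  then obtain z where z: "z \<in> Z" "g z = 0" "z \<noteq> 0" by (auto simp: Z'_def)
  define c where "c = (\<Sum>x\<in>I. z x * z x)"
  obtain y where y: "z y \<noteq> 0" using z(3) by (auto simp: fun_eq_iff)
  have "c > 0"
    unfolding c_def using y I z by (intro sum_pos2[of I y]) (auto simp: zero_less_mult_iff)
  define u where "u = (\<lambda>x. inverse (sqrt c) * z x)"
  have u: "u \<in> Z" unfolding u_def by (rule fs.subspace_scale[OF Z z(1)])
  have "(\<Sum>x\<in>I. u x * u x) = (\<Sum>x\<in>I. (inverse (sqrt c) * inverse (sqrt c)) * (z x * z x))"
    by (simp add: u_def mult_ac)
  also have "\<dots> = inverse (sqrt c) * inverse (sqrt c) * c"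
    unfolding sum_distrib_left[symmetric] c_def[symmetric] ..
  also have "\<dots> = 1" using \<open>c > 0\<close> by (simp add: field_simps)
  finally have uu: "(\<Sum>x\<in>I. u x * u x) = 1" .
  have ud: "(\<Sum>x\<in>I. u x * d x) = 0" if "d \<in> D" for d
  proof -
    have "(\<Sum>x\<in>I. u x * d x) = inverse (sqrt c) * g z d"
      using that by (simp add: u_def g_def sum_distrib_left mult_ac)
    then show ?thesis using z(2) by simp
  qed
  have "card (insert u D) + N \<le> fs.dim Z"
    using Suc.prems card_insert_le_m1[of "Suc (card D)" D u] by auto
  from Suc.IH[OF _ this] Suc.prems(1) obtain e where e: "\<forall>i<N. e i \<in> Z \<and>
      (\<forall>d\<in>insert u D. (\<Sum>x\<in>I. e i x * d x) = 0) \<and>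
      (\<forall>j<N. (\<Sum>x\<in>I. e i x * e j x) = (if i = j then 1 else 0))"
    by blast
  have ue: "(\<Sum>x\<in>I. u x * e i x) = 0" if "i < N" for i
    using e that by (simp add: mult.commute)
  show ?case
    by (rule exI[of _ "\<lambda>i. if i < N then e i else u"])
      (use e u uu ud ue in \<open>auto simp: less_Suc_eq\<close>)
qed simp

section \<open>Powers of a symmetric matrix and their traces\<close>

primrec mpow :: "'b set \<Rightarrow> ('b \<Rightarrow> 'b \<Rightarrow> real) \<Rightarrow> nat \<Rightarrow> 'b \<Rightarrow> 'b \<Rightarrow> real" where
  "mpow I a 0 x y = (if x = y then 1 else 0)"
| "mpow I a (Suc m) x y = (\<Sum>z\<in>I. a x z * mpow I a m z y)"

lemma mpow_add:
  assumes "finite I" "x \<in> I"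
  shows "mpow I a (m + n) x y = (\<Sum>z\<in>I. mpow I a m x z * mpow I a n z y)"
  using assms(2)
proof (induction m arbitrary: x)
  case 0
  have "(\<Sum>z\<in>I. mpow I a 0 x z * mpow I a n z y) = (\<Sum>z\<in>I. if z = x then mpow I a n x y else 0)"
    by (intro sum.cong) auto
  then show ?case using assms(1) 0 by simp
next
  case (Suc m)
  have "mpow I a (Suc m + n) x y = (\<Sum>w\<in>I. \<Sum>z\<in>I. a x w * (mpow I a m w z * mpow I a n z y))"
    using Suc.IH by (simp add: sum_distrib_left)
  also have "\<dots> = (\<Sum>z\<in>I. \<Sum>w\<in>I. a x w * (mpow I a m w z * mpow I a n z y))"
    by (rule sum.swap)
  finally show ?case by (simp add: sum_distrib_right mult.assoc)
qed

lemma mpow_sym: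
  assumes "finite I" and sym: "\<And>x y. x \<in> I \<Longrightarrow> y \<in> I \<Longrightarrow> a x y = a y x"
    and "x \<in> I" "y \<in> I"
  shows "mpow I a m x y = mpow I a m y x"
  using assms(3,4)
proof (induction m arbitrary: x y)
  case (Suc m)
  have "mpow I a (Suc m) x y = (\<Sum>z\<in>I. mpow I a m y z * a z x)"
    using Suc sym by (auto intro!: sum.cong)
  also have "\<dots> = (\<Sum>z\<in>I. mpow I a m y z * mpow I a 1 z x)"
  proof (intro sum.cong refl)
    fix z assume "z \<in> I"
    have "mpow I a 1 z x = (\<Sum>w\<in>I. if w = x then a z w else 0)"
      by (simp add: if_distrib[of "\<lambda>t. _ * t"] cong: if_cong)
    then show "mpow I a m y z * a z x = mpow I a m y z * mpow I a 1 z x"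
      using assms(1) Suc.prems by simp
  qed
  also have "\<dots> = mpow I a (m + 1) y x"
    using mpow_add[OF assms(1), of y a m 1 x] Suc.prems by simp
  finally show ?case by simp
qed simp

text \<open>No eigenvalues are involved. The matrix \<open>b\<close>, the r-th power of
  \<open>a\<close>, fixes every \<open>e i\<close>, so summing Bessel's inequality over its rows
  bounds \<open>N\<close> by the sum of the squares of the entries of \<open>b\<close>. By symmetry
  this is the trace of the square of \<open>b\<close>, which is why the exponent is even.\<close>

lemma fixed_vectors_le_trace:
  assumes I: "finite I" and sym: "\<And>x y. x \<in> I \<Longrightarrow> y \<in> I \<Longrightarrow> a x y = a y x"
    and e: "\<And>i j. i < N \<Longrightarrow> j < N \<Longrightarrow> (\<Sum>x\<in>I. e i x * e j x) = (if i = j then 1 else 0)"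
    and inv: "\<And>i x. i < N \<Longrightarrow> x \<in> I \<Longrightarrow> (\<Sum>y\<in>I. a x y * e i y) = e i x"
  shows "real N \<le> (\<Sum>x\<in>I. mpow I a (2 * r) x x)"
proof -
  define b where "b = mpow I a r"
  have b: "(\<Sum>y\<in>I. b x y * e i y) = e i x" if i: "i < N" and x: "x \<in> I" for x i
    unfolding b_def using x
  proof (induction r arbitrary: x)
    case 0
    have "(\<Sum>y\<in>I. mpow I a 0 x y * e i y) = (\<Sum>y\<in>I. if y = x then e i y else 0)"
      by (intro sum.cong) auto
    then show ?case using I 0 by simp
  next
    case (Suc r)
    have "(\<Sum>y\<in>I. mpow I a (Suc r) x y * e i y) =
        (\<Sum>y\<in>I. \<Sum>z\<in>I. a x z * (mpow I a r z y * e i y))"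
      by (simp add: sum_distrib_right mult.assoc)
    also have "\<dots> = (\<Sum>z\<in>I. \<Sum>y\<in>I. a x z * (mpow I a r z y * e i y))"
      by (rule sum.swap)
    also have "\<dots> = (\<Sum>z\<in>I. a x z * e i z)"
      using Suc.IH by (simp flip: sum_distrib_left)
    finally show ?case using inv[OF i Suc.prems] by simp
  qed
  \<comment> \<open>Row \<open>x\<close> of \<open>b\<close> has inner product \<open>e i x\<close>
    with \<open>e i\<close>, because \<open>b\<close> fixes \<open>e i\<close>; the square expanded
    below is that of the row minus its projection.\<close>
  have bessel: "(\<Sum>i<N. (e i x)\<^sup>2) \<le> (\<Sum>y\<in>I. (b x y)\<^sup>2)" if x: "x \<in> I" for x
  proof -
    have "0 \<le> (\<Sum>y\<in>I. (b x y - (\<Sum>i<N. e i x * e i y))\<^sup>2)"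
      by (intro sum_nonneg) simp
    also have "\<dots> = (\<Sum>y\<in>I. (b x y)\<^sup>2) - 2 * (\<Sum>y\<in>I. b x y * (\<Sum>i<N. e i x * e i y))
        + (\<Sum>y\<in>I. (\<Sum>i<N. e i x * e i y) * (\<Sum>i<N. e i x * e i y))"
      unfolding sum_distrib_left[of 2] sum_subtractf[symmetric] sum.distrib[symmetric]
      by (intro sum.cong refl) (simp add: power2_eq_square algebra_simps)
    also have "(\<Sum>y\<in>I. b x y * (\<Sum>i<N. e i x * e i y)) = (\<Sum>y\<in>I. \<Sum>i<N. e i x * (b x y * e i y))"
      by (simp add: sum_distrib_left mult_ac)
    also have "\<dots> = (\<Sum>i<N. \<Sum>y\<in>I. e i x * (b x y * e i y))"
      by (rule sum.swap)
    also have "\<dots> = (\<Sum>i<N. e i x * e i x)"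
      using b x by (simp flip: sum_distrib_left)
    also have "(\<Sum>y\<in>I. (\<Sum>i<N. e i x * e i y) * (\<Sum>i<N. e i x * e i y)) =
        (\<Sum>y\<in>I. \<Sum>i<N. \<Sum>j<N. e i x * e j x * (e i y * e j y))"
      by (simp add: sum_product mult_ac)
    also have "\<dots> = (\<Sum>i<N. \<Sum>y\<in>I. \<Sum>j<N. e i x * e j x * (e i y * e j y))"
      by (rule sum.swap)
    also have "\<dots> = (\<Sum>i<N. \<Sum>j<N. \<Sum>y\<in>I. e i x * e j x * (e i y * e j y))"
      by (intro sum.cong refl sum.swap)
    also have "\<dots> = (\<Sum>i<N. \<Sum>j<N. if i = j then e i x * e j x else 0)"
      using e by (intro sum.cong refl) (auto simp flip: sum_distrib_left)
    also have "\<dots> = (\<Sum>i<N. e i x * e i x)" by simp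
    finally show ?thesis by (simp add: power2_eq_square)
  qed
  have "real N = (\<Sum>i<N. \<Sum>x\<in>I. e i x * e i x)"
    using e by simp
  also have "\<dots> = (\<Sum>x\<in>I. \<Sum>i<N. e i x * e i x)"
    by (rule sum.swap)
  also have "\<dots> \<le> (\<Sum>x\<in>I. \<Sum>y\<in>I. b x y * b x y)"
    using bessel by (intro sum_mono) (simp add: power2_eq_square)
  also have "\<dots> = (\<Sum>x\<in>I. mpow I a (2 * r) x x)"
  proof (intro sum.cong refl)
    fix x assume x: "x \<in> I"
    have "(\<Sum>y\<in>I. b x y * b x y) = (\<Sum>y\<in>I. mpow I a r x y * mpow I a r y x)"
      unfolding b_def using x by (intro sum.cong refl arg_cong2[where f = "(*)"] mpow_sym I sym)
    then show "(\<Sum>y\<in>I. b x y * b x y) = mpow I a (2 * r) x x"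
      using mpow_add[OF I x, of a r r x] by (simp add: mult_2)
  qed
  finally show ?thesis .
qed

text \<open>A harmonic chain is orthogonal to the boundary of every simplex \<open>\<eta>\<close>,
  which kills the \<open>\<alpha>\<close> term, and it is a cycle, which kills the
  \<open>\<beta>\<close> term; hence \<open>a\<close> fixes it. As a cycle is annihilated by the
  incidence row of any set \<open>\<tau>\<close>, the down part may run over sets that are not
  simplices, including the empty set in degree 0.\<close>

lemma dim_homology_le_trace:
  fixes X :: "'a::linorder set set"
  assumes X: "finite X" and faces: "\<And>\<eta> a. \<eta> \<in> X \<Longrightarrow> card \<eta> = k + 2 \<Longrightarrow> a \<in> \<eta> \<Longrightarrow> \<eta> - {a} \<in> X"
    and dim: "fs.dim (cycles k X) = fs.dim (cycles k X \<inter> boundaries k X) + N"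
    and a: "\<And>\<rho> \<sigma>. a \<rho> \<sigma> = (if \<rho> = \<sigma> then 1 else 0)
        - \<alpha> * (\<Sum>\<eta> | \<eta> \<in> X \<and> card \<eta> = k + 2. incidence \<rho> \<eta> * incidence \<sigma> \<eta>)
        - \<beta> * (\<Sum>\<tau>\<in>F. incidence \<tau> \<rho> * incidence \<tau> \<sigma>)"
  shows "real N \<le> (\<Sum>\<rho> | \<rho> \<in> X \<and> card \<rho> = k + 1. mpow {\<sigma> \<in> X. card \<sigma> = k + 1} a (2 * r) \<rho> \<rho>)"
proof -
  define I where "I = {\<sigma> \<in> X. card \<sigma> = k + 1}"
  define J where "J = {\<eta> \<in> X. card \<eta> = k + 2}"
  define B where "B = cycles k X \<inter> boundaries k X"
  have fin: "finite I" "finite J" using X by (auto simp: I_def J_def)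
  have supp: "x \<in> I" if "z \<in> cycles k X" "z x \<noteq> 0" for z x
    using that by (auto simp: cycles_def chains_def I_def)
  obtain D where D: "D \<subseteq> B" "fs.independent D" "B \<subseteq> fs.span D"
    using fs.maximal_independent_subset[of B] by blast
  have "finite D"
  proof (rule conjunct1[OF fs.independent_span_bound[OF _ D(2)]])
    show "finite ((\<lambda>x. indicator {x} :: 'a set \<Rightarrow> real) ` I)" using fin by simp
    show "D \<subseteq> fs.span ((\<lambda>x. indicator {x}) ` I)"
      unfolding span_indicators[OF fin(1), symmetric] using D(1) supp by (auto simp: B_def)
  qed
  then have "\<exists>e. (\<forall>i<N. e i \<in> cycles k X \<and> (\<forall>d\<in>D. (\<Sum>x\<in>I. e i x * d x) = 0) \<and>
    (\<forall>j<N. (\<Sum>x\<in>I. e i x * e j x) = (if i = j then 1 else 0)))"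
    using dim fs.basis_card_eq_dim[OF D(1,3,2)]
    by (intro orthonormal_family fin(1) supp subspace_cycles[OF X]) (auto simp: B_def)
  then obtain e where e: "\<And>i. i < N \<Longrightarrow> e i \<in> cycles k X"
    "\<And>i d. i < N \<Longrightarrow> d \<in> D \<Longrightarrow> (\<Sum>x\<in>I. e i x * d x) = 0"
    "\<And>i j. i < N \<Longrightarrow> j < N \<Longrightarrow> (\<Sum>x\<in>I. e i x * e j x) = (if i = j then 1 else 0)"
    by metis
  have eB: "(\<Sum>x\<in>I. e i x * f x) = 0" if i: "i < N" and f: "f \<in> B" for i f
  proof -
    from f D(3) obtain c where c: "f = (\<Sum>d\<in>D. (\<lambda>x. c d * d x))"
      unfolding fs.span_finite[OF \<open>finite D\<close>] by auto
    have "(\<Sum>x\<in>I. e i x * f x) = (\<Sum>x\<in>I. \<Sum>d\<in>D. c d * (e i x * d x))"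
      unfolding c sum_fun_apply by (simp add: sum_distrib_left mult_ac)
    also have "\<dots> = (\<Sum>d\<in>D. \<Sum>x\<in>I. c d * (e i x * d x))"
      by (rule sum.swap)
    also have "\<dots> = 0" using e(2)[OF i] by (simp flip: sum_distrib_left)
    finally show ?thesis .
  qed
  \<comment> \<open>The column of \<open>\<eta>\<close> in the boundary matrix is the boundary of
    the single simplex \<open>\<eta>\<close>.\<close>
  have inB: "(\<lambda>\<sigma>. incidence \<sigma> \<eta>) \<in> B" if \<eta>: "\<eta> \<in> J" for \<eta>
  proof -
    have fin\<eta>: "finite \<eta>" using \<eta> by (intro card_ge_0_finite) (auto simp: J_def)
    have facet: "\<eta> - {v} \<in> I" if "v \<in> \<eta>" for v
      using that \<eta> faces[of \<eta> v] fin\<eta> by (auto simp: I_def J_def)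
    have ch: "(\<lambda>\<sigma>. incidence \<sigma> \<eta>) \<in> chains k X"
      using facet by (auto simp: chains_def I_def elim!: incidence_nonzeroD)
    have "boundary (indicator {\<eta>}) = (\<lambda>\<sigma>. incidence \<sigma> \<eta>)"
      by (subst boundary_eq[of "{\<eta>}"]) (auto split: split_indicator_asm)
    moreover have "indicator {\<eta>} \<in> chains (k + 1) X"
      using \<eta> by (auto simp: chains_def J_def split: split_indicator_asm)
    ultimately have "(\<lambda>\<sigma>. incidence \<sigma> \<eta>) \<in> boundaries k X"
      unfolding boundaries_def by (metis image_eqI)
    moreover have "boundary (\<lambda>\<sigma>. incidence \<sigma> \<eta>) = (\<lambda>_. 0)"
    proof
      fix \<tau>
      have inj: "inj_on (\<lambda>a. \<eta> - {a}) \<eta>" by (auto simp: inj_on_def)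
      have "boundary (\<lambda>\<sigma>. incidence \<sigma> \<eta>) \<tau> = (\<Sum>\<sigma>\<in>(\<lambda>a. \<eta> - {a}) ` \<eta>. incidence \<tau> \<sigma> * incidence \<sigma> \<eta>)"
        by (subst boundary_eq[of "(\<lambda>a. \<eta> - {a}) ` \<eta>"])
          (auto simp: fin\<eta> elim!: incidence_nonzeroD)
      also have "\<dots> = (\<Sum>a\<in>\<eta>. incidence \<tau> (\<eta> - {a}) * incidence (\<eta> - {a}) \<eta>)"
        by (simp add: sum.reindex[OF inj])
      also have "\<dots> = 0" by (rule boundary_boundary_simplex[OF fin\<eta>])
      finally show "boundary (\<lambda>\<sigma>. incidence \<sigma> \<eta>) \<tau> = 0" .
    qed
    ultimately show ?thesis using ch by (simp add: B_def cycles_def)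
  qed
  have cyc: "(\<Sum>\<sigma>\<in>I. incidence \<tau> \<sigma> * e i \<sigma>) = 0" if i: "i < N" for i \<tau>
  proof -
    have "boundary (e i) \<tau> = 0" using e(1)[OF i] by (simp add: cycles_def)
    moreover have "boundary (e i) = (\<lambda>\<tau>. \<Sum>\<sigma>\<in>I. incidence \<tau> \<sigma> * e i \<sigma>)"
      using supp[OF e(1)[OF i]] by (intro boundary_eq fin) auto
    ultimately show ?thesis by simp
  qed
  have "real N \<le> (\<Sum>\<rho>\<in>I. mpow I a (2 * r) \<rho> \<rho>)"
  proof (rule fixed_vectors_le_trace[OF fin(1) _ e(3)])
    show "a x y = a y x" for x y by (simp add: a mult_ac)
    fix i \<rho> assume i: "i < N" and \<rho>: "\<rho> \<in> I"
    have d: "(\<Sum>\<sigma>\<in>I. (if \<rho> = \<sigma> then 1 else 0) * e i \<sigma>) = e i \<rho>"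
    proof -
      have "(\<Sum>\<sigma>\<in>I. (if \<rho> = \<sigma> then 1 else 0) * e i \<sigma>) = (\<Sum>\<sigma>\<in>I. if \<sigma> = \<rho> then e i \<sigma> else 0)"
        by (intro sum.cong) auto
      then show ?thesis using \<rho> fin by simp
    qed
    have up: "(\<Sum>\<sigma>\<in>I. (\<Sum>\<eta>\<in>J. incidence \<rho> \<eta> * incidence \<sigma> \<eta>) * e i \<sigma>) = 0"
    proof -
      have "(\<Sum>\<sigma>\<in>I. (\<Sum>\<eta>\<in>J. incidence \<rho> \<eta> * incidence \<sigma> \<eta>) * e i \<sigma>) =
          (\<Sum>\<sigma>\<in>I. \<Sum>\<eta>\<in>J. incidence \<rho> \<eta> * (e i \<sigma> * incidence \<sigma> \<eta>))"
        unfolding sum_distrib_right by (simp only: mult_ac)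
      also have "\<dots> = (\<Sum>\<eta>\<in>J. \<Sum>\<sigma>\<in>I. incidence \<rho> \<eta> * (e i \<sigma> * incidence \<sigma> \<eta>))"
        by (rule sum.swap)
      also have "\<dots> = 0" using eB[OF i inB] by (simp flip: sum_distrib_left)
      finally show ?thesis .
    qed
    have down: "(\<Sum>\<sigma>\<in>I. (\<Sum>\<tau>\<in>F. incidence \<tau> \<rho> * incidence \<tau> \<sigma>) * e i \<sigma>) = 0"
    proof -
      have "(\<Sum>\<sigma>\<in>I. (\<Sum>\<tau>\<in>F. incidence \<tau> \<rho> * incidence \<tau> \<sigma>) * e i \<sigma>) =
          (\<Sum>\<sigma>\<in>I. \<Sum>\<tau>\<in>F. incidence \<tau> \<rho> * (incidence \<tau> \<sigma> * e i \<sigma>))"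
        unfolding sum_distrib_right by (simp only: mult_ac)
      also have "\<dots> = (\<Sum>\<tau>\<in>F. \<Sum>\<sigma>\<in>I. incidence \<tau> \<rho> * (incidence \<tau> \<sigma> * e i \<sigma>))"
        by (rule sum.swap)
      also have "\<dots> = 0" using cyc[OF i] by (simp flip: sum_distrib_left)
      finally show ?thesis .
    qed
    have "(\<Sum>\<sigma>\<in>I. a \<rho> \<sigma> * e i \<sigma>) = (\<Sum>\<sigma>\<in>I. (if \<rho> = \<sigma> then 1 else 0) * e i \<sigma>)
        - \<alpha> * (\<Sum>\<sigma>\<in>I. (\<Sum>\<eta>\<in>J. incidence \<rho> \<eta> * incidence \<sigma> \<eta>) * e i \<sigma>)
        - \<beta> * (\<Sum>\<sigma>\<in>I. (\<Sum>\<tau>\<in>F. incidence \<tau> \<rho> * incidence \<tau> \<sigma>) * e i \<sigma>)"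
      unfolding sum_distrib_left[of \<alpha>] sum_distrib_left[of \<beta>] sum_subtractf[symmetric]
      by (intro sum.cong refl) (simp only: a J_def[symmetric] left_diff_distrib mult.assoc)
    then show "(\<Sum>\<sigma>\<in>I. a \<rho> \<sigma> * e i \<sigma>) = e i \<rho>"
      unfolding d up down by simp
  qed
  then show ?thesis by (simp only: I_def)
qed

section \<open>The Laplacian of a clique complex as a sum over walks\<close>

definition cliques :: "'a set \<Rightarrow> 'a set set \<Rightarrow> nat \<Rightarrow> 'a set set" where
  "cliques V S j = {\<sigma>. \<sigma> \<subseteq> V \<and> card \<sigma> = j \<and> pairs \<sigma> \<subseteq> S}"

lemma clique_complex_card:
  "{\<sigma> \<in> clique_complex V S. card \<sigma> = Suc j} = cliques V S (Suc j)"
  by (auto simp: clique_complex_def cliques_def)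

lemma finite_cliques: "finite V \<Longrightarrow> finite (cliques V S j)"
  by (rule finite_subset[of _ "Pow V"]) (auto simp: cliques_def)

lemma pairs_mono: "\<sigma> \<subseteq> \<tau> \<Longrightarrow> pairs \<sigma> \<subseteq> pairs \<tau>"
  by (auto simp: pairs_def)

lemma pairs_insert:
  assumes "v \<notin> \<rho>"
  shows "pairs (insert v \<rho>) = pairs \<rho> \<union> (\<lambda>a. {v, a}) ` \<rho>"
proof
  show "pairs (insert v \<rho>) \<subseteq> pairs \<rho> \<union> (\<lambda>a. {v, a}) ` \<rho>"
  proof
    fix e assume e: "e \<in> pairs (insert v \<rho>)"
    then obtain x y where xy: "e = {x, y}" "x \<noteq> y" by (auto simp: pairs_def card_2_iff)
    show "e \<in> pairs \<rho> \<union> (\<lambda>a. {v, a}) ` \<rho>"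
    proof (cases "v \<in> e")
      case True
      then show ?thesis using e xy by (auto simp: pairs_def insert_commute)
    qed (use e in \<open>auto simp: pairs_def\<close>)
  qed
  show "pairs \<rho> \<union> (\<lambda>a. {v, a}) ` \<rho> \<subseteq> pairs (insert v \<rho>)"
    using assms by (auto simp: pairs_def card_2_iff)
qed

definition cone_ind :: "'a set set \<Rightarrow> 'a \<Rightarrow> 'a set \<Rightarrow> real" where
  "cone_ind S v \<tau> = (if \<forall>a\<in>\<tau>. {v, a} \<in> S then 1 else 0)"

lemma insert_in_cliques_iff:
  assumes "\<rho> \<in> cliques V S (Suc k)" "v \<in> V" "v \<notin> \<rho>"
  shows "insert v \<rho> \<in> cliques V S (k + 2) \<longleftrightarrow> cone_ind S v \<rho> = 1"
proof -
  have "finite \<rho>" using assms by (intro card_ge_0_finite) (auto simp: cliques_def)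
  then show ?thesis
    using assms by (auto simp: cliques_def cone_ind_def pairs_insert)
qed

text \<open>The \<open>v\<close>-part of the entries of \<open>n (I - \<partial>\<partial>\<^sup>* / (n p\<^sup>k\<^sup>+\<^sup>1) - \<partial>\<^sup>*\<partial> / (n p\<^sup>k))\<close>. For \<open>v \<notin> \<rho>\<close> it only
  depends on the edges between \<open>v\<close> and \<open>\<rho>\<close>, and it is centered when these have probability \<open>p\<close>.\<close>

definition step_weight ::
  "nat \<Rightarrow> real \<Rightarrow> 'a::linorder set set \<Rightarrow> 'a \<Rightarrow> 'a set \<Rightarrow> 'a set \<Rightarrow> real" where
  "step_weight k p S v \<rho> \<sigma> =
     (if v \<in> \<rho> then (if \<sigma> = \<rho> then 1 - 1 / p ^ k else 0)
      else if \<sigma> = \<rho> then 1 - cone_ind S v \<rho> / p ^ (k + 1)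
      else if \<exists>a\<in>\<rho>. \<sigma> = insert v (\<rho> - {a}) then incidence (\<rho> \<inter> \<sigma>) \<rho> * incidence (\<rho> \<inter> \<sigma>) \<sigma> *
        (cone_ind S v \<rho> / p ^ (k + 1) - cone_ind S v (\<rho> \<inter> \<sigma>) / p ^ k)
      else 0)"

lemma sum_cofaces:
  assumes V: "finite V" and \<rho>: "\<rho> \<in> cliques V S (Suc k)"
  shows "(\<Sum>\<eta>\<in>cliques V S (k + 2). incidence \<rho> \<eta> * f \<eta>) =
    (\<Sum>v\<in>V - \<rho>. cone_ind S v \<rho> * (incidence \<rho> (insert v \<rho>) * f (insert v \<rho>)))"
proof -
  let ?A = "{v \<in> V - \<rho>. cone_ind S v \<rho> = 1}"
  have inj: "inj_on (\<lambda>v. insert v \<rho>) ?A" by (auto simp: inj_on_def)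
  have "(\<Sum>\<eta>\<in>cliques V S (k + 2). incidence \<rho> \<eta> * f \<eta>) =
      (\<Sum>\<eta>\<in>(\<lambda>v. insert v \<rho>) ` ?A. incidence \<rho> \<eta> * f \<eta>)"
  proof (rule sum.mono_neutral_right)
    show "finite (cliques V S (k + 2))" by (rule finite_cliques[OF V])
    show "(\<lambda>v. insert v \<rho>) ` ?A \<subseteq> cliques V S (k + 2)"
      using insert_in_cliques_iff[OF \<rho>] by blast
    show "\<forall>\<eta>\<in>cliques V S (k + 2) - (\<lambda>v. insert v \<rho>) ` ?A. incidence \<rho> \<eta> * f \<eta> = 0"
    proof
      fix \<eta> assume \<eta>: "\<eta> \<in> cliques V S (k + 2) - (\<lambda>v. insert v \<rho>) ` ?A"
      have "incidence \<rho> \<eta> = 0"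
      proof (rule ccontr)
        assume "incidence \<rho> \<eta> \<noteq> 0"
        then obtain v where v: "v \<in> \<eta>" "\<rho> = \<eta> - {v}" by (rule incidence_nonzeroD)
        then have eq: "\<eta> = insert v \<rho>" "v \<in> V - \<rho>" using \<eta> by (auto simp: cliques_def)
        then have "cone_ind S v \<rho> = 1" using insert_in_cliques_iff[OF \<rho>, of v] \<eta> by auto
        then show False using \<eta> eq by blast
      qed
      then show "incidence \<rho> \<eta> * f \<eta> = 0" by simp
    qed
  qed
  also have "\<dots> = (\<Sum>v\<in>?A. incidence \<rho> (insert v \<rho>) * f (insert v \<rho>))"
    unfolding sum.reindex[OF inj] comp_def ..
  also have "\<dots> = (\<Sum>v\<in>?A. cone_ind S v \<rho> * (incidence \<rho> (insert v \<rho>) * f (insert v \<rho>)))"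
    by (intro sum.cong) auto
  also have "\<dots> = (\<Sum>v\<in>V - \<rho>. cone_ind S v \<rho> * (incidence \<rho> (insert v \<rho>) * f (insert v \<rho>)))"
    using V by (intro sum.mono_neutral_left) (auto simp: cone_ind_def)
  finally show ?thesis .
qed

lemma sum_faces:
  assumes V: "finite V" and \<rho>: "\<rho> \<subseteq> V" "card \<rho> = Suc k"
  shows "(\<Sum>\<tau> | \<tau> \<subseteq> V \<and> card \<tau> = k. incidence \<tau> \<rho> * f \<tau>) =
    (\<Sum>a\<in>\<rho>. incidence (\<rho> - {a}) \<rho> * f (\<rho> - {a}))"
proof -
  have fin: "finite \<rho>" using V \<rho> finite_subset by blast
  have inj: "inj_on (\<lambda>a. \<rho> - {a}) \<rho>" by (auto simp: inj_on_def)
  have "(\<Sum>\<tau> | \<tau> \<subseteq> V \<and> card \<tau> = k. incidence \<tau> \<rho> * f \<tau>) =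
      (\<Sum>\<tau>\<in>(\<lambda>a. \<rho> - {a}) ` \<rho>. incidence \<tau> \<rho> * f \<tau>)"
  proof (rule sum.mono_neutral_right)
    show "(\<lambda>a. \<rho> - {a}) ` \<rho> \<subseteq> {\<tau>. \<tau> \<subseteq> V \<and> card \<tau> = k}"
      using \<rho> fin by auto
    show "\<forall>\<tau>\<in>{\<tau>. \<tau> \<subseteq> V \<and> card \<tau> = k} - (\<lambda>a. \<rho> - {a}) ` \<rho>. incidence \<tau> \<rho> * f \<tau> = 0"
      using incidence_nonzeroD[of _ \<rho>] by fastforce
  qed (use V in simp)
  then show ?thesis by (simp add: sum.reindex[OF inj])
qed

text \<open>The identity contributes 1 for every vertex. On the diagonal, a vertex outside
  \<open>\<rho>\<close> accounts for a possible coface and each of the k + 1 vertices inside for one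
  face. Off the diagonal only neighbours have a nonzero entry, and it comes from the single vertex
  \<open>v\<close> of \<open>\<sigma>\<close> outside \<open>\<rho>\<close>, through the only
  possible common coface and the only common face.\<close>

lemma laplacian_entry:
  fixes V :: "'a::linorder set"
  assumes V: "finite V" "V \<noteq> {}" and p: "p > 0"
    and \<rho>: "\<rho> \<in> cliques V S (Suc k)" and \<sigma>: "\<sigma> \<in> cliques V S (Suc k)"
  shows "(if \<rho> = \<sigma> then 1 else 0)
      - 1 / (real (card V) * p ^ (k + 1)) * (\<Sum>\<eta>\<in>cliques V S (k + 2). incidence \<rho> \<eta> * incidence \<sigma> \<eta>)
      - 1 / (real (card V) * p ^ k) * (\<Sum>\<tau> | \<tau> \<subseteq> V \<and> card \<tau> = k. incidence \<tau> \<rho> * incidence \<tau> \<sigma>)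
    = (\<Sum>v\<in>V. step_weight k p S v \<rho> \<sigma>) / real (card V)" (is "?d - ?\<alpha> * ?U - ?\<beta> * ?D = ?R")
proof -
  have \<rho>': "\<rho> \<subseteq> V" "card \<rho> = Suc k" and \<sigma>': "\<sigma> \<subseteq> V" "card \<sigma> = Suc k"
    using \<rho> \<sigma> by (auto simp: cliques_def)
  have fin: "finite \<rho>" "finite \<sigma>" using \<rho>' \<sigma>' V finite_subset by blast+
  have n: "real (card V) > 0" using V by (simp add: card_gt_0_iff)
  have U: "?U = (\<Sum>v\<in>V - \<rho>. cone_ind S v \<rho> * (incidence \<rho> (insert v \<rho>) * incidence \<sigma> (insert v \<rho>)))"
    by (rule sum_cofaces[OF V(1) \<rho>])
  have D: "?D = (\<Sum>a\<in>\<rho>. incidence (\<rho> - {a}) \<rho> * incidence (\<rho> - {a}) \<sigma>)"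
    by (rule sum_faces[OF V(1) \<rho>'])
  consider (eq) "\<sigma> = \<rho>" | (adj) v a where "v \<in> V - \<rho>" "a \<in> \<rho>" "\<sigma> = insert v (\<rho> - {a})"
    | (far) "\<sigma> \<noteq> \<rho>" "\<And>v a. v \<in> V - \<rho> \<Longrightarrow> a \<in> \<rho> \<Longrightarrow> \<sigma> \<noteq> insert v (\<rho> - {a})"
    by blast
  then show ?thesis
  proof cases
    case eq
    have sq: "incidence \<rho> (insert v \<rho>) * incidence \<rho> (insert v \<rho>) = 1" if "v \<notin> \<rho>" for v
      using incidence_square[of v "insert v \<rho>"] that by simp
    define C where "C = (\<Sum>v\<in>V - \<rho>. cone_ind S v \<rho>)"
    have UC: "?U = C"
      unfolding U[unfolded eq] eq C_def by (intro sum.cong refl) (simp add: sq)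
    have Dk: "?D = real (k + 1)"
      unfolding D[unfolded eq] eq using \<rho>' by (simp add: incidence_square)
    have "(\<Sum>v\<in>V. step_weight k p S v \<rho> \<sigma>) =
        (\<Sum>v\<in>V - \<rho>. 1 - cone_ind S v \<rho> / p ^ (k + 1)) + (\<Sum>v\<in>\<rho>. 1 - 1 / p ^ k)"
      unfolding eq using V \<rho>'
      by (subst sum.subset_diff[of \<rho> V]) (auto simp: step_weight_def intro!: sum.cong)
    also have "(\<Sum>v\<in>V - \<rho>. 1 - cone_ind S v \<rho> / p ^ (k + 1)) =
        real (card V - card \<rho>) - C / p ^ (k + 1)"
      unfolding C_def using V \<rho>' fin by (simp add: sum_subtractf sum_divide_distrib card_Diff_subset)
    also have "real (card V - card \<rho>) = real (card V) - real (k + 1)"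
      using \<rho>' card_mono[OF V(1) \<rho>'(1)] by (simp add: of_nat_diff)
    finally have W: "(\<Sum>v\<in>V. step_weight k p S v \<rho> \<sigma>) =
        real (card V) - C / p ^ (k + 1) - real (k + 1) / p ^ k"
      using \<rho>' by (simp add: right_diff_distrib)
    show ?thesis
      unfolding UC Dk W using n p eq by (simp add: diff_divide_distrib mult_ac)
  next
    case (adj v a)
    have va: "v \<noteq> a" "v \<notin> \<rho>" using adj by auto
    have int: "\<rho> \<inter> \<sigma> = \<rho> - {a}" using adj by auto
    have ne: "\<sigma> \<noteq> \<rho>" using adj by auto
    have U': "?U = cone_ind S v \<rho> * (incidence \<rho> (insert v \<rho>) * incidence \<sigma> (insert v \<rho>))"
    proof -
      have "incidence \<sigma> (insert w \<rho>) = 0" if w: "w \<in> V - \<rho>" "w \<noteq> v" for w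
      proof (rule ccontr)
        assume "incidence \<sigma> (insert w \<rho>) \<noteq> 0"
        then have "\<sigma> \<subseteq> insert w \<rho>" by (auto elim!: incidence_nonzeroD)
        then show False using adj w by auto
      qed
      then have "?U = (\<Sum>v\<in>{v}. cone_ind S v \<rho> * (incidence \<rho> (insert v \<rho>) * incidence \<sigma> (insert v \<rho>)))"
        unfolding U using adj V by (intro sum.mono_neutral_right) auto
      then show ?thesis by simp
    qed
    have D': "?D = incidence (\<rho> - {a}) \<rho> * incidence (\<rho> - {a}) \<sigma>"
    proof -
      have "incidence (\<rho> - {b}) \<sigma> = 0" if b: "b \<in> \<rho>" "b \<noteq> a" for b
      proof (rule ccontr)
        assume "incidence (\<rho> - {b}) \<sigma> \<noteq> 0"
        then have "\<rho> - {b} \<subseteq> \<sigma>" by (auto elim!: incidence_nonzeroD)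
        then show False using adj va b by auto
      qed
      then have "?D = (\<Sum>a\<in>{a}. incidence (\<rho> - {a}) \<rho> * incidence (\<rho> - {a}) \<sigma>)"
        unfolding D using adj fin by (intro sum.mono_neutral_right) auto
      then show ?thesis by simp
    qed
    have R: "(\<Sum>w\<in>V. step_weight k p S w \<rho> \<sigma>) = step_weight k p S v \<rho> \<sigma>"
    proof -
      have "step_weight k p S w \<rho> \<sigma> = 0" if "w \<noteq> v" for w
        using that adj ne by (auto simp: step_weight_def)
      then have "(\<Sum>w\<in>V. step_weight k p S w \<rho> \<sigma>) = (\<Sum>w\<in>{v}. step_weight k p S w \<rho> \<sigma>)"
        using adj V by (intro sum.mono_neutral_right) auto
      then show ?thesis by simp
    qed
    \<comment> \<open>As \<open>\<sigma>\<close> is a clique, the second indicator in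
      \<open>step_weight\<close> is 1 here. It leaves the matrix unchanged and is present only to
      make the weight centered.\<close>
    have cone: "cone_ind S v (\<rho> - {a}) = 1"
    proof -
      have "pairs \<sigma> = pairs (\<rho> - {a}) \<union> (\<lambda>b. {v, b}) ` (\<rho> - {a})"
        unfolding adj(3) using va by (intro pairs_insert) auto
      then have "(\<lambda>b. {v, b}) ` (\<rho> - {a}) \<subseteq> S" using \<sigma> by (auto simp: cliques_def)
      then show ?thesis by (simp add: cone_ind_def image_subset_iff)
    qed
    have st: "step_weight k p S v \<rho> \<sigma> = incidence (\<rho> - {a}) \<rho> * incidence (\<rho> - {a}) \<sigma> *
        (cone_ind S v \<rho> / p ^ (k + 1) - 1 / p ^ k)"
      using adj ne va unfolding step_weight_def int cone by auto
    \<comment> \<open>The four signs around the square formed by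
      \<open>\<rho> \<inter> \<sigma>\<close>, \<open>\<rho>\<close>, \<open>\<sigma>\<close> and
      \<open>insert v \<rho>\<close>. Its two paths carry opposite signs, hence so do the upper and
      the lower contribution.\<close>
    define x y z w where xyzw: "x = incidence (\<rho> - {a}) \<rho>" "y = incidence \<rho> (insert v \<rho>)"
      "z = incidence (\<rho> - {a}) \<sigma>" "w = incidence \<sigma> (insert v \<rho>)"
    have eqs: "insert v \<rho> - {v} = \<rho>" "insert v \<rho> - {a} = \<sigma>" "insert v \<rho> - {v, a} = \<rho> - {a}"
      using adj va by auto
    have "\<sigma> - {v} = \<rho> - {a}" using adj va by auto
    then have sq: "x * x = 1" "z * z = 1" "w * w = 1"
      using incidence_square[of a \<rho>] incidence_square[of v \<sigma>] incidence_square[of a "insert v \<rho>"]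
        adj eqs unfolding xyzw by auto
    have xy: "x * y = - (z * w)"
      using incidence_opposite[of "insert v \<rho>" v a] fin adj va unfolding xyzw eqs by simp
    have "y * w = (x * x) * (y * w)" using sq by simp
    also have "\<dots> = x * (x * y) * w" by (simp only: mult_ac)
    also have "\<dots> = - (x * z * (w * w))" unfolding xy by (simp add: mult_ac)
    finally have yw: "y * w = - (x * z)" using sq by simp
    have UDR: "?U = - (cone_ind S v \<rho> * (x * z))" "?D = x * z"
      "(\<Sum>v\<in>V. step_weight k p S v \<rho> \<sigma>) = x * z * (cone_ind S v \<rho> / p ^ (k + 1) - 1 / p ^ k)"
      unfolding U' D' R st using yw by (simp_all add: xyzw)
    show ?thesis
      unfolding UDR using n p ne by (simp add: field_simps)
  next
    case far
    have U0: "incidence \<sigma> (insert v \<rho>) = 0" if v: "v \<in> V - \<rho>" for v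
    proof (rule ccontr)
      assume "incidence \<sigma> (insert v \<rho>) \<noteq> 0"
      then obtain a where a: "a \<in> insert v \<rho>" "\<sigma> = insert v \<rho> - {a}" by (rule incidence_nonzeroD)
      then have "a \<noteq> v" using far(1) v by auto
      then have "a \<in> \<rho>" "\<sigma> = insert v (\<rho> - {a})" using a by auto
      then show False using far(2) v by blast
    qed
    have D0: "incidence (\<rho> - {a}) \<sigma> = 0" if a: "a \<in> \<rho>" for a
    proof (rule ccontr)
      assume "incidence (\<rho> - {a}) \<sigma> \<noteq> 0"
      then obtain v where v: "v \<in> \<sigma>" "\<rho> - {a} = \<sigma> - {v}" by (rule incidence_nonzeroD)
      then have eq: "\<sigma> = insert v (\<rho> - {a})" by auto
      then have "v \<notin> \<rho>" using far(1) v a by auto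
      then show False using far(2)[of v a] eq a v \<sigma>' by blast
    qed
    have "step_weight k p S v \<rho> \<sigma> = 0" if "v \<in> V" for v
      using far that by (auto simp: step_weight_def)
    then show ?thesis
      using far(1) U0 D0 unfolding U D by auto
  qed
qed

text \<open>If \<open>\<sigma>\<close> is not a clique, a missing edge joins \<open>v\<close> to a
  vertex of \<open>\<rho> \<inter> \<sigma>\<close>, so both indicators vanish. Consequently a walk
  may pass through arbitrary sets of k + 1 vertices: the index set of the sum becomes deterministic,
  and only the start has to be a clique.\<close>

lemma step_weight_off_cliques:
  assumes \<rho>: "\<rho> \<in> cliques V S (Suc k)" and v: "v \<in> V" and \<sigma>: "\<sigma> \<notin> cliques V S (Suc k)"
  shows "step_weight k p S v \<rho> \<sigma> = 0"
proof -
  have "cone_ind S v (\<rho> \<inter> \<sigma>) = 0 \<and> cone_ind S v \<rho> = 0"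
    if a: "v \<notin> \<rho>" "a \<in> \<rho>" "\<sigma> = insert v (\<rho> - {a})" for a
  proof -
    have int: "\<rho> \<inter> \<sigma> = \<rho> - {a}" using a by auto
    have "finite \<rho>" using \<rho> by (intro card_ge_0_finite) (auto simp: cliques_def)
    then have "\<sigma> \<subseteq> V" "card \<sigma> = Suc k" using \<rho> v a by (auto simp: cliques_def)
    then have "\<not> pairs \<sigma> \<subseteq> S" using \<sigma> by (auto simp: cliques_def)
    moreover have "pairs \<sigma> = pairs (\<rho> - {a}) \<union> (\<lambda>b. {v, b}) ` (\<rho> - {a})"
      unfolding a(3) using a by (intro pairs_insert) auto
    moreover have "pairs (\<rho> - {a}) \<subseteq> S"
      using \<rho> pairs_mono[of "\<rho> - {a}" \<rho>] by (auto simp: cliques_def)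
    ultimately obtain b where "b \<in> \<rho> - {a}" "{v, b} \<notin> S" by blast
    then show ?thesis unfolding int by (auto simp: cone_ind_def)
  qed
  moreover have "\<sigma> \<noteq> \<rho>" using assms by auto
  ultimately show ?thesis by (auto simp: step_weight_def)
qed

text \<open>A walk lists pairs of a vertex and the next simplex. The vertex has to be recorded
  because a step that stays at \<open>\<rho>\<close> can go through any vertex.\<close>

primrec walk_weight ::
  "nat \<Rightarrow> real \<Rightarrow> 'a::linorder set set \<Rightarrow> 'a set \<Rightarrow> ('a \<times> 'a set) list \<Rightarrow> real" where
  "walk_weight k p S \<rho> [] = 1"
| "walk_weight k p S \<rho> (x # xs) = step_weight k p S (fst x) \<rho> (snd x) * walk_weight k p S (snd x) xs"

primrec walk_end :: "'a set \<Rightarrow> ('a \<times> 'a set) list \<Rightarrow> 'a set" where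
  "walk_end \<rho> [] = \<rho>"
| "walk_end \<rho> (x # xs) = walk_end (snd x) xs"

definition walks :: "'a set \<Rightarrow> nat \<Rightarrow> nat \<Rightarrow> ('a \<times> 'a set) list set" where
  "walks V k m = {xs. set xs \<subseteq> V \<times> {\<sigma>. \<sigma> \<subseteq> V \<and> card \<sigma> = Suc k} \<and> length xs = m}"

lemma sum_walks_Suc:
  assumes V: "finite V"
  shows "(\<Sum>xs\<in>walks V k (Suc m). f xs) =
    (\<Sum>v\<in>V. \<Sum>\<sigma> | \<sigma> \<subseteq> V \<and> card \<sigma> = Suc k. \<Sum>xs\<in>walks V k m. f ((v, \<sigma>) # xs))"
proof -
  let ?A = "V \<times> {\<sigma>. \<sigma> \<subseteq> V \<and> card \<sigma> = Suc k}"
  have eq: "walks V k (Suc m) = (\<lambda>(x, xs). x # xs) ` (?A \<times> walks V k m)"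
    by (auto simp: walks_def length_Suc_conv image_iff simp del: subset_iff) fastforce+
  have inj: "inj_on (\<lambda>(x, xs). x # xs) (?A \<times> walks V k m)"
    by (auto simp: inj_on_def)
  have "(\<Sum>xs\<in>walks V k (Suc m). f xs) = (\<Sum>(x, xs)\<in>?A \<times> walks V k m. f (x # xs))"
    unfolding eq by (subst sum.reindex[OF inj]) (simp add: case_prod_beta comp_def)
  also have "\<dots> = (\<Sum>x\<in>?A. \<Sum>xs\<in>walks V k m. f (x # xs))"
    by (rule sum.cartesian_product[symmetric])
  also have "\<dots> = (\<Sum>(v, \<sigma>)\<in>?A. \<Sum>xs\<in>walks V k m. f ((v, \<sigma>) # xs))"
    by (intro sum.cong) auto
  also have "\<dots> = (\<Sum>v\<in>V. \<Sum>\<sigma> | \<sigma> \<subseteq> V \<and> card \<sigma> = Suc k. \<Sum>xs\<in>walks V k m. f ((v, \<sigma>) # xs))"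
    by (rule sum.cartesian_product[symmetric])
  finally show ?thesis .
qed

lemma mpow_walks:
  assumes V: "finite V" and \<rho>: "\<rho> \<in> cliques V S (Suc k)"
    and a: "\<And>\<rho> \<sigma>. \<rho> \<in> cliques V S (Suc k) \<Longrightarrow> \<sigma> \<in> cliques V S (Suc k) \<Longrightarrow>
      a \<rho> \<sigma> = (\<Sum>v\<in>V. step_weight k p S v \<rho> \<sigma>) / c"
  shows "mpow (cliques V S (Suc k)) a m \<rho> \<sigma> =
    (\<Sum>xs\<in>walks V k m. if walk_end \<rho> xs = \<sigma> then walk_weight k p S \<rho> xs else 0) / c ^ m"
  using \<rho>
proof (induction m arbitrary: \<rho>)
  case 0
  have "walks V k 0 = {[]}" by (auto simp: walks_def)
  then show ?case by simp
next
  case (Suc m)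
  let ?I = "cliques V S (Suc k)" and ?\<Delta> = "{\<sigma>. \<sigma> \<subseteq> V \<and> card \<sigma> = Suc k}"
  define F where "F \<pi> = (\<Sum>xs\<in>walks V k m. if walk_end \<pi> xs = \<sigma> then walk_weight k p S \<pi> xs else 0)" for \<pi>
  have "mpow ?I a (Suc m) \<rho> \<sigma> = (\<Sum>\<pi>\<in>?I. (\<Sum>v\<in>V. step_weight k p S v \<rho> \<pi>) / c * (F \<pi> / c ^ m))"
    using Suc a by (simp add: F_def)
  also have "\<dots> = (\<Sum>\<pi>\<in>?I. \<Sum>v\<in>V. step_weight k p S v \<rho> \<pi> * F \<pi>) / c ^ Suc m"
    by (simp add: sum_divide_distrib sum_distrib_right)
  also have "(\<Sum>\<pi>\<in>?I. \<Sum>v\<in>V. step_weight k p S v \<rho> \<pi> * F \<pi>) =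
      (\<Sum>\<pi>\<in>?\<Delta>. \<Sum>v\<in>V. step_weight k p S v \<rho> \<pi> * F \<pi>)"
    using V step_weight_off_cliques[OF Suc.prems]
    by (intro sum.mono_neutral_left) (auto simp: cliques_def)
  also have "\<dots> = (\<Sum>v\<in>V. \<Sum>\<pi>\<in>?\<Delta>. step_weight k p S v \<rho> \<pi> * F \<pi>)"
    by (rule sum.swap)
  also have "\<dots> = (\<Sum>v\<in>V. \<Sum>\<pi>\<in>?\<Delta>. \<Sum>xs\<in>walks V k m.
      if walk_end \<rho> ((v, \<pi>) # xs) = \<sigma> then walk_weight k p S \<rho> ((v, \<pi>) # xs) else 0)"
    unfolding F_def sum_distrib_left by (intro sum.cong refl) auto
  also have "\<dots> = (\<Sum>xs\<in>walks V k (Suc m). if walk_end \<rho> xs = \<sigma> then walk_weight k p S \<rho> xs else 0)"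
    by (rule sum_walks_Suc[OF V, symmetric])
  finally show ?case .
qed

text \<open>The trace of the m-th power of \<open>A\<close>, expanded over closed walks.\<close>

definition clique_trace :: "'a::linorder set \<Rightarrow> nat \<Rightarrow> nat \<Rightarrow> real \<Rightarrow> 'a set set \<Rightarrow> real" where
  "clique_trace V k m p S = (\<Sum>\<rho>\<in>cliques V S (Suc k).
     (\<Sum>xs\<in>walks V k m. if walk_end \<rho> xs = \<rho> then walk_weight k p S \<rho> xs else 0) / real (card V) ^ m)"

lemma dim_homology_le_clique_trace:
  fixes V :: "'a::linorder set"
  assumes V: "finite V" "V \<noteq> {}" and p: "p > 0"
    and dim: "fs.dim (cycles k (clique_complex V S)) =
      fs.dim (cycles k (clique_complex V S) \<inter> boundaries k (clique_complex V S)) + N"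
  shows "real N \<le> clique_trace V k (2 * r) p S"
proof -
  let ?X = "clique_complex V S" and ?I = "cliques V S (Suc k)"
  define a where "a \<rho> \<sigma> = (if \<rho> = \<sigma> then 1 else 0)
        - 1 / (real (card V) * p ^ (k + 1)) * (\<Sum>\<eta> | \<eta> \<in> ?X \<and> card \<eta> = k + 2. incidence \<rho> \<eta> * incidence \<sigma> \<eta>)
        - 1 / (real (card V) * p ^ k) * (\<Sum>\<tau> | \<tau> \<subseteq> V \<and> card \<tau> = k. incidence \<tau> \<rho> * incidence \<tau> \<sigma>)" for \<rho> \<sigma>
  have J: "{\<eta> \<in> ?X. card \<eta> = k + 2} = cliques V S (k + 2)"
    using clique_complex_card[of V S "Suc k"] by simp
  have I: "{\<eta> \<in> ?X. card \<eta> = k + 1} = ?I"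
    using clique_complex_card[of V S k] by simp
  have ent: "a \<rho> \<sigma> = (\<Sum>v\<in>V. step_weight k p S v \<rho> \<sigma>) / real (card V)" if "\<rho> \<in> ?I" "\<sigma> \<in> ?I" for \<rho> \<sigma>
    unfolding a_def J by (rule laplacian_entry[OF V p that])
  have "real N \<le> (\<Sum>\<rho> | \<rho> \<in> ?X \<and> card \<rho> = k + 1. mpow {\<sigma> \<in> ?X. card \<sigma> = k + 1} a (2 * r) \<rho> \<rho>)"
  proof (rule dim_homology_le_trace[OF _ _ dim a_def])
    show "finite ?X" using V by (auto simp: clique_complex_def)
    fix \<eta> a assume \<eta>: "\<eta> \<in> ?X" "card \<eta> = k + 2" "a \<in> \<eta>"
    then have "\<eta> - {a} \<noteq> {}" by (metis One_nat_def card_Diff_singleton_if card.empty add_2_eq_Suc'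
        diff_Suc_1 nat.distinct(1))
    then show "\<eta> - {a} \<in> ?X"
      using \<eta> pairs_mono[of "\<eta> - {a}" \<eta>] by (auto simp: clique_complex_def)
  qed
  then show ?thesis
    unfolding I clique_trace_def using mpow_walks[OF V(1) _ ent] by simp
qed

text \<open>With all edges present and p = 1 every step weight is 0, so already the trace of the
  square vanishes. This disposes of all times from 1 on, including possible infinite bars.\<close>

lemma dim_homology_full_simplex:
  fixes V :: "'a::linorder set"
  assumes V: "finite V" "V \<noteq> {}"
    and dim: "fs.dim (cycles k (clique_complex V (pairs V))) =
      fs.dim (cycles k (clique_complex V (pairs V)) \<inter> boundaries k (clique_complex V (pairs V))) + N"
  shows "N = 0"
proof -
  have st: "step_weight k 1 (pairs V) v \<rho> \<sigma> = 0" if "\<rho> \<subseteq> V" "v \<in> V" for v \<rho> \<sigma>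
  proof -
    have "cone_ind (pairs V) v \<tau> = 1" if "\<tau> \<subseteq> \<rho>" "v \<notin> \<rho>" for \<tau>
      using that \<open>\<rho> \<subseteq> V\<close> \<open>v \<in> V\<close> by (force simp: cone_ind_def pairs_def card_2_iff)
    then show ?thesis by (auto simp: step_weight_def)
  qed
  have "walk_weight k 1 (pairs V) \<rho> xs = 0" if "\<rho> \<subseteq> V" "xs \<in> walks V k 2" for \<rho> xs
    using that st by (auto simp: walks_def length_Suc_conv numeral_2_eq_2)
  then have "clique_trace V k (2 * 1) 1 (pairs V) = 0"
    unfolding clique_trace_def by (intro sum.neutral ballI) (auto simp: cliques_def intro!: sum.neutral)
  then show ?thesis
    using dim_homology_le_clique_trace[OF V _ dim, of 1 1] by simp
qed

section \<open>Independent edges\<close>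

text \<open>Expectation over a random subset of \<open>E\<close> that contains each element
  independently with probability \<open>p\<close>. As a finite sum it can be treated algebraically;
  \<open>nn_integral_edge_set\<close> links it to the edge weights.\<close>

definition bern_exp :: "'e set \<Rightarrow> real \<Rightarrow> ('e set \<Rightarrow> real) \<Rightarrow> real" where
  "bern_exp E p g = (\<Sum>S\<in>Pow E. p ^ card S * (1 - p) ^ card (E - S) * g S)"

text \<open>Takes the place of measurability with respect to the edges in \<open>J\<close>.\<close>

definition depends_on :: "('e set \<Rightarrow> 'c) \<Rightarrow> 'e set \<Rightarrow> bool" where
  "depends_on f J \<longleftrightarrow> (\<forall>S. f S = f (S \<inter> J))"

lemma depends_on_mono:
  assumes "depends_on f J" "J \<subseteq> J'"
  shows "depends_on f J'"
  unfolding depends_on_def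
proof
  fix S
  have "f (S \<inter> J') = f (S \<inter> J' \<inter> J)" using assms(1) unfolding depends_on_def by blast
  also have "S \<inter> J' \<inter> J = S \<inter> J" using assms(2) by blast
  also have "f (S \<inter> J) = f S"
    by (rule sym) (use assms(1) in \<open>unfold depends_on_def, blast\<close>)
  finally show "f S = f (S \<inter> J')" ..
qed

lemma depends_on_comp: "depends_on f J \<Longrightarrow> depends_on (\<lambda>S. h (f S)) J"
  unfolding depends_on_def by (intro allI arg_cong[where f = h]) blast

lemma depends_on_comp2: "depends_on f J \<Longrightarrow> depends_on g J \<Longrightarrow> depends_on (\<lambda>S. h (f S) (g S)) J"
  unfolding depends_on_def by (intro allI arg_cong2[where f = h]) blast+

lemma depends_on_prod:
  fixes f :: "'i \<Rightarrow> 'e set \<Rightarrow> real"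
  shows "(\<And>i. i \<in> A \<Longrightarrow> depends_on (f i) J) \<Longrightarrow> depends_on (\<lambda>S. \<Prod>i\<in>A. f i S) J"
  unfolding depends_on_def by (intro allI prod.cong refl) blast

lemma bern_exp_const:
  assumes "finite E"
  shows "bern_exp E p (\<lambda>_. c) = c"
proof -
  have "(\<Sum>S\<in>Pow E. p ^ card S * (1 - p) ^ card (E - S)) = (\<Prod>e\<in>E. p + (1 - p))"
    unfolding prod_add[OF assms] by simp
  then show ?thesis by (simp add: bern_exp_def flip: sum_distrib_right)
qed

lemma bern_exp_cong: "(\<And>S. S \<subseteq> E \<Longrightarrow> f S = g S) \<Longrightarrow> bern_exp E p f = bern_exp E p g"
  unfolding bern_exp_def by (intro sum.cong) auto

lemma bern_exp_mono:
  assumes "0 \<le> p" "p \<le> 1" "\<And>S. S \<subseteq> E \<Longrightarrow> f S \<le> g S"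
  shows "bern_exp E p f \<le> bern_exp E p g"
  unfolding bern_exp_def using assms by (intro sum_mono mult_left_mono) auto

lemma bern_exp_nonneg:
  "0 \<le> p \<Longrightarrow> p \<le> 1 \<Longrightarrow> (\<And>S. S \<subseteq> E \<Longrightarrow> 0 \<le> g S) \<Longrightarrow> 0 \<le> bern_exp E p g"
  unfolding bern_exp_def by (intro sum_nonneg mult_nonneg_nonneg) auto

lemma bern_exp_sum: "bern_exp E p (\<lambda>S. \<Sum>i\<in>A. f i S) = (\<Sum>i\<in>A. bern_exp E p (f i))"
  unfolding bern_exp_def by (simp add: sum_distrib_left) (rule sum.swap)

lemma bern_exp_add: "bern_exp E p (\<lambda>S. f S + g S) = bern_exp E p f + bern_exp E p g"
  unfolding bern_exp_def by (simp add: sum.distrib distrib_left)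

lemma bern_exp_diff: "bern_exp E p (\<lambda>S. f S - g S) = bern_exp E p f - bern_exp E p g"
  unfolding bern_exp_def by (simp add: sum_subtractf right_diff_distrib)

lemma bern_exp_cmult: "bern_exp E p (\<lambda>S. c * f S) = c * bern_exp E p f"
  unfolding bern_exp_def by (simp add: sum_distrib_left mult_ac)

text \<open>The weight of a set is the product of the weights of its parts inside and outside
  \<open>J\<close>, and the two functions see one part each.\<close>

lemma bern_exp_split:
  assumes E: "finite E" "J \<subseteq> E" and f: "depends_on f J" and g: "depends_on g J'" and J: "J \<inter> J' = {}"
  shows "bern_exp E p (\<lambda>S. f S * g S) = bern_exp J p f * bern_exp (E - J) p g"
proof -
  let ?h = "\<lambda>(S, T). S \<union> T :: 'a set"
  have bij: "bij_betw ?h (Pow J \<times> Pow (E - J)) (Pow E)"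
    by (rule bij_betw_byWitness[where f' = "\<lambda>S. (S \<inter> J, S - J)"]) (use E in auto)
  have "bern_exp E p (\<lambda>S. f S * g S) =
      (\<Sum>(S, T)\<in>Pow J \<times> Pow (E - J). p ^ card (S \<union> T) * (1 - p) ^ card (E - (S \<union> T)) * (f (S \<union> T) * g (S \<union> T)))"
    unfolding bern_exp_def by (subst sum.reindex_bij_betw[OF bij, symmetric]) (simp add: case_prod_beta)
  also have "\<dots> = (\<Sum>(S, T)\<in>Pow J \<times> Pow (E - J).
      (p ^ card S * (1 - p) ^ card (J - S) * f S) * (p ^ card T * (1 - p) ^ card (E - J - T) * g T))"
  proof (intro sum.cong refl, clarify)
    fix S T assume S: "S \<subseteq> J" and T: "T \<subseteq> E - J"
    have fin: "finite S" "finite T" "finite J" using S T E by (auto intro: finite_subset)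
    have c1: "card (S \<union> T) = card S + card T"
      using S T fin by (intro card_Un_disjoint) auto
    have "E - (S \<union> T) = (J - S) \<union> (E - J - T)" using S T E by auto
    then have c2: "card (E - (S \<union> T)) = card (J - S) + card (E - J - T)"
      using E fin by (simp add: card_Un_disjoint Int_Diff Diff_Int_distrib2 disjoint_iff)
    have "f (S \<union> T) = f ((S \<union> T) \<inter> J)" using f by (simp add: depends_on_def)
    also have "(S \<union> T) \<inter> J = S" using S T by auto
    finally have f': "f (S \<union> T) = f S" .
    have "g (S \<union> T) = g ((S \<union> T) \<inter> J')" using g by (simp add: depends_on_def)
    also have "(S \<union> T) \<inter> J' = T \<inter> J'" using S J by auto
    also have "g (T \<inter> J') = g T" using g unfolding depends_on_def by metis
    finally have g': "g (S \<union> T) = g T" .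
    show "p ^ card (S \<union> T) * (1 - p) ^ card (E - (S \<union> T)) * (f (S \<union> T) * g (S \<union> T)) =
      (p ^ card S * (1 - p) ^ card (J - S) * f S) * (p ^ card T * (1 - p) ^ card (E - J - T) * g T)"
      unfolding c1 c2 f' g' power_add by (simp only: mult_ac)
  qed
  also have "\<dots> = bern_exp J p f * bern_exp (E - J) p g"
    unfolding bern_exp_def sum_product by (rule sum.cartesian_product[symmetric])
  finally show ?thesis .
qed

lemma bern_exp_indep:
  assumes E: "finite E" "J \<subseteq> E" and f: "depends_on f J" and g: "depends_on g J'" and J: "J \<inter> J' = {}"
  shows "bern_exp E p (\<lambda>S. f S * g S) = bern_exp E p f * bern_exp E p g"
proof -
  have c: "depends_on (\<lambda>_. 1::real) K" for K :: "'a set" by (simp add: depends_on_def)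
  have "bern_exp E p f = bern_exp J p f"
    using bern_exp_split[OF E f c[of "{}"]] E by (simp add: bern_exp_const)
  moreover have "bern_exp E p g = bern_exp (E - J) p g"
    using bern_exp_split[OF E c g J] E by (simp add: bern_exp_const finite_subset)
  ultimately show ?thesis using bern_exp_split[OF assms] by simp
qed

lemma bern_exp_superset:
  assumes E: "finite E" "F \<subseteq> E"
  shows "bern_exp E p (\<lambda>S. if F \<subseteq> S then 1 else 0) = p ^ card F"
proof -
  have f: "depends_on (\<lambda>S. if F \<subseteq> S then 1 else 0 :: real) F" by (auto simp: depends_on_def)
  have c: "depends_on (\<lambda>_. 1::real) {}" by (simp add: depends_on_def)
  have "bern_exp E p (\<lambda>S. if F \<subseteq> S then 1 else 0) = bern_exp F p (\<lambda>S. if F \<subseteq> S then 1 else 0)"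
    using bern_exp_split[OF E f c] E by (simp add: bern_exp_const)
  also have "\<dots> = (\<Sum>S\<in>{F}. p ^ card S * (1 - p) ^ card (F - S))"
    unfolding bern_exp_def using E
    by (intro sum.mono_neutral_cong_right) (auto intro: finite_subset)
  finally show ?thesis by simp
qed

section \<open>Moments of clique counts and of step weights\<close>

lemma finite_pairs: "finite V \<Longrightarrow> finite (pairs V)"
  by (rule finite_subset[of _ "Pow V"]) (auto simp: pairs_def)

lemma card_pairs: "finite \<rho> \<Longrightarrow> card (pairs \<rho>) = card \<rho> choose 2"
  unfolding pairs_def by (rule n_subsets)

lemma doubleton_in_pairs: "{v, a} \<in> pairs V \<longleftrightarrow> v \<in> V \<and> a \<in> V \<and> v \<noteq> a"
  by (auto simp: pairs_def card_insert_if)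

lemma bern_exp_cliques:
  assumes "finite V"
  shows "bern_exp (pairs V) p (\<lambda>S. real (card (cliques V S j))) = real (card V choose j) * p ^ (j choose 2)"
proof -
  let ?\<Delta> = "{\<sigma>. \<sigma> \<subseteq> V \<and> card \<sigma> = j}"
  have fin: "finite ?\<Delta>" using assms by simp
  have "real (card (cliques V S j)) = (\<Sum>\<sigma>\<in>?\<Delta>. if pairs \<sigma> \<subseteq> S then 1 else 0)" for S
  proof -
    have "cliques V S j = {\<sigma> \<in> ?\<Delta>. pairs \<sigma> \<subseteq> S}" by (auto simp: cliques_def)
    then show ?thesis using fin by (simp add: sum.If_cases Int_def)
  qed
  then have "bern_exp (pairs V) p (\<lambda>S. real (card (cliques V S j))) =
      (\<Sum>\<sigma>\<in>?\<Delta>. bern_exp (pairs V) p (\<lambda>S. if pairs \<sigma> \<subseteq> S then 1 else 0))"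
    by (simp only: bern_exp_sum)
  also have "\<dots> = (\<Sum>\<sigma>\<in>?\<Delta>. p ^ (j choose 2))"
    using assms finite_pairs[OF assms] pairs_mono[of _ V]
    by (intro sum.cong refl) (auto simp: bern_exp_superset card_pairs finite_subset)
  also have "\<dots> = real (card V choose j) * p ^ (j choose 2)"
    using n_subsets[OF assms, of j] by simp
  finally show ?thesis .
qed

lemma depends_on_cone_ind:
  assumes "\<tau> \<subseteq> \<rho>"
  shows "depends_on (\<lambda>S. cone_ind S v \<tau>) ((\<lambda>a. {v, a}) ` \<rho>)"
  using assms by (auto simp: depends_on_def cone_ind_def)

lemma depends_on_step_weight:
  "depends_on (\<lambda>S. step_weight k p S v \<rho> \<sigma>) ((\<lambda>a. {v, a}) ` \<rho>)"
  unfolding depends_on_def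
proof
  fix S
  have "cone_ind S v \<tau> = cone_ind (S \<inter> (\<lambda>a. {v, a}) ` \<rho>) v \<tau>" if "\<tau> \<subseteq> \<rho>" for \<tau>
    using depends_on_cone_ind[OF that, of v] unfolding depends_on_def by blast
  from this[of \<rho>] this[of "\<rho> \<inter> \<sigma>"]
  show "step_weight k p S v \<rho> \<sigma> = step_weight k p (S \<inter> (\<lambda>a. {v, a}) ` \<rho>) v \<rho> \<sigma>"
    unfolding step_weight_def by simp
qed

lemma bern_exp_cone_ind:
  assumes V: "finite V" and v: "v \<in> V" "v \<notin> \<tau>" "\<tau> \<subseteq> V"
  shows "bern_exp (pairs V) p (\<lambda>S. cone_ind S v \<tau>) = p ^ card \<tau>"
proof -
  let ?F = "(\<lambda>a. {v, a}) ` \<tau>"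
  have "?F \<subseteq> pairs V" using v by (auto simp: doubleton_in_pairs)
  moreover have "cone_ind S v \<tau> = (if ?F \<subseteq> S then 1 else 0)" for S
    by (auto simp: cone_ind_def)
  moreover have "card ?F = card \<tau>"
    by (intro card_image) (auto simp: inj_on_def doubleton_eq_iff)
  ultimately show ?thesis
    using bern_exp_superset[OF finite_pairs[OF V], of ?F p] by simp
qed

lemma step_weight_outside:
  "\<not> \<sigma> \<subseteq> insert v \<rho> \<Longrightarrow> step_weight k p S v \<rho> \<sigma> = 0"
  by (auto simp: step_weight_def)

text \<open>The powers of p in \<open>step_weight\<close> are the means of the indicators that they
  divide: \<open>v\<close> has k + 1 edges to \<open>\<rho>\<close> and k edges to
  \<open>\<rho> \<inter> \<sigma>\<close>.\<close>

lemma bern_exp_step_weight: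
  assumes V: "finite V" and v: "v \<in> V" "v \<notin> \<rho>" and \<rho>: "\<rho> \<subseteq> V" "card \<rho> = Suc k" and p: "0 < p"
  shows "bern_exp (pairs V) p (\<lambda>S. step_weight k p S v \<rho> \<sigma>) = 0"
proof -
  have c: "bern_exp (pairs V) p (\<lambda>S. cone_ind S v \<rho>) = p ^ (k + 1)"
    using bern_exp_cone_ind[OF V v \<rho>(1)] \<rho> by simp
  consider "\<sigma> = \<rho>" | a where "\<sigma> \<noteq> \<rho>" "a \<in> \<rho>" "\<sigma> = insert v (\<rho> - {a})"
    | "\<sigma> \<noteq> \<rho>" "\<not> (\<exists>a\<in>\<rho>. \<sigma> = insert v (\<rho> - {a}))" by blast
  then show ?thesis
  proof cases
    case 1
    have "bern_exp (pairs V) p (\<lambda>S. 1 - (1 / p ^ (k + 1)) * cone_ind S v \<rho>) = 0"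
      unfolding bern_exp_diff bern_exp_cmult c using p finite_pairs[OF V] by (simp add: bern_exp_const)
    then show ?thesis using 1 v by (simp add: step_weight_def)
  next
    case 2
    let ?s = "incidence (\<rho> \<inter> \<sigma>) \<rho> * incidence (\<rho> \<inter> \<sigma>) \<sigma>"
    have "\<rho> \<inter> \<sigma> = \<rho> - {a}" using 2 v by auto
    then have "card (\<rho> \<inter> \<sigma>) = k" using 2 \<rho> V by (simp add: finite_subset)
    then have c': "bern_exp (pairs V) p (\<lambda>S. cone_ind S v (\<rho> \<inter> \<sigma>)) = p ^ k"
      using bern_exp_cone_ind[OF V v(1), of "\<rho> \<inter> \<sigma>" p] v \<rho> by auto
    have "bern_exp (pairs V) p (\<lambda>S. ?s * ((1 / p ^ (k + 1)) * cone_ind S v \<rho> -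
        (1 / p ^ k) * cone_ind S v (\<rho> \<inter> \<sigma>))) = 0"
      unfolding bern_exp_diff bern_exp_cmult c c' using p by simp
    moreover have "step_weight k p S v \<rho> \<sigma> = ?s * ((1 / p ^ (k + 1)) * cone_ind S v \<rho> -
        (1 / p ^ k) * cone_ind S v (\<rho> \<inter> \<sigma>))" for S
      using 2 v unfolding step_weight_def by auto
    ultimately show ?thesis by simp
  next
    case 3
    then show ?thesis using v finite_pairs[OF V] by (simp add: step_weight_def bern_exp_const)
  qed
qed

lemma step_weight_abs:
  assumes p: "0 < p" "p \<le> 1"
  shows "\<bar>step_weight k p S v \<rho> \<sigma>\<bar> \<le> 1 / p ^ (k + 1)"
proof -
  let ?L = "1 / p ^ (k + 1)"
  have pk: "0 < p ^ k" "p ^ (k + 1) \<le> p ^ k" "p ^ k \<le> 1" "0 < p ^ (k + 1)" "p ^ (k + 1) \<le> 1"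
    using p by (auto simp: mult_le_one power_le_one mult_left_le_one_le)
  have L: "1 \<le> ?L" "1 / p ^ k \<le> ?L" "0 \<le> 1 / p ^ k"
    using pk p by (auto simp: field_simps)
  have d: "\<bar>x - y\<bar> \<le> ?L" if "0 \<le> x" "x \<le> ?L" "0 \<le> y" "y \<le> ?L" for x y
    using that by auto
  have i: "0 \<le> cone_ind S v \<tau> / q" "cone_ind S v \<tau> / q \<le> 1 / q" if "q > 0" for \<tau> q
    using that by (auto simp: cone_ind_def)
  have inc: "\<bar>incidence a b * incidence c e * z\<bar> \<le> ?L" if "\<bar>z\<bar> \<le> ?L" for a b c e :: "'a set" and z
  proof -
    have "\<bar>incidence a b * incidence c e\<bar> \<le> 1"
      unfolding abs_mult using incidence_abs by (intro mult_le_one) auto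
    then show ?thesis unfolding abs_mult[of _ z] using that
      by (meson abs_ge_zero mult_left_le_one_le order_trans)
  qed
  have 1: "\<bar>1 - 1 / p ^ k\<bar> \<le> ?L" using L by (intro d) auto
  have 2: "\<bar>1 - cone_ind S v \<rho> / p ^ (k + 1)\<bar> \<le> ?L"
    using L i[OF pk(4)] by (intro d) auto
  have 3: "\<bar>cone_ind S v \<rho> / p ^ (k + 1) - cone_ind S v (\<rho> \<inter> \<sigma>) / p ^ k\<bar> \<le> ?L"
    by (rule d[OF i(1)[OF pk(4)] i(2)[OF pk(4)] i(1)[OF pk(1)] order_trans[OF i(2)[OF pk(1)] L(2)]])
  show ?thesis
    unfolding step_weight_def using 1 2 inc[OF 3] L by auto
qed

text \<open>At an unseen vertex the first moment is available, and it is bounded since the weight is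
  a difference of two terms of mean 1. At a vertex seen before, correlations leave only the supremum
  bound \<open>step_weight_abs\<close>.\<close>

lemma bern_exp_abs_step_weight:
  assumes V: "finite V" and v: "v \<in> V" "v \<notin> \<rho>" and \<rho>: "\<rho> \<subseteq> V" "card \<rho> = Suc k"
    and p: "0 < p" "p \<le> 1"
  shows "bern_exp (pairs V) p (\<lambda>S. \<bar>step_weight k p S v \<rho> \<sigma>\<bar>) \<le> 2"
proof -
  have c: "bern_exp (pairs V) p (\<lambda>S. cone_ind S v \<rho>) = p ^ (k + 1)"
    using bern_exp_cone_ind[OF V v \<rho>(1)] \<rho> by simp
  have ci: "0 \<le> cone_ind S v \<tau>" for S \<tau> by (simp add: cone_ind_def)
  consider "\<sigma> = \<rho>" | a where "\<sigma> \<noteq> \<rho>" "a \<in> \<rho>" "\<sigma> = insert v (\<rho> - {a})"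
    | "\<sigma> \<noteq> \<rho>" "\<not> (\<exists>a\<in>\<rho>. \<sigma> = insert v (\<rho> - {a}))" by blast
  then show ?thesis
  proof cases
    case 1
    have "bern_exp (pairs V) p (\<lambda>S. \<bar>step_weight k p S v \<rho> \<sigma>\<bar>) \<le>
        bern_exp (pairs V) p (\<lambda>S. 1 + (1 / p ^ (k + 1)) * cone_ind S v \<rho>)"
    proof (intro bern_exp_mono)
      fix S
      have "0 \<le> cone_ind S v \<rho> / p ^ (k + 1)" using ci p by simp
      then show "\<bar>step_weight k p S v \<rho> \<sigma>\<bar> \<le> 1 + (1 / p ^ (k + 1)) * cone_ind S v \<rho>"
        using 1 v by (simp add: step_weight_def abs_le_iff)
    qed (use p in auto)
    also have "\<dots> = 2"
      unfolding bern_exp_add bern_exp_cmult c using p finite_pairs[OF V] by (simp add: bern_exp_const)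
    finally show ?thesis .
  next
    case 2
    let ?s = "incidence (\<rho> \<inter> \<sigma>) \<rho> * incidence (\<rho> \<inter> \<sigma>) \<sigma>"
    have "\<rho> \<inter> \<sigma> = \<rho> - {a}" using 2 v by auto
    then have "card (\<rho> \<inter> \<sigma>) = k" using 2 \<rho> V by (simp add: finite_subset)
    then have c': "bern_exp (pairs V) p (\<lambda>S. cone_ind S v (\<rho> \<inter> \<sigma>)) = p ^ k"
      using bern_exp_cone_ind[OF V v(1), of "\<rho> \<inter> \<sigma>" p] v \<rho> by auto
    have "bern_exp (pairs V) p (\<lambda>S. \<bar>step_weight k p S v \<rho> \<sigma>\<bar>) \<le>
        bern_exp (pairs V) p (\<lambda>S. (1 / p ^ (k + 1)) * cone_ind S v \<rho> + (1 / p ^ k) * cone_ind S v (\<rho> \<inter> \<sigma>))"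
    proof (intro bern_exp_mono)
      fix S
      let ?x = "cone_ind S v \<rho> / p ^ (k + 1)" and ?y = "cone_ind S v (\<rho> \<inter> \<sigma>) / p ^ k"
      have "\<bar>?s\<bar> \<le> 1"
        unfolding abs_mult using incidence_abs by (intro mult_le_one) auto
      moreover have "step_weight k p S v \<rho> \<sigma> = ?s * (?x - ?y)"
        using 2 v unfolding step_weight_def by auto
      ultimately have "\<bar>step_weight k p S v \<rho> \<sigma>\<bar> \<le> \<bar>?x - ?y\<bar>"
        by (simp add: abs_mult mult_left_le_one_le)
      also have "\<dots> \<le> ?x + ?y"
      proof -
        have "0 \<le> ?x" "0 \<le> ?y" using ci p by simp_all
        then show ?thesis by linarith
      qed
      finally show "\<bar>step_weight k p S v \<rho> \<sigma>\<bar> \<le>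
          (1 / p ^ (k + 1)) * cone_ind S v \<rho> + (1 / p ^ k) * cone_ind S v (\<rho> \<inter> \<sigma>)" by simp
    qed (use p in auto)
    also have "\<dots> = 2"
      unfolding bern_exp_add bern_exp_cmult c c' using p by simp
    finally show ?thesis .
  next
    case 3
    then show ?thesis using v finite_pairs[OF V] by (simp add: step_weight_def bern_exp_const)
  qed
qed

section \<open>Expected weights of walks\<close>

primrec old_steps :: "'a set \<Rightarrow> ('a \<times> 'a set) list \<Rightarrow> nat" where
  "old_steps U [] = 0"
| "old_steps U (x # xs) = (if fst x \<in> U then 1 else 0) + old_steps (insert (fst x) U) xs"

text \<open>A necessary condition for a nonzero weight that does not involve the random edges. It
  leaves at most k + 2 choices for the next simplex once the vertex is chosen.\<close>

primrec valid_walk :: "'a set \<Rightarrow> ('a \<times> 'a set) list \<Rightarrow> bool" where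
  "valid_walk \<rho> [] = True"
| "valid_walk \<rho> (x # xs) = (snd x \<subseteq> insert (fst x) \<rho> \<and> valid_walk (snd x) xs)"

lemma walk_weight_invalid: "\<not> valid_walk \<rho> xs \<Longrightarrow> walk_weight k p S \<rho> xs = 0"
proof (induction xs arbitrary: \<rho>)
  case (Cons x xs)
  then show ?case
    by (cases "snd x \<subseteq> insert (fst x) \<rho>") (simp_all add: step_weight_outside)
qed simp

lemma walks_Cons_iff:
  "x # xs \<in> walks V k m \<longleftrightarrow>
    fst x \<in> V \<and> snd x \<subseteq> V \<and> card (snd x) = Suc k \<and> (\<exists>m'. m = Suc m' \<and> xs \<in> walks V k m')"
  by (cases x) (auto simp: walks_def)

text \<open>The function \<open>g\<close> carries the start condition and the absolute weights of
  the steps already taken; it depends only on edges inside the set \<open>U\<close> of vertices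
  seen. A step through a new vertex uses edges outside \<open>pairs U\<close>, so it is independent
  of \<open>g\<close> and costs a factor 2. A step through an old vertex is bounded by its
  supremum.\<close>

lemma bern_exp_abs_walk_weight:
  assumes V: "finite V" and p: "0 < p" "p \<le> 1"
    and U: "U \<subseteq> V" "\<rho> \<subseteq> U" "card \<rho> = Suc k" and xs: "xs \<in> walks V k m"
    and g: "\<And>S. 0 \<le> g S" "depends_on g (pairs U)"
  shows "bern_exp (pairs V) p (\<lambda>S. g S * \<bar>walk_weight k p S \<rho> xs\<bar>)
    \<le> bern_exp (pairs V) p g * ((1 / p ^ (k + 1)) ^ old_steps U xs * 2 ^ m)"
  using U xs g
proof (induction xs arbitrary: U \<rho> g m)
  case Nil
  then show ?case by (simp add: walks_def)
next
  case (Cons x xs)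
  obtain v \<sigma> where x: "x = (v, \<sigma>)" by fastforce
  from Cons.prems(4) obtain m' where m: "m = Suc m'" "xs \<in> walks V k m'" and
    v: "v \<in> V" and \<sigma>: "\<sigma> \<subseteq> V" "card \<sigma> = Suc k"
    unfolding x walks_Cons_iff by auto
  let ?E = "bern_exp (pairs V) p" and ?L = "1 / p ^ (k + 1)"
  define h where "h S = g S * \<bar>step_weight k p S v \<rho> \<sigma>\<bar>" for S
  have Eg: "0 \<le> ?E g" using p Cons.prems(5) by (intro bern_exp_nonneg) auto
  have L0: "0 < ?L" using p by simp
  show ?case
  proof (cases "\<sigma> \<subseteq> insert v \<rho>")
    case False
    then have "walk_weight k p S \<rho> (x # xs) = 0" for S
      by (simp add: x step_weight_outside)
    then have "?E (\<lambda>S. g S * \<bar>walk_weight k p S \<rho> (x # xs)\<bar>) = 0"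
      using V by (simp add: bern_exp_const finite_pairs del: walk_weight.simps)
    also have "0 \<le> ?E g * (?L ^ old_steps U (x # xs) * 2 ^ m)"
      using Eg L0 by (intro mult_nonneg_nonneg zero_le_power) auto
    finally show ?thesis .
  next
    case True
    have U: "insert v U \<subseteq> V" "\<sigma> \<subseteq> insert v U" using v Cons.prems True by auto
    have h0: "0 \<le> h S" for S using Cons.prems(5) by (simp add: h_def)
    have hE: "?E h \<le> ?E g * ((if v \<in> U then ?L else 1) * 2)"
    proof (cases "v \<in> U")
      case old: True
      have "?E h \<le> ?E (\<lambda>S. ?L * g S)"
        using p step_weight_abs[OF p] Cons.prems(5) unfolding h_def mult.commute[of ?L]
        by (intro bern_exp_mono mult_left_mono) auto
      also have "\<dots> = ?E g * ?L" unfolding bern_exp_cmult by (rule mult.commute)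
      also have "\<dots> \<le> ?E g * (?L * 2)"
        using L0 by (intro mult_left_mono Eg) linarith
      finally show ?thesis using old by simp
    next
      case new: False
      have "(\<lambda>a. {v, a}) ` \<rho> \<subseteq> pairs V"
        using v subsetD[OF Cons.prems(1)] subsetD[OF Cons.prems(2)] new
        by (auto simp: doubleton_in_pairs)
      moreover have "(\<lambda>a. {v, a}) ` \<rho> \<inter> pairs U = {}"
        using new by (auto simp: pairs_def)
      ultimately have "?E h = ?E (\<lambda>S. \<bar>step_weight k p S v \<rho> \<sigma>\<bar>) * ?E g"
        unfolding h_def mult.commute[of "g _"]
        by (rule bern_exp_indep[OF finite_pairs[OF V] _ depends_on_comp[OF depends_on_step_weight] Cons.prems(6)])
      also have "\<dots> \<le> 2 * ?E g"
        using Eg Cons.prems new by (intro mult_right_mono bern_exp_abs_step_weight V v p) auto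
      finally show ?thesis using new by (simp add: mult.commute)
    qed
    have dep: "depends_on h (pairs (insert v U))"
      unfolding h_def
    proof (intro depends_on_comp2[where h = "(*)"] depends_on_comp[where h = abs])
      show "depends_on g (pairs (insert v U))"
        using Cons.prems(6) by (rule depends_on_mono) (rule pairs_mono, blast)
      show "depends_on (\<lambda>S. step_weight k p S v \<rho> \<sigma>) (pairs (insert v U))"
      proof (cases "v \<in> \<rho>")
        case True
        then show ?thesis by (simp add: step_weight_def depends_on_def)
      next
        case False
        show ?thesis
          by (rule depends_on_mono[OF depends_on_step_weight])
            (use False Cons.prems(2) in \<open>auto simp: doubleton_in_pairs\<close>)
      qed
    qed
    have "?E (\<lambda>S. g S * \<bar>walk_weight k p S \<rho> (x # xs)\<bar>) = ?E (\<lambda>S. h S * \<bar>walk_weight k p S \<sigma> xs\<bar>)"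
      by (simp add: x h_def abs_mult mult.assoc)
    also have "\<dots> \<le> ?E h * (?L ^ old_steps (insert v U) xs * 2 ^ m')"
      by (rule Cons.IH[OF U \<sigma>(2) m(2) h0 dep])
    also have "\<dots> \<le> ?E g * ((if v \<in> U then ?L else 1) * 2) * (?L ^ old_steps (insert v U) xs * 2 ^ m')"
      using L0 by (intro mult_right_mono hE) auto
    also have "\<dots> = ?E g * (?L ^ old_steps U (x # xs) * 2 ^ m)"
      by (simp add: x m)
    finally show ?thesis .
  qed
qed

lemma card_less_Suc_conv:
  "card {i. i < Suc n \<and> P i} = (if P 0 then 1 else 0) + card {i. i < n \<and> P (Suc i)}"
proof -
  have "{i. i < Suc n \<and> P i} = (if P 0 then {0} else {}) \<union> Suc ` {i. i < n \<and> P (Suc i)}"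
    by (auto simp: image_iff less_Suc_eq_0_disj)
  moreover have "card (Suc ` {i. i < n \<and> P (Suc i)}) = card {i. i < n \<and> P (Suc i)}"
    by (simp add: card_image)
  ultimately show ?thesis by auto
qed

lemma old_steps_eq_card:
  "old_steps U xs = card {i. i < length xs \<and> fst (xs ! i) \<in> U \<union> (\<lambda>j. fst (xs ! j)) ` {..<i}}"
proof (induction xs arbitrary: U)
  case (Cons x xs)
  have "(\<lambda>j. fst ((x # xs) ! j)) ` {..<Suc i} = insert (fst x) ((\<lambda>j. fst (xs ! j)) ` {..<i})" for i
    by (simp add: lessThan_Suc_eq_insert_0 image_image)
  then show ?case by (simp add: card_less_Suc_conv Cons.IH disj_ac)
qed simp

lemma walk_weight_prod:
  "walk_weight k p S \<rho> xs = (\<Prod>i<length xs.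
    step_weight k p S (fst (xs ! i)) (if i = 0 then \<rho> else snd (xs ! (i - 1))) (snd (xs ! i)))"
proof (induction xs arbitrary: \<rho>)
  case (Cons x xs)
  have "(\<Prod>i<length xs. step_weight k p S (fst (xs ! i)) (if i = 0 then snd x else snd (xs ! (i - 1))) (snd (xs ! i))) =
    (\<Prod>i<length xs. step_weight k p S (fst (xs ! i)) (snd ((x # xs) ! i)) (snd (xs ! i)))"
    by (intro prod.cong refl) (auto simp: nth_Cons')
  then show ?case by (simp add: Cons.IH prod.lessThan_Suc_shift del: prod.lessThan_Suc)
qed simp

text \<open>A step through a vertex seen for the first time has mean zero, so it survives only if one of its
  edges is used again. By then both endpoints are old, and a step uses only \<open>k + 1\<close> edges: hence there
  are at most \<open>k + 1\<close> new vertices for each old one.\<close>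

lemma bern_exp_walk_weight_eq_0:
  fixes V :: "'a::linorder set"
  assumes V: "finite V" and p: "0 < p"
    and \<rho>: "\<rho> \<subseteq> V" "card \<rho> = Suc k" and xs: "xs \<in> walks V k m"
    and g: "depends_on g (pairs \<rho>)" and m: "(k + 2) * old_steps \<rho> xs < m"
  shows "bern_exp (pairs V) p (\<lambda>S. g S * walk_weight k p S \<rho> xs) = 0"
proof -
  define v where "v i = fst (xs ! i)" for i
  define r where "r i = (if i = 0 then \<rho> else snd (xs ! (i - 1)))" for i
  define U where "U i = \<rho> \<union> v ` {..<i}" for i
  \<comment> \<open>The edges that step \<open>i\<close> looks at. If \<open>v i\<close> lies in
    \<open>r i\<close>, this also contains a singleton, which is not an edge; for a new vertex all
    members are edges.\<close>
  define D where "D i = (\<lambda>a. {v i, a}) ` r i" for i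
  have len: "length xs = m" using xs by (simp add: walks_def)
  have W: "walk_weight k p S \<rho> xs = (\<Prod>i<m. step_weight k p S (v i) (r i) (r (Suc i)))" for S
    unfolding walk_weight_prod len v_def r_def by simp
  have vV: "v i \<in> V" and rV: "r (Suc i) \<subseteq> V" "card (r (Suc i)) = Suc k" if "i < m" for i
  proof -
    have "xs ! i \<in> V \<times> {\<sigma>. \<sigma> \<subseteq> V \<and> card \<sigma> = Suc k}"
      using xs that len nth_mem[of i xs] unfolding walks_def by blast
    then show "v i \<in> V" "r (Suc i) \<subseteq> V" "card (r (Suc i)) = Suc k"
      by (auto simp: v_def r_def)
  qed
  have r: "r i \<subseteq> V" "card (r i) = Suc k" "finite (r i)" if "i < m" for i
  proof -
    show "r i \<subseteq> V" "card (r i) = Suc k"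
      using rV[of "i - 1"] that \<rho> by (cases i; simp add: r_def)+
    then show "finite (r i)" using V finite_subset by blast
  qed
  show ?thesis
  proof (cases "\<forall>i<m. r (Suc i) \<subseteq> insert (v i) (r i)")
    case False
    then obtain i where "i < m" "\<not> r (Suc i) \<subseteq> insert (v i) (r i)" by blast
    then have "walk_weight k p S \<rho> xs = 0" for S
      unfolding W by (intro prod_zero bexI[of _ i]) (auto simp: step_weight_outside)
    then show ?thesis using V by (simp add: bern_exp_const finite_pairs)
  next
    case steps: True
    have rU: "r i \<subseteq> U i" if "i \<le> m" for i
      using that
    proof (induction i)
      case 0
      then show ?case by (simp add: r_def U_def)
    next
      case (Suc i)
      then have "r (Suc i) \<subseteq> insert (v i) (U i)"
        using steps[rule_format, of i] by auto
      then show ?case by (auto simp: U_def lessThan_Suc)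
    qed
    have Umono: "U i \<subseteq> U j" if "i \<le> j" for i j using that by (auto simp: U_def)
    define Old where "Old = {i. i < m \<and> v i \<in> U i}"
    define New where "New = {i. i < m \<and> v i \<notin> U i}"
    have cardOld: "card Old = old_steps \<rho> xs"
      unfolding old_steps_eq_card Old_def U_def v_def len ..
    have cardNew: "card New + card Old = m"
    proof -
      have "New \<union> Old = {..<m}" "New \<inter> Old = {}" by (auto simp: New_def Old_def)
      moreover have "finite New" "finite Old" by (auto simp: New_def Old_def)
      ultimately show ?thesis by (metis card_Un_disjoint card_lessThan)
    qed
    \<comment> \<open>Edges of step \<open>i\<close> have both ends among the vertices seen by the
      end of that step, whereas every edge of \<open>D j\<close> contains \<open>v j\<close>, unseen
      before step \<open>j\<close>.\<close>
    have disj: "D i \<inter> D j = {}" if "i < j" "j \<in> New" for i j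
    proof -
      have "e \<subseteq> U (Suc i)" if "e \<in> D i" for e
        using that rU[of i] \<open>i < j\<close> \<open>j \<in> New\<close> by (auto simp: D_def U_def New_def lessThan_Suc)
      moreover have "v j \<notin> U (Suc i)"
        using Umono[of "Suc i" j] that by (auto simp: New_def)
      moreover have "v j \<in> e" if "e \<in> D j" for e
        using that by (auto simp: D_def)
      ultimately show ?thesis by blast
    qed
    have "\<exists>i\<in>New. \<forall>j\<in>Old. D i \<inter> D j = {}"
    proof (rule ccontr)
      assume "\<not> (\<exists>i\<in>New. \<forall>j\<in>Old. D i \<inter> D j = {})"
      then have "\<forall>i\<in>New. \<exists>e. e \<in> D i \<and> e \<in> (\<Union>j\<in>Old. D j)" by blast
      then obtain c where c: "\<And>i. i \<in> New \<Longrightarrow> c i \<in> D i" "\<And>i. i \<in> New \<Longrightarrow> c i \<in> (\<Union>j\<in>Old. D j)"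
        by metis
      \<comment> \<open>Of two new steps, the later one shares no edge with the earlier one, so the
        shared edges chosen for them are distinct. All of them must fit among the at most k + 1
        edges of each old step.\<close>
      have "inj_on c New"
      proof (rule inj_onI, rule ccontr)
        fix i j assume ij: "i \<in> New" "j \<in> New" "c i = c j" "i \<noteq> j"
        then have "D i \<inter> D j = {}" using disj[of i j] disj[of j i] by (cases "i < j") auto
        then show False using c(1)[OF ij(1)] c(1)[OF ij(2)] ij(3) by auto
      qed
      moreover have finD: "finite (\<Union>j\<in>Old. D j)"
        using r by (auto simp: D_def Old_def)
      ultimately have "card New \<le> card (\<Union>j\<in>Old. D j)"
        using c(2) by (intro card_inj_on_le[of c]) auto
      also have "\<dots> \<le> (\<Sum>j\<in>Old. card (D j))"
        by (intro card_UN_le) (simp add: Old_def)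
      also have "\<dots> \<le> (\<Sum>j\<in>Old. Suc k)"
      proof (intro sum_mono)
        fix j assume "j \<in> Old"
        then have j: "j < m" by (simp add: Old_def)
        show "card (D j) \<le> Suc k"
          unfolding D_def using card_image_le[OF r(3)[OF j], of "\<lambda>a. {v j, a}"] r(2)[OF j] by simp
      qed
      finally have "m \<le> (k + 2) * card Old" using cardNew by (simp add: algebra_simps)
      then show False using m cardOld by simp
    qed
    then obtain i where i: "i \<in> New" "\<And>j. j \<in> Old \<Longrightarrow> D i \<inter> D j = {}" by blast
    have im: "i < m" and vi: "v i \<notin> U i" using i(1) by (auto simp: New_def)
    have vr: "v i \<notin> r i" "v i \<notin> \<rho>" using vi rU[of i] im by (auto simp: U_def)
    let ?J = "pairs \<rho> \<union> (\<Union>j\<in>{..<m} - {i}. D j)"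
    let ?f = "\<lambda>j S. step_weight k p S (v j) (r j) (r (Suc j))"
    have "D i \<inter> D j = {}" if "j < m" "j \<noteq> i" for j
    proof (cases "j \<in> Old")
      case False
      then have "j \<in> New" using that by (auto simp: New_def Old_def)
      then show ?thesis using disj[of i j] disj[of j i] that i(1) by (cases "i < j") auto
    qed (use i in auto)
    moreover have "D i \<inter> pairs \<rho> = {}" using vr by (auto simp: D_def pairs_def)
    ultimately have DJ: "D i \<inter> ?J = {}" by blast
    have "bern_exp (pairs V) p (\<lambda>S. ?f i S * (g S * (\<Prod>j\<in>{..<m} - {i}. ?f j S))) =
        bern_exp (pairs V) p (?f i) * bern_exp (pairs V) p (\<lambda>S. g S * (\<Prod>j\<in>{..<m} - {i}. ?f j S))"
    proof (rule bern_exp_indep[OF finite_pairs[OF V] _ _ _ DJ])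
      show "D i \<subseteq> pairs V" using vV[OF im] r(1)[OF im] vr by (auto simp: D_def doubleton_in_pairs)
      show "depends_on (?f i) (D i)" unfolding D_def by (rule depends_on_step_weight)
      show "depends_on (\<lambda>S. g S * (\<Prod>j\<in>{..<m} - {i}. ?f j S)) ?J"
      proof (intro depends_on_comp2[where h = "(*)"] depends_on_prod)
        show "depends_on g ?J" using g by (rule depends_on_mono) auto
        fix j assume "j \<in> {..<m} - {i}"
        then show "depends_on (?f j) ?J"
          by (intro depends_on_mono[OF depends_on_step_weight]) (auto simp: D_def)
      qed
    qed
    also have "bern_exp (pairs V) p (?f i) = 0"
      using im vr by (intro bern_exp_step_weight V vV r p)
    finally have "bern_exp (pairs V) p (\<lambda>S. ?f i S * (g S * (\<Prod>j\<in>{..<m} - {i}. ?f j S))) = 0" by simp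
    moreover have "g S * walk_weight k p S \<rho> xs = ?f i S * (g S * (\<Prod>j\<in>{..<m} - {i}. ?f j S))" for S
      unfolding W using im by (subst prod.remove[of _ i]) (auto simp: mult_ac)
    ultimately show ?thesis by presburger
  qed
qed

text \<open>A revisit has a bounded number of choices for its vertex instead of
  \<open>card V\<close>, so weighting it by \<open>card V\<close> keeps the total per step of order
  \<open>card V\<close>. These factors cancel against the normalization of the trace.\<close>

lemma sum_valid_walks:
  assumes V: "finite V" "V \<noteq> {}" and \<rho>: "finite \<rho>" "card \<rho> = Suc k" and U: "finite U"
  shows "(\<Sum>xs\<in>walks V k m. if valid_walk \<rho> xs then real (card V) ^ old_steps U xs else 0)
    \<le> (real (k + 2) * real (card V) * real (card U + m)) ^ m"
  using \<rho> U
proof (induction m arbitrary: \<rho> U)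
  case 0
  have "walks V k 0 = {[]}" by (auto simp: walks_def)
  then show ?case by simp
next
  case (Suc m)
  let ?n = "real (card V)" and ?\<Delta> = "{\<sigma>. \<sigma> \<subseteq> V \<and> card \<sigma> = Suc k}"
  let ?B = "(real (k + 2) * ?n * real (card U + Suc m)) ^ m"
  define F where "F v \<sigma> = (\<Sum>xs\<in>walks V k m. if valid_walk \<sigma> xs then ?n ^ old_steps (insert v U) xs else 0)" for v \<sigma>
  have n: "1 \<le> ?n" using V by (simp add: Suc_le_eq card_gt_0_iff)
  have FB: "F v \<sigma> \<le> ?B" if "\<sigma> \<in> ?\<Delta>" for v \<sigma>
  proof -
    have "F v \<sigma> \<le> (real (k + 2) * ?n * real (card (insert v U) + m)) ^ m"
      unfolding F_def using that V Suc.prems by (intro Suc.IH) (auto intro: finite_subset)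
    also have "\<dots> \<le> ?B"
      using Suc.prems(3) by (intro power_mono mult_left_mono) (auto simp: card_insert_if)
    finally show ?thesis .
  qed
  have cnt: "card {\<sigma>. \<sigma> \<subseteq> insert v \<rho> \<and> card \<sigma> = Suc k} \<le> k + 2" for v
    using Suc.prems(1,2) by (simp add: n_subsets card_insert_if)
  have "(\<Sum>xs\<in>walks V k (Suc m). if valid_walk \<rho> xs then ?n ^ old_steps U xs else 0) =
      (\<Sum>v\<in>V. \<Sum>\<sigma>\<in>?\<Delta>. if \<sigma> \<subseteq> insert v \<rho> then (if v \<in> U then ?n else 1) * F v \<sigma> else 0)"
    unfolding sum_walks_Suc[OF V(1)] F_def sum_distrib_left by (intro sum.cong refl) (auto intro!: sum.cong)
  also have "\<dots> \<le> (\<Sum>v\<in>V. (if v \<in> U then ?n else 1) * (real (k + 2) * ?B))"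
  proof (intro sum_mono)
    fix v
    let ?w = "if v \<in> U then ?n else 1"
    have w: "0 \<le> ?w" using n by simp
    have "(\<Sum>\<sigma>\<in>?\<Delta>. if \<sigma> \<subseteq> insert v \<rho> then ?w * F v \<sigma> else 0) =
        (\<Sum>\<sigma>\<in>{\<sigma> \<in> ?\<Delta>. \<sigma> \<subseteq> insert v \<rho>}. ?w * F v \<sigma>)"
      using V by (intro sum.inter_filter[symmetric]) simp
    also have "\<dots> \<le> (\<Sum>\<sigma>\<in>{\<sigma> \<in> ?\<Delta>. \<sigma> \<subseteq> insert v \<rho>}. ?w * ?B)"
      using FB w by (intro sum_mono mult_left_mono) auto
    also have "\<dots> = real (card {\<sigma> \<in> ?\<Delta>. \<sigma> \<subseteq> insert v \<rho>}) * (?w * ?B)" by simp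
    also have "\<dots> \<le> real (k + 2) * (?w * ?B)"
    proof (intro mult_right_mono)
      have "card {\<sigma> \<in> ?\<Delta>. \<sigma> \<subseteq> insert v \<rho>} \<le> card {\<sigma>. \<sigma> \<subseteq> insert v \<rho> \<and> card \<sigma> = Suc k}"
        using Suc.prems(1) by (intro card_mono) auto
      then show "real (card {\<sigma> \<in> ?\<Delta>. \<sigma> \<subseteq> insert v \<rho>}) \<le> real (k + 2)"
        using cnt[of v] by linarith
    qed (use w n in auto)
    finally show "(\<Sum>\<sigma>\<in>?\<Delta>. if \<sigma> \<subseteq> insert v \<rho> then ?w * F v \<sigma> else 0) \<le> ?w * (real (k + 2) * ?B)"
      by (simp only: mult_ac)
  qed
  also have "\<dots> = (\<Sum>v\<in>V. if v \<in> U then ?n else 1) * (real (k + 2) * ?B)"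
    by (simp only: sum_distrib_right)
  also have "\<dots> \<le> (?n * real (card U + Suc m)) * (real (k + 2) * ?B)"
  proof (intro mult_right_mono)
    \<comment> \<open>At most \<open>card V\<close> unseen choices of weight 1 and
      \<open>card U\<close> seen ones of weight \<open>card V\<close>. Enlarging
      \<open>card U + 1\<close> to \<open>card U + Suc m\<close> matches the base already present in
      \<open>?B\<close>, which has room for the growth of \<open>U\<close> along the walk.\<close>
    have "(\<Sum>v\<in>V. if v \<in> U then ?n else 1) \<le> (\<Sum>v\<in>V. (if v \<in> U then ?n else 0) + 1)"
      by (intro sum_mono) auto
    also have "\<dots> = real (card (V \<inter> U)) * ?n + ?n"
      using V by (simp add: sum.distrib sum.If_cases)
    also have "\<dots> \<le> real (card U) * ?n + ?n * real (Suc m)"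
      using Suc.prems(3) n by (intro add_mono mult_right_mono) (auto intro: card_mono)
    also have "\<dots> = ?n * real (card U + Suc m)" by (simp add: algebra_simps)
    finally show "(\<Sum>v\<in>V. if v \<in> U then ?n else 1) \<le> ?n * real (card U + Suc m)" .
  qed simp
  also have "\<dots> = (real (k + 2) * ?n * real (card U + Suc m)) ^ Suc m"
    by (simp only: power_Suc mult_ac)
  finally show ?case .
qed

text \<open>Walks with fewer than \<open>R\<close> revisits have expectation 0. For the others, the
  factor p^(-(k+1)) of each revisit is split into \<open>card V\<close> divided by
  \<open>card V * p ^ (k + 1)\<close>: the numerators are absorbed by the count in
  \<open>sum_valid_walks\<close>, and at least \<open>R\<close> of the denominators, all at least 1,
  remain as decay.\<close>

lemma bern_exp_clique_trace:
  fixes V :: "'a::linorder set"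
  assumes V: "finite V" "V \<noteq> {}" and p: "0 < p" "p \<le> 1"
    and d: "1 \<le> real (card V) * p ^ (k + 1)" and m: "m = (k + 2) * R"
  shows "bern_exp (pairs V) p (clique_trace V k m p) \<le>
    real (card V choose Suc k) * p ^ (Suc k choose 2) *
      ((2 * real (k + 2) * real (k + 1 + m)) ^ m / (real (card V) * p ^ (k + 1)) ^ R)"
proof -
  let ?n = "real (card V)" and ?E = "bern_exp (pairs V) p" and ?\<Delta> = "{\<sigma>. \<sigma> \<subseteq> V \<and> card \<sigma> = Suc k}"
  let ?d = "?n * p ^ (k + 1)" and ?e = "Suc k choose 2"
  let ?K = "(2 * real (k + 2) * real (k + 1 + m)) ^ m / ?d ^ R"
  have n: "1 \<le> ?n" using V by (simp add: Suc_le_eq card_gt_0_iff)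
  \<comment> \<open>The condition that the start is a clique, as a factor of the weight, so that the
    sum can run over all sets of k + 1 vertices. The factor is independent of all edges to new
    vertices.\<close>
  define g where "g \<rho> S = (if pairs \<rho> \<subseteq> S then 1 else 0 :: real)" for \<rho> :: "'a set" and S
  have bound: "?E (\<lambda>S. g \<rho> S * ((\<Sum>xs\<in>walks V k m. if walk_end \<rho> xs = \<rho> then walk_weight k p S \<rho> xs else 0) / ?n ^ m))
      \<le> p ^ ?e * ?K" if \<rho>: "\<rho> \<in> ?\<Delta>" for \<rho>
  proof -
    have fin: "finite \<rho>" using \<rho> V finite_subset by auto
    have dep: "depends_on (g \<rho>) (pairs \<rho>)" by (auto simp: g_def depends_on_def)
    have Eg: "?E (g \<rho>) = p ^ ?e"
      unfolding g_def using \<rho> V fin pairs_mono[of \<rho> V]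
      by (subst bern_exp_superset) (simp_all add: finite_pairs card_pairs)
    have walk: "?E (\<lambda>S. g \<rho> S * walk_weight k p S \<rho> xs) \<le>
        p ^ ?e * 2 ^ m / ?d ^ R * (if valid_walk \<rho> xs then ?n ^ old_steps \<rho> xs else 0)"
      if xs: "xs \<in> walks V k m" for xs
    proof (cases "valid_walk \<rho> xs \<and> m \<le> (k + 2) * old_steps \<rho> xs")
      case True
      then have "(k + 2) * R \<le> (k + 2) * old_steps \<rho> xs" unfolding m by blast
      then have "R \<le> old_steps \<rho> xs" by (simp only: mult_le_cancel1)
      then have dR: "?d ^ R \<le> ?d ^ old_steps \<rho> xs" using d by (intro power_increasing)
      have "?E (\<lambda>S. g \<rho> S * walk_weight k p S \<rho> xs) \<le> ?E (\<lambda>S. g \<rho> S * \<bar>walk_weight k p S \<rho> xs\<bar>)"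
        using p by (intro bern_exp_mono) (auto simp: g_def)
      also have "\<dots> \<le> ?E (g \<rho>) * ((1 / p ^ (k + 1)) ^ old_steps \<rho> xs * 2 ^ m)"
        using \<rho> by (intro bern_exp_abs_walk_weight V p xs dep) (auto simp: g_def)
      also have "(1 / p ^ (k + 1)) ^ old_steps \<rho> xs = ?n ^ old_steps \<rho> xs / ?d ^ old_steps \<rho> xs"
        using n p by (simp add: power_mult_distrib power_one_over field_simps)
      also have "?E (g \<rho>) * (?n ^ old_steps \<rho> xs / ?d ^ old_steps \<rho> xs * 2 ^ m) \<le>
          p ^ ?e * (?n ^ old_steps \<rho> xs / ?d ^ R * 2 ^ m)"
        unfolding Eg using dR d n p
        by (intro mult_left_mono mult_right_mono divide_left_mono mult_pos_pos zero_less_power) auto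
      finally show ?thesis using True by (simp add: mult_ac)
    next
      case False
      have "?E (\<lambda>S. g \<rho> S * walk_weight k p S \<rho> xs) = 0"
      proof (cases "valid_walk \<rho> xs")
        case True
        then show ?thesis
          using False \<rho> by (intro bern_exp_walk_weight_eq_0[OF V(1) p(1) _ _ xs dep]) auto
      next
        case False
        then show ?thesis using V by (simp add: walk_weight_invalid bern_exp_const finite_pairs)
      qed
      also have "0 \<le> p ^ ?e * 2 ^ m / ?d ^ R * (if valid_walk \<rho> xs then ?n ^ old_steps \<rho> xs else 0)"
        using p n by simp
      finally show ?thesis .
    qed
    have "?E (\<lambda>S. g \<rho> S * ((\<Sum>xs\<in>walks V k m. if walk_end \<rho> xs = \<rho> then walk_weight k p S \<rho> xs else 0) / ?n ^ m)) =
      ?E (\<lambda>S. (1 / ?n ^ m) * (\<Sum>xs\<in>walks V k m. if walk_end \<rho> xs = \<rho> then g \<rho> S * walk_weight k p S \<rho> xs else 0))"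
      unfolding sum_distrib_left sum_divide_distrib by (intro bern_exp_cong sum.cong refl) auto
    also have "\<dots> = (1 / ?n ^ m) *
        (\<Sum>xs\<in>walks V k m. ?E (\<lambda>S. if walk_end \<rho> xs = \<rho> then g \<rho> S * walk_weight k p S \<rho> xs else 0))"
      unfolding bern_exp_cmult bern_exp_sum ..
    also have "\<dots> \<le> (1 / ?n ^ m) * (\<Sum>xs\<in>walks V k m.
        p ^ ?e * 2 ^ m / ?d ^ R * (if valid_walk \<rho> xs then ?n ^ old_steps \<rho> xs else 0))"
    proof (intro mult_left_mono sum_mono)
      fix xs assume xs: "xs \<in> walks V k m"
      have "0 \<le> p ^ ?e * 2 ^ m / ?d ^ R * (if valid_walk \<rho> xs then ?n ^ old_steps \<rho> xs else 0)"
        using p n by simp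
      then show "?E (\<lambda>S. if walk_end \<rho> xs = \<rho> then g \<rho> S * walk_weight k p S \<rho> xs else 0) \<le>
          p ^ ?e * 2 ^ m / ?d ^ R * (if valid_walk \<rho> xs then ?n ^ old_steps \<rho> xs else 0)"
        using walk[OF xs] V by (cases "walk_end \<rho> xs = \<rho>") (simp_all add: bern_exp_const finite_pairs)
    qed (use n in simp)
    also have "\<dots> \<le> (1 / ?n ^ m) * (p ^ ?e * 2 ^ m / ?d ^ R *
        (real (k + 2) * ?n * real (card \<rho> + m)) ^ m)"
      unfolding sum_distrib_left[symmetric] using p n \<rho> fin
      by (intro mult_left_mono sum_valid_walks V) auto
    also have "\<dots> = p ^ ?e * ?K"
    proof -
      have "card \<rho> + m = k + 1 + m" using \<rho> by simp
      then show ?thesis unfolding power_mult_distrib using n by simp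
    qed
    finally show ?thesis .
  qed
  have eq: "clique_trace V k m p S = (\<Sum>\<rho>\<in>?\<Delta>. g \<rho> S *
      ((\<Sum>xs\<in>walks V k m. if walk_end \<rho> xs = \<rho> then walk_weight k p S \<rho> xs else 0) / ?n ^ m))" for S
    unfolding clique_trace_def using V
    by (intro sum.mono_neutral_cong_left) (auto simp: cliques_def g_def)
  have "?E (clique_trace V k m p) \<le> (\<Sum>\<rho>\<in>?\<Delta>. p ^ ?e * ?K)"
    unfolding eq bern_exp_sum by (intro sum_mono bound)
  also have "\<dots> = real (card V choose Suc k) * p ^ ?e * ?K"
    using n_subsets[OF V(1), of "Suc k"] by simp
  finally show ?thesis .
qed

section \<open>The random clique complex process\<close>

definition edge_set :: "nat \<Rightarrow> (nat set \<Rightarrow> real) \<Rightarrow> real \<Rightarrow> nat set set" where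
  "edge_set n u t = {e \<in> pairs {..<n}. u e \<le> t}"

lemma dim_subspace_mono:
  assumes "W \<subseteq> Z" and D: "finite D" "Z \<subseteq> fs.span D"
  shows "fs.dim W \<le> fs.dim Z"
proof -
  obtain B where B: "B \<subseteq> Z" "fs.independent B" "Z \<subseteq> fs.span B"
    using fs.maximal_independent_subset[of Z] by blast
  have "B \<subseteq> fs.span D" using B(1) D(2) by blast
  then have "finite B" using fs.independent_span_bound[OF D(1) B(2)] by blast
  then have "fs.dim W \<le> card B" using assms(1) B(3) by (intro fs.dim_le_card) auto
  then show ?thesis using fs.basis_card_eq_dim[OF B(1,3,2)] by simp
qed

lemma chains_clique_complex:
  "chains k (clique_complex V S) = {f. \<forall>\<sigma>. f \<sigma> \<noteq> 0 \<longrightarrow> \<sigma> \<in> cliques V S (Suc k)}"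
  unfolding clique_complex_card[symmetric] by (auto simp: chains_def)

text \<open>Rank counting: the cycles have dimension f_k minus the rank of the boundary map, a rank
  of at most f_(k-1), and the bounding cycles have dimension at most f_(k+1). For k = 0 the count
  f_(-1) is that of the empty set, in accordance with reduced homology.\<close>

lemma dim_homology_bounds:
  fixes V :: "'a::linorder set"
  assumes V: "finite V"
    and dim: "fs.dim (cycles k (clique_complex V S)) =
      fs.dim (cycles k (clique_complex V S) \<inter> boundaries k (clique_complex V S)) + N"
  shows "N \<le> card (cliques V S (Suc k))"
    and "real (card (cliques V S (Suc k))) - real (card (cliques V S k)) -
      real (card (cliques V S (k + 2))) \<le> real N"
proof -
  let ?X = "clique_complex V S" and ?i = "\<lambda>x::'a set. indicator {x} :: 'a set \<Rightarrow> real"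
  have X: "finite ?X" using V by (auto simp: clique_complex_def)
  have fin: "finite (?i ` cliques V S j)" for j using finite_cliques[OF V] by simp
  have chsp: "chains j ?X \<subseteq> fs.span (?i ` cliques V S (Suc j))" for j
    unfolding chains_clique_complex span_indicators[OF finite_cliques[OF V]] by blast
  have chdim: "fs.dim (chains j ?X) = card (cliques V S (Suc j))" for j
    unfolding chains_clique_complex by (rule dim_supported[OF finite_cliques[OF V]])
  have cyc: "cycles k ?X \<subseteq> chains k ?X" by (auto simp: cycles_def)
  have rn: "fs.dim (chains j ?X) = fs.dim {z \<in> chains j ?X. boundary z = 0} + fs.dim (boundary ` chains j ?X)" for j
    using boundary_add[OF X] boundary_scale[OF X]
    by (intro fsp.rank_nullity[OF subspace_chains fin chsp]) auto
  have "fs.dim (cycles k ?X) \<le> fs.dim (chains k ?X)"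
    by (rule dim_subspace_mono[OF cyc fin chsp])
  then show "N \<le> card (cliques V S (Suc k))" using dim chdim by simp
  have img: "boundary ` chains k ?X \<subseteq> fs.span (?i ` cliques V S k)"
  proof -
    have "\<tau> \<in> cliques V S k" if f: "f \<in> chains k ?X" and b: "boundary f \<tau> \<noteq> 0" for f \<tau>
    proof -
      from b obtain \<sigma> where \<sigma>: "incidence \<tau> \<sigma> * f \<sigma> \<noteq> 0"
        unfolding boundary_chains[OF X f] by (metis (no_types, lifting) sum.neutral)
      then have c: "\<sigma> \<in> cliques V S (Suc k)" using f by (auto simp: chains_clique_complex)
      have "incidence \<tau> \<sigma> \<noteq> 0" using \<sigma> by auto
      then obtain v where "v \<in> \<sigma>" "\<tau> = \<sigma> - {v}" by (rule incidence_nonzeroD)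
      then show ?thesis
        using c pairs_mono[of \<tau> \<sigma>] by (auto simp: cliques_def)
    qed
    then show ?thesis
      unfolding span_indicators[OF finite_cliques[OF V], symmetric] by auto
  qed
  have "fs.dim (boundary ` chains k ?X) \<le> card (?i ` cliques V S k)"
    by (rule fs.dim_le_card[OF img fin])
  also have "\<dots> \<le> card (cliques V S k)" by (rule card_image_le[OF finite_cliques[OF V]])
  finally have 1: "fs.dim (boundary ` chains k ?X) \<le> card (cliques V S k)" .
  have ceq: "cycles k ?X = {z \<in> chains k ?X. boundary z = 0}"
    by (simp add: cycles_def zero_fun_def)
  have "cycles k ?X \<inter> boundaries k ?X \<subseteq> boundary ` chains (k + 1) ?X"
    by (auto simp: boundaries_def)
  moreover have "boundary ` chains (k + 1) ?X \<subseteq> fs.span (boundary ` (?i ` cliques V S (k + 2)))"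
  proof
    fix y assume "y \<in> boundary ` chains (k + 1) ?X"
    then obtain f where f: "f \<in> chains (k + 1) ?X" "y = boundary f" by blast
    have supp: "f \<sigma> \<noteq> 0 \<Longrightarrow> \<sigma> \<in> cliques V S (k + 2)" for \<sigma>
      using f(1) by (auto simp: chains_clique_complex)
    have "y = (\<Sum>\<sigma>\<in>cliques V S (k + 2). (\<lambda>\<tau>. f \<sigma> * boundary (?i \<sigma>) \<tau>))"
    proof
      fix \<tau>
      have "boundary (?i \<sigma>) \<tau> = incidence \<tau> \<sigma>" for \<sigma>
        by (subst boundary_eq[of "{\<sigma>}"]) (auto split: split_indicator_asm)
      moreover have "boundary f = (\<lambda>\<tau>. \<Sum>\<sigma>\<in>cliques V S (k + 2). incidence \<tau> \<sigma> * f \<sigma>)"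
        by (rule boundary_eq[OF finite_cliques[OF V] supp])
      ultimately show "y \<tau> = (\<Sum>\<sigma>\<in>cliques V S (k + 2). (\<lambda>\<tau>. f \<sigma> * boundary (?i \<sigma>) \<tau>)) \<tau>"
        unfolding f(2) sum_fun_apply by (simp add: mult.commute)
    qed
    also have "\<dots> \<in> fs.span (boundary ` (?i ` cliques V S (k + 2)))"
      by (intro fs.span_sum fs.span_scale fs.span_base) auto
    finally show "y \<in> fs.span (boundary ` (?i ` cliques V S (k + 2)))" .
  qed
  ultimately have "fs.dim (cycles k ?X \<inter> boundaries k ?X) \<le> card (boundary ` (?i ` cliques V S (k + 2)))"
    using fin by (intro fs.dim_le_card) auto
  also have "\<dots> \<le> card (cliques V S (k + 2))"
    by (metis (no_types) card_image_le finite_cliques[OF V] image_image)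
  finally have 2: "fs.dim (cycles k ?X \<inter> boundaries k ?X) \<le> card (cliques V S (k + 2))" .
  show "real (card (cliques V S (Suc k))) - real (card (cliques V S k)) -
      real (card (cliques V S (k + 2))) \<le> real N"
    using rn[of k] chdim[of k] ceq dim 1 2 by simp
qed

text \<open>The trace dominates a Betti number. Nonnegativity is what allows it under an integral
  with values in \<open>ennreal\<close>.\<close>

lemma clique_trace_nonneg:
  fixes V :: "'a::linorder set"
  assumes V: "finite V" "V \<noteq> {}" and p: "p > 0"
  shows "0 \<le> clique_trace V k (2 * r) p S"
proof -
  let ?X = "clique_complex V S"
  have X: "finite ?X" using V by (auto simp: clique_complex_def)
  have "fs.dim (cycles k ?X \<inter> boundaries k ?X) \<le> fs.dim (cycles k ?X)"
  proof (rule dim_subspace_mono)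
    show "cycles k ?X \<subseteq> fs.span ((\<lambda>x. indicator {x}) ` ?X)"
      unfolding span_indicators[OF X, symmetric] by (auto simp: cycles_def chains_def)
  qed (use X in auto)
  then obtain N where "fs.dim (cycles k ?X) = fs.dim (cycles k ?X \<inter> boundaries k ?X) + N"
    using le_Suc_ex by blast
  from dim_homology_le_clique_trace[OF V p this, of r] show ?thesis by linarith
qed

section \<open>The process as a filtration and its barcode\<close>

lemma clique_process_eq:
  assumes "t < 1"
  shows "clique_process n u t = clique_complex {..<n} (edge_set n u t)"
  using assms by (simp add: clique_process_def edge_set_def)

lemma clique_process_eq_full:
  assumes "1 \<le> t"
  shows "clique_process n u t = clique_complex {..<n} (pairs {..<n})"
  using assms pairs_mono[of _ "{..<n}"] by (auto simp: clique_process_def clique_complex_def)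

lemma is_barcode_clique_process: "is_barcode k (clique_process n u) (barcode k (clique_process n u))"
proof -
  \<comment> \<open>The entrance time of a simplex. The cap at 1 makes the complex full from time 1
    on, whatever the values of \<open>u\<close>; the inserted 0 gives vertices, which have no pairs,
    the entrance time 0. Hence barcodes exist for every \<open>u\<close>, not just almost
    surely.\<close>
  define w where "w \<sigma> = min 1 (Max (insert 0 (u ` pairs \<sigma>)))" for \<sigma> :: "nat set"
  have "\<exists>bs. is_barcode k (clique_process n u) bs"
  proof (rule barcode_exists)
    show "finite {\<sigma>. \<sigma> \<noteq> {} \<and> \<sigma> \<subseteq> {..<n}}" by simp
    fix t :: real assume t: "0 \<le> t"
    have "w \<sigma> \<le> t \<longleftrightarrow> 1 \<le> t \<or> (\<forall>e\<in>pairs \<sigma>. u e \<le> t)" if "\<sigma> \<subseteq> {..<n}" for \<sigma>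
    proof -
      have "finite (pairs \<sigma>)" using that by (intro finite_pairs) (auto intro: finite_subset)
      then show ?thesis using t by (auto simp: w_def min_le_iff_disj)
    qed
    then show "clique_process n u t = {\<sigma> \<in> {\<sigma>. \<sigma> \<noteq> {} \<and> \<sigma> \<subseteq> {..<n}}. w \<sigma> \<le> t}"
      using pairs_mono[of _ "{..<n}"] by (auto simp: clique_process_def clique_complex_def)
  qed
  then show ?thesis unfolding barcode_def by (rule someI_ex)
qed

text \<open>For a barcode \<open>bs\<close> of a filtration and \<open>t \<ge> 0\<close>, this is
  the Betti number at time \<open>t\<close>.\<close>

definition alive :: "(real \<times> ereal) list \<Rightarrow> real \<Rightarrow> nat" where
  "alive bs t = card {i. i < length bs \<and> fst (bs ! i) \<le> t \<and> ereal t < snd (bs ! i)}"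

lemma emeasure_bar:
  assumes "0 \<le> b" "ereal b < d"
  shows "emeasure lborel {t. b \<le> t \<and> ereal t < d} = e2ennreal (d - ereal b)"
proof (cases d)
  case (real r)
  have "{t. b \<le> t \<and> ereal t < d} = {b..<r}" using real by auto
  then show ?thesis using assms real by (simp add: ennreal.abs_eq[symmetric] e2ennreal_ereal)
next
  case PInf
  have "of_nat m \<le> emeasure lborel {b..}" for m
  proof -
    have "of_nat m = emeasure lborel {b..b + real m}" by (simp add: ennreal_of_nat_eq_real_of_nat)
    also have "\<dots> \<le> emeasure lborel {b..}" by (intro emeasure_mono) auto
    finally show ?thesis .
  qed
  then have "\<not> emeasure lborel {b..} < \<top>"
    using ennreal_Ex_less_of_nat[of "emeasure lborel {b..}"] leD by blast
  then have "emeasure lborel {b..} = \<top>"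
    by (simp add: less_top[symmetric])
  moreover have "{t. b \<le> t \<and> ereal t < d} = {b..}" using PInf by auto
  ultimately show ?thesis using PInf by simp
next
  case MInf
  then show ?thesis using assms by simp
qed

lemma sum_bars_eq_nn_integral:
  assumes "\<forall>(b, d)\<in>set bs. 0 \<le> b \<and> ereal b < d"
  shows "(\<Sum>(b, d)\<leftarrow>bs. e2ennreal (d - ereal b)) =
    (\<integral>\<^sup>+t. of_nat (alive bs t) * indicator {0..} t \<partial>lborel)"
proof -
  define A where "A i = {t. fst (bs ! i) \<le> t \<and> ereal t < snd (bs ! i)}" for i
  have A: "A i \<in> sets lborel" for i unfolding A_def by measurable
  have bar: "0 \<le> fst (bs ! i) \<and> ereal (fst (bs ! i)) < snd (bs ! i)" if "i < length bs" for i
    using assms nth_mem[OF that] by auto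
  have al: "of_nat (alive bs t) * indicator {0..} t = (\<Sum>i<length bs. indicator (A i) t :: ennreal)" for t :: real
  proof (cases "0 \<le> t")
    case True
    have "{i. i < length bs \<and> fst (bs ! i) \<le> t \<and> ereal t < snd (bs ! i)} = {..<length bs} \<inter> {i. t \<in> A i}"
      by (auto simp: A_def)
    then show ?thesis using True
      by (simp add: alive_def indicator_def sum.If_cases)
  next
    case False
    then have "t \<notin> A i" if "i < length bs" for i using bar[OF that] by (auto simp: A_def)
    then show ?thesis using False by simp
  qed
  have "(\<Sum>(b, d)\<leftarrow>bs. e2ennreal (d - ereal b)) =
      (\<Sum>i<length bs. e2ennreal (snd (bs ! i) - ereal (fst (bs ! i))))"
    by (simp add: sum_list_sum_nth case_prod_beta atLeast0LessThan)
  also have "\<dots> = (\<Sum>i<length bs. emeasure lborel (A i))"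
    unfolding A_def using bar by (intro sum.cong refl emeasure_bar[symmetric]) auto
  also have "\<dots> = (\<integral>\<^sup>+t. (\<Sum>i<length bs. indicator (A i) t) \<partial>lborel)"
    using A by (simp add: nn_integral_sum)
  finally show ?thesis unfolding al .
qed

lemma lifetime_sum_eq:
  "lifetime_sum k (clique_process n u) =
    (\<integral>\<^sup>+t. of_nat (alive (barcode k (clique_process n u)) t) * indicator {0..} t \<partial>lborel)"
  unfolding lifetime_sum_def
  using is_barcode_clique_process by (intro sum_bars_eq_nn_integral) (simp add: is_barcode_def)

lemma dim_cycles_clique_process:
  assumes "0 \<le> t"
  shows "fs.dim (cycles k (clique_process n u t)) =
    fs.dim (cycles k (clique_process n u t) \<inter> boundaries k (clique_process n u t)) +
      alive (barcode k (clique_process n u)) t"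
  unfolding alive_def
proof (rule dim_cycles_barcode[OF is_barcode_clique_process assms])
  show "finite (clique_process n u t)"
    by (rule finite_subset[of _ "Pow {..<n}"]) (auto simp: clique_process_def clique_complex_def)
qed

section \<open>Integration over the edge weights\<close>

lemma emeasure_edge_set:
  assumes t: "0 \<le> t" "t \<le> 1" and S: "S \<subseteq> pairs {..<n}"
  shows "{u \<in> space (edge_weights n). edge_set n u t = S} \<in> sets (edge_weights n)"
    and "emeasure (edge_weights n) {u \<in> space (edge_weights n). edge_set n u t = S} =
      ennreal (t ^ card S * (1 - t) ^ card (pairs {..<n} - S))"
proof -
  let ?E = "pairs {..<n}" and ?U = "uniform_measure lborel {0..1::real}"
  define A where "A e = (if e \<in> S then {..t} else {t<..})" for e
  have fin: "finite ?E" by (simp add: finite_pairs)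
  have U: "prob_space ?U" by (intro prob_space_uniform_measure) auto
  interpret product_sigma_finite "\<lambda>_::nat set. ?U"
    by (rule product_sigma_finite.intro) (rule prob_space_imp_sigma_finite[OF U])
  have eq: "{u \<in> space (edge_weights n). edge_set n u t = S} = PiE ?E A"
  proof (intro set_eqI iffI)
    fix u assume "u \<in> {u \<in> space (edge_weights n). edge_set n u t = S}"
    then show "u \<in> PiE ?E A"
      by (auto simp: edge_weights_def space_PiM PiE_iff edge_set_def A_def)
  next
    fix u assume u: "u \<in> PiE ?E A"
    then have "u e \<le> t \<longleftrightarrow> e \<in> S" if "e \<in> ?E" for e
      using PiE_mem[OF u that] by (auto simp: A_def split: if_splits)
    then show "u \<in> {u \<in> space (edge_weights n). edge_set n u t = S}"
      using u S by (auto simp: edge_weights_def space_PiM PiE_iff edge_set_def)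
  qed
  have A: "A e \<in> sets ?U" for e by (auto simp: A_def)
  show "{u \<in> space (edge_weights n). edge_set n u t = S} \<in> sets (edge_weights n)"
    unfolding eq unfolding edge_weights_def using A fin by (intro sets_PiM_I_finite) auto
  have m: "emeasure ?U (A e) = ennreal (if e \<in> S then t else 1 - t)" for e
  proof (cases "e \<in> S")
    case True
    have "{0..1} \<inter> {..t} = {0..t}" using t by auto
    then show ?thesis using True t by (simp add: A_def divide_ennreal_def)
  next
    case False
    have "{0..1} \<inter> {t<..} = {t<..1}" using t by auto
    then show ?thesis using False t by (simp add: A_def divide_ennreal_def)
  qed
  have "emeasure (edge_weights n) (PiE ?E A) = (\<Prod>e\<in>?E. emeasure ?U (A e))"
    unfolding edge_weights_def using A by (intro emeasure_PiM fin)
  also have "\<dots> = ennreal (\<Prod>e\<in>?E. if e \<in> S then t else 1 - t)"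
    unfolding m using t by (subst prod_ennreal) auto
  also have "(\<Prod>e\<in>?E. if e \<in> S then t else 1 - t) = t ^ card S * (1 - t) ^ card (?E - S)"
    using fin S by (simp add: prod.If_cases Int_absorb1 Diff_eq)
  finally show "emeasure (edge_weights n) {u \<in> space (edge_weights n). edge_set n u t = S} =
      ennreal (t ^ card S * (1 - t) ^ card (?E - S))" unfolding eq .
qed

lemma nn_integral_edge_set:
  assumes t: "0 \<le> t" "t \<le> 1" and g: "\<And>S. 0 \<le> g S"
  shows "(\<integral>\<^sup>+u. ennreal (g (edge_set n u t)) \<partial>edge_weights n) = ennreal (bern_exp (pairs {..<n}) t g)"
proof -
  let ?E = "pairs {..<n}" and ?M = "edge_weights n"
  let ?A = "\<lambda>S. {u \<in> space ?M. edge_set n u t = S}"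
  have fin: "finite ?E" by (simp add: finite_pairs)
  have "(\<integral>\<^sup>+u. ennreal (g (edge_set n u t)) \<partial>?M) =
      (\<integral>\<^sup>+u. (\<Sum>S\<in>Pow ?E. ennreal (g S) * indicator (?A S) u) \<partial>?M)"
  proof (intro nn_integral_cong)
    fix u assume u: "u \<in> space ?M"
    have "(\<Sum>S\<in>Pow ?E. ennreal (g S) * indicator (?A S) u) =
        (\<Sum>S\<in>{edge_set n u t}. ennreal (g S) * indicator (?A S) u)"
    proof (rule sum.mono_neutral_right)
      show "{edge_set n u t} \<subseteq> Pow ?E" by (auto simp: edge_set_def)
    qed (use fin in \<open>auto split: split_indicator\<close>)
    then show "ennreal (g (edge_set n u t)) = (\<Sum>S\<in>Pow ?E. ennreal (g S) * indicator (?A S) u)"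
      using u by simp
  qed
  also have "\<dots> = (\<Sum>S\<in>Pow ?E. ennreal (g S) * emeasure ?M (?A S))"
    using emeasure_edge_set(1)[OF t] by (subst nn_integral_sum) (auto simp: nn_integral_cmult_indicator)
  also have "\<dots> = (\<Sum>S\<in>Pow ?E. ennreal (t ^ card S * (1 - t) ^ card (?E - S) * g S))"
    using emeasure_edge_set(2)[OF t] g t
    by (intro sum.cong refl) (auto simp: ennreal_mult[symmetric] mult.commute)
  also have "\<dots> = ennreal (bern_exp ?E t g)"
    unfolding bern_exp_def using g t by (intro sum_ennreal) auto
  finally show ?thesis .
qed

text \<open>Fubini's theorem for quantities that depend on the time and on the current edge set.
  Joint measurability reduces to the finitely many events that the edge set equals \<open>S\<close>.
  The lifetime sum, which rests on chosen barcodes, is only compared pointwise with such quantities,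
  so monotonicity of the integral suffices for it.\<close>

lemma nn_integral_process:
  assumes B: "B \<in> sets borel" "B \<subseteq> {0..1}" and G: "\<And>t S. t \<in> B \<Longrightarrow> 0 \<le> G t S"
    and meas: "\<And>S. (\<lambda>t. G t S) \<in> borel_measurable borel"
  shows "(\<integral>\<^sup>+u. (\<integral>\<^sup>+t. ennreal (G t (edge_set n u t)) * indicator B t \<partial>lborel) \<partial>edge_weights n) =
    (\<integral>\<^sup>+t. ennreal (bern_exp (pairs {..<n}) t (G t)) * indicator B t \<partial>lborel)"
proof -
  let ?E = "pairs {..<n}" and ?M = "edge_weights n"
  have fin: "finite ?E" by (simp add: finite_pairs)
  have U: "prob_space (uniform_measure lborel {0..1::real})" by (intro prob_space_uniform_measure) auto
  interpret P: prob_space ?M unfolding edge_weights_def by (rule prob_space_PiM[OF U])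
  interpret pair_sigma_finite lborel ?M ..
  have comp: "(\<lambda>x. snd x e) \<in> borel_measurable (lborel \<Otimes>\<^sub>M ?M)" if "e \<in> ?E" for e
  proof -
    have "(\<lambda>u. u e) \<in> borel_measurable ?M"
      unfolding edge_weights_def
      using measurable_component_singleton[OF that, of "\<lambda>_. uniform_measure lborel {0..1::real}"]
      by (simp cong: measurable_cong_sets)
    then show ?thesis by measurable
  qed
  have pm: "Measurable.pred (lborel \<Otimes>\<^sub>M ?M) (\<lambda>x. edge_set n (snd x) (fst x) = S)" for S
  proof (cases "S \<subseteq> ?E")
    case True
    have "edge_set n (snd x) (fst x) = S \<longleftrightarrow> (\<forall>e\<in>?E. snd x e \<le> fst x \<longleftrightarrow> e \<in> S)" for x
      using True by (auto simp: edge_set_def)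
    moreover have "Measurable.pred (lborel \<Otimes>\<^sub>M ?M) (\<lambda>x. \<forall>e\<in>?E. snd x e \<le> fst x \<longleftrightarrow> e \<in> S)"
    proof (intro pred_intros_finite fin)
      fix e assume "e \<in> ?E"
      note [measurable] = comp[OF this]
      show "Measurable.pred (lborel \<Otimes>\<^sub>M ?M) (\<lambda>x. snd x e \<le> fst x \<longleftrightarrow> e \<in> S)" by measurable
    qed
    ultimately show ?thesis by simp
  next
    case False
    then have "edge_set n (snd x) (fst x) = S \<longleftrightarrow> False" for x by (auto simp: edge_set_def)
    then show ?thesis by simp
  qed
  have gm: "(\<lambda>x. ennreal (G (fst x) (edge_set n (snd x) (fst x))) * indicator B (fst x))
      \<in> borel_measurable (lborel \<Otimes>\<^sub>M ?M)"
  proof -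
    have eq: "ennreal (G (fst x) (edge_set n (snd x) (fst x))) * indicator B (fst x) =
       (\<Sum>S\<in>Pow ?E. if edge_set n (snd x) (fst x) = S then ennreal (G (fst x) S) * indicator B (fst x) else 0)" for x
      using fin by (simp add: edge_set_def)
    note [measurable] = pm meas B(1)
    show ?thesis unfolding eq by measurable
  qed
  have "(\<integral>\<^sup>+u. (\<integral>\<^sup>+t. ennreal (G t (edge_set n u t)) * indicator B t \<partial>lborel) \<partial>?M) =
      (\<integral>\<^sup>+t. (\<integral>\<^sup>+u. ennreal (G t (edge_set n u t)) * indicator B t \<partial>?M) \<partial>lborel)"
    using gm by (intro Fubini') (simp add: case_prod_beta)
  also have "\<dots> = (\<integral>\<^sup>+t. ennreal (bern_exp ?E t (G t)) * indicator B t \<partial>lborel)"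
  proof (intro nn_integral_cong)
    fix t :: real
    show "(\<integral>\<^sup>+u. ennreal (G t (edge_set n u t)) * indicator B t \<partial>?M) =
        ennreal (bern_exp ?E t (G t)) * indicator B t"
    proof (cases "t \<in> B")
      case True
      then show ?thesis using B G nn_integral_edge_set[of t "G t" n] by auto
    qed simp
  qed
  finally show ?thesis .
qed

lemma measurable_step_weight: "(\<lambda>p. step_weight k p S v \<rho> \<sigma>) \<in> borel_measurable borel"
proof -
  have [measurable]: "(\<lambda>p. a / p ^ j) \<in> borel_measurable borel" for a :: real and j by measurable
  show ?thesis
    unfolding step_weight_def
    by (cases "v \<in> \<rho>"; cases "\<sigma> = \<rho>"; cases "\<exists>a\<in>\<rho>. \<sigma> = insert v (\<rho> - {a})"; simp only: if_True if_False simp_thms; measurable)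
qed

lemma measurable_walk_weight: "(\<lambda>p. walk_weight k p S \<rho> xs) \<in> borel_measurable borel"
  by (induction xs arbitrary: \<rho>) (auto intro!: measurable_step_weight borel_measurable_times)

lemma measurable_clique_trace: "(\<lambda>p. clique_trace V k m p S) \<in> borel_measurable borel"
  unfolding clique_trace_def
proof (intro borel_measurable_sum borel_measurable_divide borel_measurable_const)
  show "(\<lambda>p. if walk_end \<rho> xs = \<rho> then walk_weight k p S \<rho> xs else 0) \<in> borel_measurable borel" for \<rho> xs
    by (cases "walk_end \<rho> xs = \<rho>") (simp_all add: measurable_walk_weight)
qed

section \<open>Expected lifetime sums\<close>

text \<open>Up to \<open>T0\<close> the Betti number is bounded by the number of k-simplices, beyond
  it by the trace, whose estimate needs \<open>1 \<le> real n * t ^ (k + 1)\<close>. The two forms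
  of \<open>m\<close> serve different ends: evenness makes the trace an upper bound, and
  divisibility by k + 2 turns the number of steps into the guaranteed number \<open>R\<close> of
  revisits.\<close>

lemma expected_lifetime_sum_le:
  assumes n: "0 < n" and T0: "0 < T0" "1 \<le> real n * T0 ^ (k + 1)"
    and m: "m = 2 * r" "m = (k + 2) * R"
  shows "(\<integral>\<^sup>+ u. lifetime_sum k (clique_process n u) \<partial>edge_weights n) \<le>
    (\<integral>\<^sup>+t. ennreal (if t \<le> T0 then real (n choose Suc k) * t ^ (Suc k choose 2)
        else real (n choose Suc k) * t ^ (Suc k choose 2) *
          ((2 * real (k + 2) * real (k + 1 + m)) ^ m / (real n * t ^ (k + 1)) ^ R)) * indicator {0..1} t \<partial>lborel)"
proof -
  let ?V = "{..<n}"
  have V: "finite ?V" "?V \<noteq> {}" using n by auto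
  define G where "G t S = (if t \<le> T0 then real (card (cliques ?V S (Suc k))) else clique_trace ?V k m t S)" for t S
  have G0: "0 \<le> G t S" if "t \<in> {0..1}" for t S
    using clique_trace_nonneg[OF V, of t k r S] T0 m(1) by (auto simp: G_def)
  have alive_le: "of_nat (alive (barcode k (clique_process n u)) t) * indicator {0..} t \<le>
      ennreal (G t (edge_set n u t)) * indicator {0..1} t" for u t
  proof (cases "0 \<le> t")
    case t0: True
    let ?N = "alive (barcode k (clique_process n u)) t"
    note dim = dim_cycles_clique_process[OF t0, of k n u]
    show ?thesis
    proof (cases "t < 1")
      case True
      note dim = dim[unfolded clique_process_eq[OF True]]
      have "real ?N \<le> G t (edge_set n u t)"
        using dim_homology_bounds(1)[OF V(1) dim] dim_homology_le_clique_trace[OF V _ dim, of t r] T0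
        by (auto simp: G_def m(1))
      then have "of_nat ?N \<le> ennreal (G t (edge_set n u t))"
        unfolding ennreal_of_nat_eq_real_of_nat by (rule ennreal_leI)
      then show ?thesis using t0 True by simp
    next
      case False
      then have "?N = 0"
        using dim_homology_full_simplex[OF V dim[unfolded clique_process_eq_full[OF leI[OF False]]]] by simp
      then show ?thesis by simp
    qed
  qed simp
  have "(\<integral>\<^sup>+ u. lifetime_sum k (clique_process n u) \<partial>edge_weights n) \<le>
      (\<integral>\<^sup>+u. (\<integral>\<^sup>+t. ennreal (G t (edge_set n u t)) * indicator {0..1} t \<partial>lborel) \<partial>edge_weights n)"
    unfolding lifetime_sum_eq by (intro nn_integral_mono alive_le)
  also have "\<dots> = (\<integral>\<^sup>+t. ennreal (bern_exp (pairs ?V) t (G t)) * indicator {0..1} t \<partial>lborel)"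
  proof (rule nn_integral_process[OF _ _ G0])
    show "(\<lambda>t. G t S) \<in> borel_measurable borel" for S
      unfolding G_def by (intro measurable_If measurable_clique_trace) auto
  qed auto
  also have "\<dots> \<le> (\<integral>\<^sup>+t. ennreal (if t \<le> T0 then real (n choose Suc k) * t ^ (Suc k choose 2)
        else real (n choose Suc k) * t ^ (Suc k choose 2) *
          ((2 * real (k + 2) * real (k + 1 + m)) ^ m / (real n * t ^ (k + 1)) ^ R)) * indicator {0..1} t \<partial>lborel)"
  proof (intro nn_integral_mono)
    fix t :: real
    show "ennreal (bern_exp (pairs ?V) t (G t)) * indicator {0..1} t \<le>
      ennreal (if t \<le> T0 then real (n choose Suc k) * t ^ (Suc k choose 2)
        else real (n choose Suc k) * t ^ (Suc k choose 2) *
          ((2 * real (k + 2) * real (k + 1 + m)) ^ m / (real n * t ^ (k + 1)) ^ R)) * indicator {0..1} t"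
    proof (cases "t \<in> {0..1}")
      case t: True
      show ?thesis
      proof (cases "t \<le> T0")
        case True
        then have "G t = (\<lambda>S. real (card (cliques ?V S (Suc k))))" by (auto simp: G_def)
        then show ?thesis using True bern_exp_cliques[OF V(1), of t "Suc k"] by simp
      next
        case False
        have "T0 ^ (k + 1) \<le> t ^ (k + 1)" using False T0 by (intro power_mono) auto
        then have "1 \<le> real (card ?V) * t ^ (k + 1)"
          using T0(2) n by (auto intro: order_trans mult_left_mono)
        from bern_exp_clique_trace[OF V _ _ this m(2)] False t T0
        have "bern_exp (pairs ?V) t (clique_trace ?V k m t) \<le> real (n choose Suc k) * t ^ (Suc k choose 2) *
          ((2 * real (k + 2) * real (k + 1 + m)) ^ m / (real n * t ^ (k + 1)) ^ R)" by simp
        moreover have "G t = clique_trace ?V k m t" using False by (auto simp: G_def)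
        ultimately show ?thesis using False by (simp only: if_False) (intro mult_right_mono ennreal_leI, auto)
      qed
    qed simp
  qed
  finally show ?thesis .
qed

lemma expected_lifetime_sum_ge:
  assumes I: "0 < a" "a \<le> b" "b < 1"
    and c: "\<And>t. a \<le> t \<Longrightarrow> t \<le> b \<Longrightarrow> c \<le> real (n choose Suc k) * t ^ (Suc k choose 2) -
      real (n choose k) * t ^ (k choose 2) - real (n choose (k + 2)) * t ^ ((k + 2) choose 2)"
  shows "ennreal (c * (b - a)) \<le> (\<integral>\<^sup>+ u. lifetime_sum k (clique_process n u) \<partial>edge_weights n)"
proof -
  let ?V = "{..<n}"
  have V: "finite ?V" by simp
  let ?h = "\<lambda>S. real (card (cliques ?V S (Suc k))) - real (card (cliques ?V S k)) - real (card (cliques ?V S (k + 2)))"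
  \<comment> \<open>Truncation at 0 keeps a lower bound for the Betti number, can only raise the
    expectation, and permits integration in \<open>ennreal\<close>.\<close>
  define G where "G t S = max 0 (?h S)" for t :: real and S
  have alive_ge: "ennreal (G t (edge_set n u t)) * indicator {a..b} t \<le>
      of_nat (alive (barcode k (clique_process n u)) t) * indicator {0..} t" for u t
  proof (cases "t \<in> {a..b}")
    case True
    then have t: "0 \<le> t" "t < 1" using I by auto
    note dim = dim_cycles_clique_process[OF t(1), of k n u, unfolded clique_process_eq[OF t(2)]]
    have "G t (edge_set n u t) \<le> real (alive (barcode k (clique_process n u)) t)"
      using dim_homology_bounds(2)[OF V dim] by (simp add: G_def)
    then have "ennreal (G t (edge_set n u t)) \<le> of_nat (alive (barcode k (clique_process n u)) t)"
      unfolding ennreal_of_nat_eq_real_of_nat by (rule ennreal_leI)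
    then show ?thesis using t True by simp
  qed simp
  have "ennreal (c * (b - a)) = (\<integral>\<^sup>+t. ennreal c * indicator {a..b} t \<partial>lborel)"
    using I by (simp add: nn_integral_cmult_indicator ennreal_mult'')
  also have "\<dots> \<le> (\<integral>\<^sup>+t. ennreal (bern_exp (pairs ?V) t (G t)) * indicator {a..b} t \<partial>lborel)"
  proof (intro nn_integral_mono)
    fix t :: real
    show "ennreal c * indicator {a..b} t \<le> ennreal (bern_exp (pairs ?V) t (G t)) * indicator {a..b} t"
    proof (cases "t \<in> {a..b}")
      case True
      then have t: "0 \<le> t" "t \<le> 1" using I by auto
      have "c \<le> bern_exp (pairs ?V) t ?h"
        unfolding bern_exp_diff bern_exp_cliques[OF V] using c True by simp
      also have "\<dots> \<le> bern_exp (pairs ?V) t (G t)"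
        using t by (intro bern_exp_mono) (auto simp: G_def)
      finally show ?thesis using True by (simp add: ennreal_leI)
    qed simp
  qed
  also have "\<dots> = (\<integral>\<^sup>+u. (\<integral>\<^sup>+t. ennreal (G t (edge_set n u t)) * indicator {a..b} t \<partial>lborel) \<partial>edge_weights n)"
    using I by (intro nn_integral_process[symmetric]) (auto simp: G_def)
  also have "\<dots> \<le> (\<integral>\<^sup>+ u. lifetime_sum k (clique_process n u) \<partial>edge_weights n)"
    unfolding lifetime_sum_eq by (intro nn_integral_mono alive_ge)
  finally show ?thesis .
qed

section \<open>The critical scale and the two estimates\<close>

lemma real_choose_two: "real (Suc k choose 2) = real k * (real k + 1) / 2"
proof -
  have "even (Suc k * k)" by simp
  then show ?thesis unfolding choose_two by (simp add: real_of_nat_div algebra_simps)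
qed

text \<open>The exponent of the theorem arises here: up to constants, the last equation multiplies
  the expected number of k-simplices at time \<open>T\<close> by the length \<open>T\<close> of the
  time window in which they contribute.\<close>

lemma critical_scale:
  fixes k :: nat
  assumes n: "0 < n"
  defines "T \<equiv> real n powr (- 1 / (real k + 1))"
  shows "0 < T" "T \<le> 1" "real n * T ^ (k + 1) = 1" "real n * T ^ k = real n powr (1 / (real k + 1))"
    "real n ^ Suc k * T ^ (Suc k choose 2) * T = real n powr (real k / 2 + 1 - 1 / (real k + 1))"
proof -
  have n1: "1 \<le> real n" using n by simp
  show "0 < T" using n by (simp add: T_def)
  have Tp: "T ^ j = real n powr (- real j / (real k + 1))" for j
    unfolding T_def using n by (simp add: powr_powr flip: powr_realpow)
  show "T \<le> 1" unfolding T_def using powr_mono[OF _ n1, of "- 1 / (real k + 1)" 0] n by simp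
  have np: "real n ^ j = real n powr real j" for j using n by (simp add: powr_realpow)
  have "- real (k + 1) / (real k + 1) = -1" by (simp add: field_simps)
  then show "real n * T ^ (k + 1) = 1"
    unfolding Tp using n by (simp add: powr_minus)
  have "1 + - real k / (real k + 1) = 1 / (real k + 1)" by (simp add: field_simps)
  then show "real n * T ^ k = real n powr (1 / (real k + 1))"
    unfolding Tp using n by (metis powr_add powr_one of_nat_0_le_iff)
  have "real n ^ Suc k * T ^ (Suc k choose 2) * T =
      real n powr (real (Suc k) + - real (Suc k choose 2) / (real k + 1) + - 1 / (real k + 1))"
    unfolding np Tp powr_add by (simp add: T_def)
  also have "- real (Suc k choose 2) / (real k + 1) = - real k / 2"
    unfolding real_choose_two by (simp add: field_simps)
  also have "real (Suc k) + - real k / 2 + - 1 / (real k + 1) = real k / 2 + 1 - 1 / (real k + 1)"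
    by (simp add: field_simps)
  finally show "real n ^ Suc k * T ^ (Suc k choose 2) * T = real n powr (real k / 2 + 1 - 1 / (real k + 1))" .
qed

lemma nn_integral_inverse_square:
  assumes "0 < a"
  shows "(\<integral>\<^sup>+t. ennreal ((a / t)\<^sup>2) * indicator {a..} t \<partial>lborel) = ennreal a"
proof -
  have "(\<integral>\<^sup>+t. ennreal ((a / t)\<^sup>2) * indicator {a..} t \<partial>lborel) = ennreal (0 - (- a\<^sup>2 / a))"
  proof (rule nn_integral_FTC_atLeast[where F = "\<lambda>t. - a\<^sup>2 / t" and T = 0])
    fix t assume "a \<le> t"
    then have t: "t \<noteq> 0" using assms by auto
    show "((\<lambda>t. - a\<^sup>2 / t) has_real_derivative (a / t)\<^sup>2) (at t)"
      using t by (auto intro!: derivative_eq_intros simp: field_simps power2_eq_square)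
  next
    show "((\<lambda>t. - a\<^sup>2 / t) \<longlongrightarrow> 0) at_top"
      by (intro tendsto_divide_0[OF tendsto_const] filterlim_at_top_imp_at_infinity filterlim_ident)
  qed (auto)
  then show ?thesis using assms by (simp add: power2_eq_square)
qed

text \<open>The value \<open>R = 2 * (k + 2)\<close> makes \<open>m = (k + 2) * R\<close> even and
  gives \<open>(k + 1) * R \<ge> (Suc k choose 2) + 2\<close>. The decay past \<open>T\<close> thus
  beats the growth of the number of k-simplices by two powers, which leaves an integrable tail of
  mass \<open>T\<close>.\<close>

lemma expected_lifetime_sum_upper:
  fixes k :: nat
  assumes n: "0 < n"
  defines "m \<equiv> 2 * (k + 2) * (k + 2)"
  shows "(\<integral>\<^sup>+ u. lifetime_sum k (clique_process n u) \<partial>edge_weights n) \<le>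
    ennreal ((1 + (2 * real (k + 2) * real (k + 1 + m)) ^ m) *
      real n powr (real k / 2 + 1 - 1 / (real k + 1)))"
proof -
  define T where "T = real n powr (- 1 / (real k + 1))"
  define K where "K = (2 * real (k + 2) * real (k + 1 + m)) ^ m"
  define R where "R = 2 * (k + 2)"
  define A where "A = real n ^ Suc k * T ^ (Suc k choose 2)"
  let ?e = "Suc k choose 2"
  note T = critical_scale[OF n, of k, folded T_def]
  have K: "0 \<le> K" by (simp add: K_def)
  have A: "0 \<le> A" using T(1) by (simp add: A_def)
  have choose: "real (n choose Suc k) \<le> real n ^ Suc k"
  proof (cases "Suc k \<le> n")
    case True
    then show ?thesis using binomial_le_pow[OF True] by (metis of_nat_le_iff of_nat_power)
  qed (simp add: binomial_eq_0)
  have e: "?e + 2 \<le> (k + 1) * R"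
  proof -
    have "?e \<le> Suc k * k" unfolding choose_two by simp
    then show ?thesis by (simp add: R_def algebra_simps)
  qed
  have "(\<integral>\<^sup>+ u. lifetime_sum k (clique_process n u) \<partial>edge_weights n) \<le>
    (\<integral>\<^sup>+t. ennreal (if t \<le> T then real (n choose Suc k) * t ^ ?e
        else real (n choose Suc k) * t ^ ?e * (K / (real n * t ^ (k + 1)) ^ R)) * indicator {0..1} t \<partial>lborel)"
    unfolding K_def
    by (rule expected_lifetime_sum_le[OF n T(1), of k m "(k + 2) * (k + 2)" R])
      (use T(3) in \<open>auto simp: m_def R_def\<close>)
  also have "\<dots> \<le> (\<integral>\<^sup>+t. ennreal A * indicator {0..T} t +
      ennreal (A * K) * (ennreal ((T / t)\<^sup>2) * indicator {T..} t) \<partial>lborel)"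
  proof (intro nn_integral_mono)
    fix t :: real
    show "ennreal (if t \<le> T then real (n choose Suc k) * t ^ ?e
        else real (n choose Suc k) * t ^ ?e * (K / (real n * t ^ (k + 1)) ^ R)) * indicator {0..1} t \<le>
      ennreal A * indicator {0..T} t + ennreal (A * K) * (ennreal ((T / t)\<^sup>2) * indicator {T..} t)"
    proof (cases "t \<in> {0..1}")
      case t: True
      show ?thesis
      proof (cases "t \<le> T")
        case True
        have "real (n choose Suc k) * t ^ ?e \<le> A"
          unfolding A_def using t True choose by (intro mult_mono power_mono) auto
        then have "ennreal (real (n choose Suc k) * t ^ ?e) \<le> ennreal A" by (rule ennreal_leI)
        also have "\<dots> \<le> ennreal A + ennreal (A * K) * (ennreal ((T / t)\<^sup>2) * indicator {T..} t)" by simp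
        finally show ?thesis using t True by simp
      next
        case False
        \<comment> \<open>Time in units of \<open>T\<close>: then
          \<open>real n * t ^ (k + 1)\<close> is simply \<open>s ^ (k + 1)\<close>.\<close>
        define s where "s = t / T"
        have s: "1 \<le> s" "t = T * s" using False T(1) by (simp_all add: s_def field_simps)
        have d: "real n * t ^ (k + 1) = s ^ (k + 1)"
        proof -
          have "real n * t ^ (k + 1) = real n * T ^ (k + 1) * s ^ (k + 1)"
            unfolding s(2) power_mult_distrib by simp
          then show ?thesis unfolding T(3) by simp
        qed
        have "s ^ ?e * s ^ 2 \<le> s ^ ((k + 1) * R)"
          unfolding power_add[symmetric] using e s(1) by (rule power_increasing)
        then have sR: "s ^ ?e / (s ^ (k + 1)) ^ R \<le> 1 / s ^ 2"
          unfolding power_mult[symmetric] using s(1) by (simp add: divide_le_eq le_divide_eq mult_ac)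
        have "real (n choose Suc k) * t ^ ?e * (K / (real n * t ^ (k + 1)) ^ R) \<le>
            real n ^ Suc k * t ^ ?e * (K / (real n * t ^ (k + 1)) ^ R)"
          using choose K t by (intro mult_right_mono) auto
        also have "\<dots> = A * K * (s ^ ?e / (s ^ (k + 1)) ^ R)"
          unfolding d A_def unfolding s(2) power_mult_distrib by simp
        also have "\<dots> \<le> A * K * (1 / s ^ 2)"
          using A K by (intro mult_left_mono sR) auto
        also have "1 / s ^ 2 = (T / t)\<^sup>2" by (simp add: s_def power_divide)
        finally have "ennreal (real (n choose Suc k) * t ^ ?e * (K / (real n * t ^ (k + 1)) ^ R)) \<le>
            ennreal (A * K) * ennreal ((T / t)\<^sup>2)"
          using A K by (simp add: ennreal_mult[symmetric] ennreal_leI)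
        then show ?thesis using t False by simp
      qed
    qed simp
  qed
  also have "\<dots> = ennreal A * ennreal T + ennreal (A * K) * ennreal T"
    using T(1) by (simp add: nn_integral_add nn_integral_cmult nn_integral_inverse_square nn_integral_cmult_indicator)
  also have "\<dots> = ennreal ((1 + K) * (A * T))"
    using A K T(1) by (simp add: ennreal_mult[symmetric] ennreal_plus[symmetric] algebra_simps del: ennreal_plus)
  finally show ?thesis unfolding A_def T(5) K_def .
qed

lemma choose_Suc_absorb: "Suc k * (n choose Suc k) = (n - k) * (n choose k)"
  by (simp only: binomial_absorption binomial_absorb_comp)

text \<open>On the window from \<open>T / 8\<close> to \<open>T / 4\<close> each neighbouring face
  count has at most a quarter of the mean of f_k. The upper end makes the ratio to f_(k+1) small,
  since n t^(k+1) is at most 1/4; the lower end does so for f_(k-1), since n t^k is of order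
  n^(1/(k+1)) and \<open>large\<close> makes it big enough. Half of the mean of f_k remains, on a
  window of length \<open>T / 8\<close>: hence the factor 1/16.\<close>

lemma expected_lifetime_sum_lower:
  fixes k :: nat
  assumes n: "2 * k + 2 \<le> n" and large: "8 * (real k + 1) * 8 ^ k \<le> real n powr (1 / (real k + 1))"
  shows "ennreal ((1 / (real k + 1)) ^ Suc k * (1 / 8) ^ (Suc k choose 2) / 16 *
      real n powr (real k / 2 + 1 - 1 / (real k + 1)))
    \<le> (\<integral>\<^sup>+ u. lifetime_sum k (clique_process n u) \<partial>edge_weights n)"
proof -
  define T where "T = real n powr (- 1 / (real k + 1))"
  let ?e = "Suc k choose 2" and ?c = "real (n choose Suc k)"
  have n0: "0 < n" using n by simp
  note T = critical_scale[OF n0, of k, folded T_def]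
  define L where "L = (real n / real (Suc k)) ^ Suc k * (T / 8) ^ ?e / 2"
  have "ennreal (L * (T / 4 - T / 8)) \<le> (\<integral>\<^sup>+ u. lifetime_sum k (clique_process n u) \<partial>edge_weights n)"
  proof (rule expected_lifetime_sum_ge)
    show "0 < T / 8" "T / 8 \<le> T / 4" "T / 4 < 1" using T(1,2) by auto
    fix t assume t: "T / 8 \<le> t" "t \<le> T / 4"
    have t0: "0 < t" using t T(1) by auto
    have e1: "?e = (k choose 2) + k" "(k + 2) choose 2 = ?e + (k + 1)"
      by (simp_all add: numeral_2_eq_2)
    define x where "x = ?c * t ^ ?e"
    have x0: "0 \<le> x" using t0 by (simp add: x_def)
    have up: "real (n choose (k + 2)) * t ^ ((k + 2) choose 2) \<le> x / 4"
    proof -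
      have "real (k + 2) * real (n choose (k + 2)) = real (n - Suc k) * ?c"
        using choose_Suc_absorb[of "Suc k" n] by (metis of_nat_mult add_2_eq_Suc')
      moreover have "real (n choose (k + 2)) \<le> real (k + 2) * real (n choose (k + 2))"
        using mult_right_mono[of 1 "real (k + 2)" "real (n choose (k + 2))"] by simp
      moreover have "real (n - Suc k) * ?c \<le> real n * ?c" by (intro mult_right_mono) auto
      ultimately have b: "real (n choose (k + 2)) \<le> real n * ?c" by linarith
      have "real n * t ^ (k + 1) \<le> real n * (T / 4) ^ (k + 1)"
        using t t0 by (intro mult_left_mono power_mono) auto
      also have "\<dots> = (1 / 4) ^ (k + 1)"
        using T(3) by (simp add: power_divide)
      also have "\<dots> \<le> 1 / 4" by (simp add: power_le_one)
      finally have d: "real n * t ^ (k + 1) \<le> 1 / 4" .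
      have "real (n choose (k + 2)) * t ^ ((k + 2) choose 2) \<le> real n * ?c * t ^ ((k + 2) choose 2)"
        using b t0 by (intro mult_right_mono) auto
      also have "\<dots> = x * (real n * t ^ (k + 1))"
        unfolding e1(2) power_add x_def by (simp only: mult_ac)
      also have "\<dots> \<le> x * (1 / 4)" using x0 d by (intro mult_left_mono)
      finally show ?thesis by simp
    qed
    have down: "real (n choose k) * t ^ (k choose 2) \<le> x / 4"
    proof -
      have nk: "real n / 2 \<le> real (n - k)" using n by simp
      have "4 * (real k + 1) \<le> real n powr (1 / (real k + 1)) / 2 / 8 ^ k"
        using large by (simp add: field_simps)
      also have "\<dots> = real n / 2 * (T / 8) ^ k"
        unfolding T(4)[symmetric] by (simp add: power_divide)
      also have "\<dots> \<le> real (n - k) * t ^ k"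
        using nk t T(1) by (intro mult_mono power_mono) auto
      finally have d: "4 * (real k + 1) \<le> real (n - k) * t ^ k" .
      have "real (n choose k) * t ^ (k choose 2) * (4 * (real k + 1)) \<le>
          real (n choose k) * t ^ (k choose 2) * (real (n - k) * t ^ k)"
        using t0 by (intro mult_left_mono d) auto
      also have "\<dots> = (real (n - k) * real (n choose k)) * t ^ ?e"
        unfolding e1(1) power_add by (simp only: mult_ac)
      also have "real (n - k) * real (n choose k) = (real k + 1) * ?c"
        using choose_Suc_absorb[of k n] by (metis of_nat_mult of_nat_Suc add.commute)
      finally have "(real (n choose k) * t ^ (k choose 2) * 4) * (real k + 1) \<le> x * (real k + 1)"
        by (simp only: x_def mult_ac)
      then have "real (n choose k) * t ^ (k choose 2) * 4 \<le> x" by (rule mult_right_le_imp_le) simp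
      then show ?thesis by simp
    qed
    have "L \<le> x / 2"
    proof -
      have "(real n / real (Suc k)) ^ Suc k \<le> ?c"
        using n by (intro binomial_ge_n_over_k_pow_k) simp
      then have "(real n / real (Suc k)) ^ Suc k * (T / 8) ^ ?e \<le> x"
        unfolding x_def using t T(1) by (intro mult_mono power_mono) auto
      then show ?thesis unfolding L_def by (rule divide_right_mono) simp
    qed
    then show "L \<le> ?c * t ^ ?e - real (n choose k) * t ^ (k choose 2) -
        real (n choose (k + 2)) * t ^ ((k + 2) choose 2)"
      using up down unfolding x_def by linarith
  qed
  moreover have LT: "L * (T / 4 - T / 8) = (1 / (real k + 1)) ^ Suc k * (1 / 8) ^ ?e / 16 *
      (real n ^ Suc k * T ^ ?e * T)"
    unfolding L_def power_divide by (simp add: field_simps)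
  ultimately show ?thesis unfolding LT T(5) by blast
qed

theorem theorem1p5:
  fixes k :: nat
  shows "\<exists>c C :: real. c > 0 \<and> C > 0 \<and>
    (\<forall>\<^sub>F n in sequentially.
       ennreal (c * real n powr (real k / 2 + 1 - 1 / (real k + 1)))
         \<le> (\<integral>\<^sup>+ u. lifetime_sum k (clique_process n u) \<partial>edge_weights n) \<and>
       (\<integral>\<^sup>+ u. lifetime_sum k (clique_process n u) \<partial>edge_weights n)
         \<le> ennreal (C * real n powr (real k / 2 + 1 - 1 / (real k + 1))))"
proof -
  let ?m = "2 * (k + 2) * (k + 2)"
  \<comment> \<open>The largeness condition says that the (k+1)-st root of \<open>n\<close> is at
    least \<open>B\<close>.\<close>
  define B where "B = 8 * (real k + 1) * 8 ^ k"
  have B: "0 < B" by (simp add: B_def)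
  have "\<forall>\<^sub>F n in sequentially. nat \<lceil>B ^ (k + 1)\<rceil> \<le> n" by (rule eventually_ge_at_top)
  then have "\<forall>\<^sub>F n in sequentially. 8 * (real k + 1) * 8 ^ k \<le> real n powr (1 / (real k + 1))"
  proof eventually_elim
    case (elim n)
    then have "B ^ (k + 1) \<le> real n" by linarith
    then have "(B ^ (k + 1)) powr (1 / (real k + 1)) \<le> real n powr (1 / (real k + 1))"
      using B by (intro powr_mono2) auto
    also have "(B ^ (k + 1)) powr (1 / (real k + 1)) = B powr (real (k + 1) * (1 / (real k + 1)))"
      unfolding powr_powr[symmetric] using B by (simp only: powr_realpow)
    also have "real (k + 1) * (1 / (real k + 1)) = 1"
      using of_nat_0_le_iff[of k, where ?'a = real] by simp
    finally show ?case using B unfolding B_def[symmetric] by simp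
  qed
  moreover have "\<forall>\<^sub>F n in sequentially. 2 * k + 2 \<le> n" by (rule eventually_ge_at_top)
  ultimately have "\<forall>\<^sub>F n in sequentially.
       ennreal ((1 / (real k + 1)) ^ Suc k * (1 / 8) ^ (Suc k choose 2) / 16 *
           real n powr (real k / 2 + 1 - 1 / (real k + 1)))
         \<le> (\<integral>\<^sup>+ u. lifetime_sum k (clique_process n u) \<partial>edge_weights n) \<and>
       (\<integral>\<^sup>+ u. lifetime_sum k (clique_process n u) \<partial>edge_weights n)
         \<le> ennreal ((1 + (2 * real (k + 2) * real (k + 1 + ?m)) ^ ?m) *
           real n powr (real k / 2 + 1 - 1 / (real k + 1)))"
    by eventually_elim (intro conjI expected_lifetime_sum_lower expected_lifetime_sum_upper, auto)
  moreover have "0 < (1 / (real k + 1)) ^ Suc k * (1 / 8) ^ (Suc k choose 2) / 16" by simp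
  moreover have "0 < 1 + (2 * real (k + 2) * real (k + 1 + ?m)) ^ ?m"
    by (intro add_pos_nonneg zero_le_power) auto
  ultimately show ?thesis by blast
qed

end
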